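(* Consider a $GI/GI/m/\infty$ queue ($m\ge1$ servers, first-come-first-served) with i.i.d. interarrival times of mean $a$ and independent i.i.d. service times $\{\sigma_n\}$ of mean $b$, with $\rho\equiv\frac{b}{ma}\in(0,1)$, and assume $\mathbf{P}(\sigma_1>x)=\overline{F}(x)$, where both distributions $F$ and $F^s$ are subexponential. Then the stationary maximal dater $Z$ (defined in the context) satisfies, as $x\to\infty$, $$\mathbf{P}(Z>x)=(1+o(1))\left(\frac1a\overline{F}^s(x)+\Bigl(\frac{1}{ma-b}-\frac1a\Bigr)^+\overline{F}^s\Bigl(\frac{bx}{b-(m-1)a}\Bigr)\right),$$ where the second term in the parentheses is $0$ when $b\le(m-1)a$.
   Context: $\overline{F}=1-F$, and $F^s$ is the integrated tail distribution, with tail $\overline{F}^s(x)=\min\{1,\int_x^\infty\overline{F}(u)\,du\}$; $c^+=\max(c,0)$. Customers $n\in\mathbb{Z}$ have arrival epochs $T_n$, interarrival times $\tau_n=T_{n+1}-T_n\ge 0$ and service times $\sigma_n\ge 0$; $\{\tau_n\}$ and $\{\sigma_n\}$ are mutually independent i.i.d. sequences. For $k\ge0$, start the system empty at customer $-k$: let $W_{-k}=(0,\ldots,0)\in\mathbb{R}^m$ and define the Kiefer–Wolfowitz workload vectors by $$W_{n+1}=\mathbf{R}(W_n+\mathbf{e}_1\sigma_n-\mathbf{i}\tau_n)^+,\qquad n\ge-k,$$ with $\mathbf{e}_1=(1,0,\ldots,0)$, $\mathbf{i}=(1,\ldots,1)$, the positive part taken componentwise, and $\mathbf{R}$ the operator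 rearranging the components of a vector in nondecreasing order. The maximal dater is $Z_{[-k,0]}=\max(W_0^{(1)}+\sigma_0,\,W_0^{(m)})$ (the time from the arrival of customer $0$ until all customers present, including customer $0$, have left), which is nondecreasing in $k$; the stationary maximal dater is $Z=\lim_{k\to\infty}Z_{[-k,0]}$. *)

theory Defs
  imports "HOL-Probability.Probability" "HOL-Library.Landau_Symbols"
begin

definition tail :: "real measure \<Rightarrow> real \<Rightarrow> real" where
  "tail \<mu> x = measure \<mu> {x<..}"

(* A distribution on the half-line is subexponential if its support is unbounded and the
   tail of its convolution square is asymptotically twice its own tail.  A distribution that
   also charges the negative half-line is read through its positive part, i.e. the law of
   max 0 X; for a distribution on the half-line nothing changes.  This matters for the
   integrated tail distribution, which charges [b - 1, 0) when the mean b is less than 1. *)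
definition subexponential :: "real measure \<Rightarrow> bool" where
  "subexponential \<mu> \<longleftrightarrow>
     (let \<nu> = distr \<mu> borel (max 0)
      in (\<forall>x. tail \<nu> x > 0) \<and> tail (\<nu> \<star> \<nu>) \<sim>[at_top] (\<lambda>x. 2 * tail \<nu> x))"

definition integrated_tail :: "real measure \<Rightarrow> real \<Rightarrow> real" where
  "integrated_tail F x = min 1 (LBINT u:{x<..}. tail F u)"

definition integrated_tail_distribution :: "real measure \<Rightarrow> real measure" where
  "integrated_tail_distribution F = interval_measure (\<lambda>x. 1 - integrated_tail F x)"

definition (in prob_space) iid :: "(int \<Rightarrow> 'a \<Rightarrow> real) \<Rightarrow> bool" where
  "iid X \<longleftrightarrow> indep_vars (\<lambda>_. borel) X UNIV \<and>
     (\<forall>n. distr M borel (X n) = distr M borel (X 0))"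

(* Independence of the two sequences as random elements of the path space. *)
definition (in prob_space) indep_seqs ::
    "(int \<Rightarrow> 'a \<Rightarrow> real) \<Rightarrow> (int \<Rightarrow> 'a \<Rightarrow> real) \<Rightarrow> bool" where
  "indep_seqs X Y \<longleftrightarrow>
     indep_var (\<Pi>\<^sub>M n\<in>UNIV. borel) (\<lambda>\<omega> n. X n \<omega>) (\<Pi>\<^sub>M n\<in>UNIV. borel) (\<lambda>\<omega> n. Y n \<omega>)"

(* Workload vectors are lists of length m; component i of the vector is entry i - 1. *)
definition kw_step :: "real \<Rightarrow> real \<Rightarrow> real list \<Rightarrow> real list" where
  "kw_step s t w = sort (map (\<lambda>v. max 0 (v - t)) (w[0 := w ! 0 + s]))"

(* For realisations s, t of the service and interarrival times, kw_workload m s t n j is the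
   workload vector found by customer n + j when the system starts empty at customer n. *)
primrec kw_workload ::
    "nat \<Rightarrow> (int \<Rightarrow> real) \<Rightarrow> (int \<Rightarrow> real) \<Rightarrow> int \<Rightarrow> nat \<Rightarrow> real list" where
  "kw_workload m s t n 0 = replicate m 0"
| "kw_workload m s t n (Suc j) =
     kw_step (s (n + int j)) (t (n + int j)) (kw_workload m s t n j)"

definition maximal_dater :: "nat \<Rightarrow> (int \<Rightarrow> real) \<Rightarrow> (int \<Rightarrow> real) \<Rightarrow> nat \<Rightarrow> real" where
  "maximal_dater m s t k =
     (let w = kw_workload m s t (- int k) k in max (w ! 0 + s 0) (w ! (m - 1)))"

(* For nonnegative times the dater is nondecreasing in k, so the extended real limit exists. *)
definition stationary_maximal_dater :: "nat \<Rightarrow> (int \<Rightarrow> real) \<Rightarrow> (int \<Rightarrow> real) \<Rightarrow> ereal" where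
  "stationary_maximal_dater m s t = lim (\<lambda>k. ereal (maximal_dater m s t k))"

end

theory Submission
  imports Defs
begin

text \<open>
The stationary maximal dater is large because one customer in the past brought a large service
time. Number the past backwards: customer \<open>-j\<close> contributes its service time and the
interarrival time just before it, and these pairs are independent and identically distributed.
Suppose that customer \<open>-i\<close> brings a job of size \<open>s\<close> while everything else
follows the law of large numbers. When customer \<open>0\<close> arrives, the server of the big
job still has about \<open>s - i a\<close> to do. If the other \<open>m - 1\<close> servers are
overloaded meanwhile, they fill up until all workloads are equal, and from then on the total
work \<open>s - i (m a - b)\<close> is shared evenly. So the dater exceeds \<open>x\<close> precisely
when \<open>s\<close> exceeds \<open>min (x + i a) (m x + i (m a - b))\<close>. Adding the tail of the
service law at these thresholds over all \<open>i\<close> gives, up to a negligible error, the mean of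
\<open>max ((s - x) / a) ((s - m x) / (m a - b))\<close>, cut off at \<open>0\<close>. This convex, piecewise
linear function of \<open>s\<close> bends at \<open>x\<close> and, if \<open>b > (m - 1) a\<close>, again at
\<open>b x / (b - (m - 1) a)\<close>, which is where the two integrated tails come from
(\<open>fluid_tail_eq\<close>).

The lower bound (\<open>overflow_lower\<close>) needs two elementary inequalities: the dater is at least
the remaining time of any job, and at least the total work divided by \<open>m\<close>. The events that
customer \<open>-i\<close> is the most recent one above its threshold and that the partial sums behave are
disjoint, so their probabilities simply add up.

The upper bound (\<open>overflow_upper\<close>) rests on three facts.

\<^item> The dater is dominated by the maximum of a random walk with negative drift
(\<open>past_dater_le_walk\<close>). The walk comes from the water level that the workloads reach when a
large extra volume \<open>K\<close> is poured on top of them: the reserve absorbs the unevenness of the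
workloads, so the level behaves like the workload of a single server that is \<open>m\<close> times as
fast.

\<^item> This maximum can exceed \<open>x\<close> only through one big increment, up to a probability that
is negligible against the integrated tail (\<open>no_big_jump\<close>). This is a renewal argument at the
first passage above a slowly descending line. Two substantial passages would have to share the
excess, which subexponentiality of the integrated tail makes negligible. The argument bounds the
tail of the maximum by a multiple of the integrated tail at the same time
(\<open>sup_tail_bound\<close>), because the bound reproduces itself with a factor below one.

\<^item> A job below its fluid threshold does not make the dater exceed \<open>x\<close>, provided that the
other customers behave typically (\<open>no_overflow_given_typical\<close>). Typical behaviour does not
depend on the job in question, so it can be factored out, and its failure costs only a small
fraction of the probability of a big increment.

In both bounds the slope of the thresholds is changed by a factor close to \<open>1\<close>, which changes
the sum by about the same factor, and their height by a constant. The latter does not matter: the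
integrated tail is long-tailed, hence the tail of the service law itself is negligible against it
(\<open>exceed_negligible\<close>).
\<close>

section \<open>Subexponential distributions on the half-line\<close>

lemma asymp_equiv_eventually_le:
  fixes f g :: "real \<Rightarrow> real"
  assumes "f \<sim>[at_top] g" "\<And>x. g x > 0" "e > 0"
  shows "\<forall>\<^sub>F x in at_top. f x \<le> (1 + e) * g x"
proof -
  have "((\<lambda>x. if f x = 0 \<and> g x = 0 then 1 else f x / g x) \<longlongrightarrow> 1) at_top"
    using assms(1) by (simp add: asymp_equiv_def)
  then have "\<forall>\<^sub>F x in at_top. (if f x = 0 \<and> g x = 0 then 1 else f x / g x) < 1 + e"
    using assms(3) by (intro order_tendstoD) auto
  then show ?thesis
  proof eventually_elim
    case (elim x)
    then show ?case using assms(2)[of x] by (simp add: field_simps)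
  qed
qed

locale subexponential_halfline =
  fixes \<nu> :: "real measure"
  assumes rd: "real_distribution \<nu>"
    and halfline: "AE y in \<nu>. 0 \<le> y"
    and tail_pos: "\<And>x. tail \<nu> x > 0"
    and convolution_tail: "tail (\<nu> \<star> \<nu>) \<sim>[at_top] (\<lambda>x. 2 * tail \<nu> x)"
begin

sublocale real_distribution \<nu> by (rule rd)

lemma tail_mono: "x \<le> y \<Longrightarrow> tail \<nu> y \<le> tail \<nu> x"
  unfolding tail_def by (rule finite_measure_mono) auto

lemma tail_le_1: "tail \<nu> x \<le> 1"
  unfolding tail_def by (rule prob_le_1)

lemma tail_neg:
  assumes "x < 0" shows "tail \<nu> x = 1"
proof -
  have "AE y in \<nu>. y \<in> {x<..}"
    using halfline by (rule AE_mp) (rule AE_I2, use assms in auto)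
  then show ?thesis unfolding tail_def by (simp add: prob_eq_1)
qed

lemma measurable_tail [measurable]: "tail \<nu> \<in> borel_measurable borel"
proof -
  have "mono (\<lambda>x. - tail \<nu> x)" using tail_mono by (auto simp: mono_def)
  then have "(\<lambda>x. - (- tail \<nu> x)) \<in> borel_measurable borel"
    by (intro borel_measurable_uminus borel_measurable_mono)
  then show ?thesis by simp
qed

lemma integrable_tail_bounded:
  assumes [measurable]: "f \<in> borel_measurable borel" and "\<And>y. \<bar>f y\<bar> \<le> (1::real)"
  shows "integrable \<nu> f"
  using assms(2) by (intro integrable_const_bound[of _ 1]) auto

lemma tail_tendsto_0: "(tail \<nu> \<longlongrightarrow> 0) at_top"
proof -
  have "tail \<nu> = (\<lambda>x. 1 - cdf \<nu> x)"
  proof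
    fix x
    have "{x<..} = space \<nu> - {..x}" by auto
    then show "tail \<nu> x = 1 - cdf \<nu> x"
      unfolding tail_def cdf_def by (metis prob_compl atMost_borel events_eq_borel)
  qed
  then show ?thesis using tendsto_diff[OF tendsto_const cdf_lim_at_top_prob, of 1] by simp
qed

lemma tail_convolution: "tail (\<nu> \<star> \<nu>) x = (LINT y|\<nu>. tail \<nu> (x - y))"
proof -
  have "emeasure (\<nu> \<star> \<nu>) {x<..} = (\<integral>\<^sup>+y. emeasure \<nu> {z. z + y \<in> {x<..}} \<partial>\<nu>)"
    by (rule convolution_emeasure) (auto simp: finite_measure_axioms)
  also have "\<dots> = (\<integral>\<^sup>+y. ennreal (tail \<nu> (x - y)) \<partial>\<nu>)"
  proof (rule nn_integral_cong)
    fix y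
    have "{z. z + y \<in> {x<..}} = {x - y<..}" by auto
    then show "emeasure \<nu> {z. z + y \<in> {x<..}} = ennreal (tail \<nu> (x - y))"
      by (simp add: tail_def emeasure_eq_measure)
  qed
  also have "\<dots> = ennreal (LINT y|\<nu>. tail \<nu> (x - y))"
    using tail_le_1 tail_pos
    by (intro nn_integral_eq_integral integrable_tail_bounded) (auto simp: less_imp_le)
  finally show ?thesis
    using tail_pos by (simp add: tail_def measure_def less_imp_le integral_nonneg)
qed

lemma integral_indicator_Ioc:
  assumes "p \<le> q" shows "(LINT y|\<nu>. indicator {p<..q} y) = tail \<nu> p - tail \<nu> q"
proof -
  have "{p<..q} = {p<..} - {q<..}" by auto
  then have "prob {p<..q} = tail \<nu> p - tail \<nu> q"
    unfolding tail_def using assms by (metis borel_open events_eq_borel finite_measure_Diff greaterThan_subset_iff open_greaterThan)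
  then show ?thesis by simp
qed

lemma integral_indicator_atMost: "(LINT y|\<nu>. indicator {..p} y) = 1 - tail \<nu> p"
proof -
  have "{..p} = space \<nu> - {p<..}" by auto
  then have "prob {..p} = 1 - tail \<nu> p"
    unfolding tail_def by (metis borel_open events_eq_borel open_greaterThan prob_compl)
  then show ?thesis by simp
qed

lemma tail_convolution_le:
  assumes "e > 0" shows "\<forall>\<^sub>F x in at_top. tail (\<nu> \<star> \<nu>) x \<le> (2 + e) * tail \<nu> x"
  using asymp_equiv_eventually_le[OF convolution_tail, of "e / 2"] assms tail_pos
  by (auto simp: algebra_simps)

text \<open>
If the convolution square exceeds \<open>x\<close>, the first summand is at most \<open>d\<close>, or lies in
\<open>(d, x]\<close>, or is above \<open>x\<close>. If the tail dropped by a fixed factor between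
\<open>x - d\<close> and \<open>x\<close>, the middle part would contribute too much for a total of
\<open>2 * tail \<nu> x\<close>.
\<close>
lemma long_tailed:
  assumes d: "0 \<le> d" and e: "e > 0"
  shows "\<forall>\<^sub>F x in at_top. tail \<nu> (x - d) \<le> (1 + e) * tail \<nu> x"
proof -
  let ?T = "tail \<nu>"
  define p where "p = ?T d"
  have p: "p > 0" "p \<le> 1" using tail_pos tail_le_1 by (auto simp: p_def)
  have ineq: "?T x * (1 - p) + ?T (x - d) * (p - ?T x) + ?T x \<le> tail (\<nu> \<star> \<nu>) x" if "d \<le> x" for x
  proof -
    have "?T x * (1 - p) + ?T (x - d) * (p - ?T x) + ?T x
      = (LINT y|\<nu>. ?T x * indicator {..d} y + ?T (x - d) * indicator {d<..x} y + indicator {x<..} y)"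
      using that by (simp add: integral_indicator_atMost[simplified] integral_indicator_Ioc[simplified] p_def tail_def integrable_tail_bounded)
    also have "\<dots> \<le> (LINT y|\<nu>. ?T (x - y))"
    proof (rule integral_mono_AE)
      show "AE y in \<nu>. ?T x * indicator {..d} y + ?T (x - d) * indicator {d<..x} y + indicator {x<..} y \<le> ?T (x - y)"
        using halfline
      proof eventually_elim
        case (elim y)
        consider "y \<le> d" | "d < y" "y \<le> x" | "x < y" by linarith
        then show ?case
          using that d elim tail_neg[of "x - y"] tail_mono[of "x - y" x] tail_mono[of "x - y" "x - d"]
          by cases (auto simp: indicator_def)
      qed
    next
      show "integrable \<nu> (\<lambda>y. ?T x * indicator {..d} y + ?T (x - d) * indicator {d<..x} y + indicator {x<..} y)"
        by (intro Bochner_Integration.integrable_add integrable_mult_right integrable_tail_bounded) auto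
      show "integrable \<nu> (\<lambda>y. ?T (x - y))"
        by (intro integrable_tail_bounded) (auto simp: tail_le_1 tail_pos less_imp_le)
    qed
    finally show ?thesis by (simp add: tail_convolution)
  qed
  have "\<forall>\<^sub>F x in at_top. (1 + e) * ?T x < 3 * e * p / 4"
    using tendsto_mult[OF tendsto_const tail_tendsto_0, of "1 + e"] e p
    by (intro order_tendstoD(2)[of _ "(1 + e) * 0"]) auto
  moreover have "\<forall>\<^sub>F x in at_top. tail (\<nu> \<star> \<nu>) x \<le> (2 + e * p / 4) * ?T x"
    using e p by (intro tail_convolution_le) auto
  moreover have "\<forall>\<^sub>F x in at_top. d \<le> x" by (rule eventually_ge_at_top)
  ultimately show ?thesis
  proof eventually_elim
    case (elim x)
    have pos: "p - ?T x > 0"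
    proof -
      have "0 < e * p" using e p by simp
      then have "(1 + e) * ?T x < (1 + e) * p" using elim(1) p by (simp add: algebra_simps)
      then show ?thesis using e by simp
    qed
    have "?T (x - d) * (p - ?T x) \<le> (p + e * p / 4) * ?T x"
      using ineq[OF elim(3)] elim(2) by (simp add: algebra_simps)
    also have "\<dots> \<le> (1 + e) * (p - ?T x) * ?T x"
      using elim(1) tail_pos[of x] by (intro mult_right_mono) (auto simp: algebra_simps)
    finally have "?T (x - d) * (p - ?T x) \<le> ((1 + e) * ?T x) * (p - ?T x)" by (simp add: ac_simps)
    then show ?case using pos by simp
  qed
qed

text \<open>
The two cases where one summand stays below \<open>h\<close> already account for almost all of
\<open>2 * tail \<nu> x\<close>. So a large sum hardly ever consists of two substantial summands.
\<close>
lemma convolution_middle_small: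
  assumes e: "e > 0"
  shows "\<exists>h0\<ge>0. \<forall>h\<ge>h0. \<forall>\<^sub>F x in at_top.
    (LINT y|\<nu>. indicator {h<..x - h} y * tail \<nu> (x - y)) \<le> e * tail \<nu> x"
proof -
  let ?T = "tail \<nu>"
  have "\<forall>\<^sub>F h in at_top. ?T h < e / 2" using tail_tendsto_0 e by (intro order_tendstoD) auto
  then obtain h1 where h1: "\<And>h. h \<ge> h1 \<Longrightarrow> ?T h < e / 2" by (auto simp: eventually_at_top_linorder)
  show ?thesis
  proof (intro exI[of _ "max 0 h1"] conjI allI impI)
    fix h assume h: "max 0 h1 \<le> h"
    have ineq: "?T x * (1 - ?T h) + (LINT y|\<nu>. indicator {h<..x - h} y * ?T (x - y)) + ?T x
        \<le> tail (\<nu> \<star> \<nu>) x" if "2 * h \<le> x" for x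
    proof -
      have i: "integrable \<nu> (\<lambda>y. indicator {h<..x - h} y * ?T (x - y))"
        using tail_le_1 tail_pos
        by (intro integrable_tail_bounded) (auto simp: indicator_def less_imp_le abs_of_pos)
      have "?T x * (1 - ?T h) + (LINT y|\<nu>. indicator {h<..x - h} y * ?T (x - y)) + ?T x
        = (LINT y|\<nu>. ?T x * indicator {..h} y + indicator {h<..x - h} y * ?T (x - y) + indicator {x<..} y)"
        using i by (simp add: integral_indicator_atMost[simplified] tail_def integrable_tail_bounded)
      also have "\<dots> \<le> (LINT y|\<nu>. ?T (x - y))"
      proof (rule integral_mono_AE)
        show "AE y in \<nu>. ?T x * indicator {..h} y + indicator {h<..x - h} y * ?T (x - y) + indicator {x<..} y \<le> ?T (x - y)"
          using halfline
        proof eventually_elim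
          case (elim y)
          consider "y \<le> h" | "h < y" "y \<le> x" | "x < y" by linarith
          then show ?case
            using that h elim tail_neg[of "x - y"] tail_mono[of "x - y" x] tail_pos[of "x - y"]
            by cases (auto simp: indicator_def)
        qed
      next
        show "integrable \<nu> (\<lambda>y. ?T x * indicator {..h} y + indicator {h<..x - h} y * ?T (x - y) + indicator {x<..} y)"
          by (intro Bochner_Integration.integrable_add integrable_mult_right i integrable_tail_bounded) auto
        show "integrable \<nu> (\<lambda>y. ?T (x - y))"
          by (intro integrable_tail_bounded) (auto simp: tail_le_1 tail_pos less_imp_le)
      qed
      finally show ?thesis by (simp add: tail_convolution)
    qed
    have "\<forall>\<^sub>F x in at_top. tail (\<nu> \<star> \<nu>) x \<le> (2 + e / 2) * ?T x"
      using e by (intro tail_convolution_le) auto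
    moreover have "\<forall>\<^sub>F x in at_top. 2 * h \<le> x" by (rule eventually_ge_at_top)
    ultimately show "\<forall>\<^sub>F x in at_top. (LINT y|\<nu>. indicator {h<..x - h} y * ?T (x - y)) \<le> e * ?T x"
    proof eventually_elim
      case (elim x)
      have "?T h * ?T x \<le> e / 2 * ?T x"
        using h1[of h] h tail_pos[of x] by (intro mult_right_mono) auto
      then show ?case using ineq[OF elim(2)] elim(1) by (simp add: algebra_simps)
    qed
  qed auto
qed

end

section \<open>Kiefer--Wolfowitz workload vectors\<close>

lemma nth_le_iff_length_filter:
  fixes xs :: "'a::linorder list"
  assumes "sorted xs" "i < length xs"
  shows "xs ! i \<le> v \<longleftrightarrow> i < length (filter (\<lambda>x. x \<le> v) xs)"
  using assms
proof (induction xs arbitrary: i)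
  case (Cons y ys)
  show ?case
  proof (cases "y \<le> v")
    case True
    then show ?thesis using Cons by (cases i) auto
  next
    case False
    then have e: "filter (\<lambda>x. x \<le> v) (y # ys) = []"
      using Cons.prems(1) by (auto simp: filter_empty_conv)
    have "y \<le> (y # ys) ! i" using Cons.prems by (cases i) auto
    then show ?thesis unfolding e using False by auto
  qed
qed simp

text \<open>
Order statistics by counting. Both monotonicity and measurability of sorting are immediate in this
form.
\<close>
lemma nth_sort_le_iff:
  fixes xs :: "'a::linorder list"
  assumes "i < length xs"
  shows "sort xs ! i \<le> v \<longleftrightarrow> i < card {k. k < length xs \<and> xs ! k \<le> v}"
  using nth_le_iff_length_filter[of "sort xs" i v] assms
  by (simp add: filter_sort length_filter_conv_card)

lemma nth_sort_mono:
  fixes xs ys :: "real list"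
  assumes "length xs = length ys" "\<And>k. k < length ys \<Longrightarrow> xs ! k \<le> ys ! k + c" "i < length ys"
  shows "sort xs ! i \<le> sort ys ! i + c"
proof -
  have "i < card {k. k < length ys \<and> ys ! k \<le> sort ys ! i}"
    using nth_sort_le_iff[of i ys "sort ys ! i"] assms(3) by simp
  also have "\<dots> \<le> card {k. k < length xs \<and> xs ! k \<le> sort ys ! i + c}"
    using assms(1,2) by (intro card_mono) (auto, fastforce)
  finally show ?thesis using nth_sort_le_iff[of i xs] assms by simp
qed

definition workload_vector :: "nat \<Rightarrow> real list \<Rightarrow> bool" where
  "workload_vector m w \<longleftrightarrow> length w = m \<and> sorted w \<and> (\<forall>v\<in>set w. 0 \<le> v)"

lemma length_kw_step [simp]: "length (kw_step s t w) = length w"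
  by (simp add: kw_step_def)

lemma workload_vector_kw_step: "length w = m \<Longrightarrow> workload_vector m (kw_step s t w)"
  by (auto simp: workload_vector_def kw_step_def)

lemma length_kw_workload [simp]: "length (kw_workload m s t n j) = m"
  by (induction j) auto

lemma workload_vector_kw_workload: "workload_vector m (kw_workload m s t n j)"
proof (cases j)
  case 0
  then show ?thesis by (auto simp: workload_vector_def)
qed (simp add: workload_vector_kw_step)

lemma workload_vector_nth:
  assumes "workload_vector m w" "i < m"
  shows "w ! 0 \<le> w ! i" "w ! i \<le> w ! (m - 1)" "0 \<le> w ! i"
  using assms sorted_nth_mono[of w 0 i] sorted_nth_mono[of w i "m - 1"] nth_mem[of i w]
  by (auto simp: workload_vector_def)

lemma workload_vector_sum:
  assumes "workload_vector m w"
  shows "sum_list w = (\<Sum>i<m. w ! i)"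
  using assms unfolding workload_vector_def sum_list_sum_nth by (simp add: atLeast0LessThan)

text \<open>
A symmetric function of the workloads does not see the sorting.
\<close>
lemma sum_kw_step:
  fixes f :: "real \<Rightarrow> real"
  assumes "length w = m" "m \<ge> 1"
  shows "(\<Sum>i<m. f (kw_step s t w ! i)) = (\<Sum>i<m. f (max 0 (w ! i + (if i = 0 then s else 0) - t)))"
proof -
  let ?u = "map (\<lambda>v. max 0 (v - t)) (w[0 := w ! 0 + s])"
  have "(\<Sum>i<m. f (kw_step s t w ! i)) = sum_list (map f (kw_step s t w))"
    using assms by (simp add: sum_list_sum_nth atLeast0LessThan)
  also have "\<dots> = sum_list (map f ?u)"
    unfolding kw_step_def sum_mset_sum_list[symmetric] mset_map mset_sort ..
  also have "\<dots> = (\<Sum>i<m. map f ?u ! i)"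
    using assms by (simp add: sum_list_sum_nth atLeast0LessThan)
  also have "\<dots> = (\<Sum>i<m. f (max 0 (w ! i + (if i = 0 then s else 0) - t)))"
  proof (intro sum.cong refl)
    fix i assume "i \<in> {..<m}"
    then show "map f ?u ! i = f (max 0 (w ! i + (if i = 0 then s else 0) - t))"
      using assms by (cases "i = 0") simp_all
  qed
  finally show ?thesis .
qed

lemma sum_list_kw_step:
  assumes "length w = m" "m \<ge> 1"
  shows "sum_list (kw_step s t w) = (\<Sum>i<m. max 0 (w ! i + (if i = 0 then s else 0) - t))"
  using sum_kw_step[OF assms, of "\<lambda>x. x" s t] assms
  by (simp add: sum_list_sum_nth atLeast0LessThan)

lemma kw_step_last:
  assumes w: "workload_vector m w" and m: "m \<ge> 1" and s: "0 \<le> s"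
  shows "kw_step s t w ! (m - 1) = max 0 (max (w ! 0 + s) (w ! (m - 1)) - t)"
proof -
  define u where "u = map (\<lambda>v. max 0 (v - t)) (w[0 := w ! 0 + s])"
  have len: "length w = m" "length u = m" using w by (auto simp: workload_vector_def u_def)
  have u: "u ! i = max 0 (w ! i + (if i = 0 then s else 0) - t)" if "i < m" for i
    using that len by (auto simp: u_def nth_list_update)
  have st: "kw_step s t w = sort u" by (simp add: kw_step_def u_def)
  have "sort u ! (m - 1) \<in> set (sort u)"
    using len m by (intro nth_mem) simp
  then have "sort u ! (m - 1) \<in> set u" by simp
  then obtain i where i: "i < m" "sort u ! (m - 1) = u ! i" using len by (metis in_set_conv_nth)
  have ge: "x \<le> sort u ! (m - 1)" if "x \<in> set u" for x
  proof -
    from that have "x \<in> set (sort u)" by simp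
    then obtain k where "k < m" "x = sort u ! k" using len by (metis in_set_conv_nth length_sort)
    then show ?thesis
      using len m by (auto intro!: sorted_nth_mono)
  qed
  show ?thesis
  proof (rule antisym)
    have "u ! i \<le> max 0 (max (w ! 0 + s) (w ! (m - 1)) - t)"
      using workload_vector_nth(2)[OF w i(1)] u[OF i(1)] by auto
    then show "kw_step s t w ! (m - 1) \<le> max 0 (max (w ! 0 + s) (w ! (m - 1)) - t)"
      using st i by simp
    have "u ! 0 \<in> set u" "u ! (m - 1) \<in> set u" using len m by auto
    then have "u ! 0 \<le> sort u ! (m - 1)" "u ! (m - 1) \<le> sort u ! (m - 1)" using ge by auto
    then show "max 0 (max (w ! 0 + s) (w ! (m - 1)) - t) \<le> kw_step s t w ! (m - 1)"
      using st u[of 0] u[of "m - 1"] m s by (cases "m = 1") (auto simp: max_def split: if_splits)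
  qed
qed

lemma kw_step_first_ge:
  assumes w: "workload_vector m w" and m: "m \<ge> 1" and s: "0 \<le> s"
  shows "max 0 (w ! 0 - t) \<le> kw_step s t w ! 0"
proof -
  have len: "length w = m" using w by (auto simp: workload_vector_def)
  let ?u = "map (\<lambda>v. max 0 (v - t)) (w[0 := w ! 0 + s])"
  have "kw_step s t w ! 0 \<in> set (kw_step s t w)" using len m by (intro nth_mem) simp
  then have "kw_step s t w ! 0 \<in> set ?u" by (simp only: kw_step_def set_sort)
  then obtain i where "i < length ?u" and u: "?u ! i = kw_step s t w ! 0"
    unfolding in_set_conv_nth by blast
  then have i': "i < m" "kw_step s t w ! 0 = ?u ! i" using len by simp_all
  have i: "i < m" "kw_step s t w ! 0 = max 0 (w ! i + (if i = 0 then s else 0) - t)"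
    using i' len by (cases "i = 0"; simp)+
  show ?thesis unfolding i(2) using workload_vector_nth(1)[OF w i(1)] s by (cases "i = 0") simp_all
qed

lemma sum_kw_step_ge:
  assumes w: "workload_vector m w" and m: "m \<ge> 1"
  shows "sum_list w + s - real m * t \<le> sum_list (kw_step s t w)"
proof -
  have len: "length w = m" using w by (auto simp: workload_vector_def)
  have "sum_list w + s - real m * t = (\<Sum>i<m. w ! i + (if i = 0 then s else 0) - t)"
    using m by (simp add: workload_vector_sum[OF w] sum.distrib sum_subtractf sum.delta)
  also have "\<dots> \<le> sum_list (kw_step s t w)"
    unfolding sum_list_kw_step[OF len m] by (intro sum_mono) auto
  finally show ?thesis .
qed

text \<open>
If nobody is idle after the step, no server capacity was wasted.
\<close>
lemma sum_kw_step_eq: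
  assumes w: "workload_vector m w" and m: "m \<ge> 1" and ne: "kw_step s t w ! 0 \<noteq> 0"
  shows "sum_list (kw_step s t w) = sum_list w + s - real m * t"
proof -
  have len: "length w = m" using w by (auto simp: workload_vector_def)
  let ?u = "map (\<lambda>v. max 0 (v - t)) (w[0 := w ! 0 + s])"
  have v: "workload_vector m (kw_step s t w)" using len by (rule workload_vector_kw_step)
  have pos: "kw_step s t w ! 0 > 0" using ne workload_vector_nth(3)[OF v, of 0] m by auto
  have "max 0 (w ! i + (if i = 0 then s else 0) - t) = w ! i + (if i = 0 then s else 0) - t" if "i < m" for i
  proof -
    have ui: "?u ! i = max 0 (w ! i + (if i = 0 then s else 0) - t)"
      using that len by (cases "i = 0") simp_all
    have "?u ! i \<in> set ?u" using that len by (intro nth_mem) simp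
    then have "?u ! i \<in> set (kw_step s t w)" by (simp only: kw_step_def set_sort)
    then obtain k where "k < length (kw_step s t w)" and k': "kw_step s t w ! k = ?u ! i"
      unfolding in_set_conv_nth by blast
    then have k: "k < m" "?u ! i = kw_step s t w ! k" using len by simp_all
    then have "?u ! i > 0" using pos workload_vector_nth(1)[OF v k(1)] by linarith
    then show ?thesis unfolding ui by linarith
  qed
  then have "sum_list (kw_step s t w) = (\<Sum>i<m. w ! i + (if i = 0 then s else 0) - t)"
    unfolding sum_list_kw_step[OF len m] by (intro sum.cong) auto
  also have "\<dots> = sum_list w + s - real m * t"
    using m by (simp add: workload_vector_sum[OF w] sum.distrib sum_subtractf sum.delta)
  finally show ?thesis .
qed

lemma kw_step_mono:
  assumes "length w = m" "length v = m" "m \<ge> 1" "0 \<le> c"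
    and "\<And>i. i < m \<Longrightarrow> w ! i \<le> v ! i + c" "i < m"
  shows "kw_step s t w ! i \<le> kw_step s t v ! i + c"
proof -
  have "max 0 (w[0 := w ! 0 + s] ! k - t) \<le> max 0 (v[0 := v ! 0 + s] ! k - t) + c" if "k < m" for k
  proof (cases "k = 0")
    case True
    then show ?thesis using assms(1-4) assms(5)[of 0] by (simp add: max_def)
  next
    case False
    then show ?thesis using assms(1-4) assms(5)[OF that] by (simp add: max_def)
  qed
  then show ?thesis
    unfolding kw_step_def using assms by (intro nth_sort_mono) auto
qed


text \<open>
Starting one customer earlier replaces the zero vector by a nonnegative one, and the
Kiefer--Wolfowitz step is monotone.
\<close>
lemma kw_workload_mono:
  assumes "m \<ge> 1" "i < m"
  shows "kw_workload m s t n j ! i \<le> kw_workload m s t (n - 1) (Suc j) ! i"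
  using assms(2)
proof (induction j arbitrary: i)
  case 0
  then show ?case
    using workload_vector_nth(3)[OF workload_vector_kw_workload[of m s t "n - 1" "Suc 0"] 0] by simp
next
  case (Suc j)
  have "kw_step (s (n + int j)) (t (n + int j)) (kw_workload m s t n j) ! i
      \<le> kw_step (s (n + int j)) (t (n + int j)) (kw_workload m s t (n - 1) (Suc j)) ! i + 0"
    using assms(1) Suc by (intro kw_step_mono) (auto simp del: kw_workload.simps)
  then show ?case by simp
qed

lemma maximal_dater_mono:
  assumes "m \<ge> 1" "j \<le> k"
  shows "maximal_dater m s t j \<le> maximal_dater m s t k"
proof (rule lift_Suc_mono_le[OF _ assms(2)])
  fix k
  have eq: "- int (Suc k) = - int k - 1" by simp
  show "maximal_dater m s t k \<le> maximal_dater m s t (Suc k)"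
    using kw_workload_mono[of m 0 s t "- int k" k] kw_workload_mono[of m "m - 1" s t "- int k" k] assms(1)
    unfolding maximal_dater_def Let_def eq by (intro max.mono) (auto simp del: kw_workload.simps)
qed

lemma kw_workload_cong:
  assumes "\<And>i. i < j \<Longrightarrow> s (n + int i) = s' (n + int i)" "\<And>i. i < j \<Longrightarrow> t (n + int i) = t' (n + int i)"
  shows "kw_workload m s t n j = kw_workload m s' t' n j"
  using assms by (induction j) auto

lemma maximal_dater_cong:
  assumes "\<And>i. i \<le> 0 \<Longrightarrow> s i = s' i" "\<And>i. i < 0 \<Longrightarrow> t i = t' i"
  shows "maximal_dater m s t k = maximal_dater m s' t' k"
  using assms kw_workload_cong[of k s "- int k" s' t t' m] by (simp add: maximal_dater_def)

text \<open>
The time until the system empties, seen by customer \<open>n + j\<close> at its arrival. The maximal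
dater is the case \<open>n = -j\<close>, but induction along the customers needs a fixed start
\<open>n\<close>.
\<close>
definition dater :: "nat \<Rightarrow> (int \<Rightarrow> real) \<Rightarrow> (int \<Rightarrow> real) \<Rightarrow> int \<Rightarrow> nat \<Rightarrow> real" where
  "dater m s t n j =
     max (kw_workload m s t n j ! 0 + s (n + int j)) (kw_workload m s t n j ! (m - 1))"

lemma maximal_dater_eq_dater: "maximal_dater m s t k = dater m s t (- int k) k"
  by (simp add: maximal_dater_def dater_def Let_def)

context
  fixes m :: nat and s t :: "int \<Rightarrow> real" and n :: int
  assumes m: "m \<ge> 1" and s: "\<And>i. 0 \<le> s i" and t: "\<And>i. 0 \<le> t i"
begin

private abbreviation "W j \<equiv> kw_workload m s t n j"

text \<open>
The instant at which the system empties never moves back when further customers arrive.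
\<close>
lemma dater_ge_job:
  assumes "j \<le> k"
  shows "s (n + int j) - (\<Sum>i\<in>{j..<k}. t (n + int i)) \<le> dater m s t n k"
  using assms
proof (induction k rule: dec_induct)
  case base
  then show ?case
    using workload_vector_nth(3)[OF workload_vector_kw_workload, of 0 m s t n j] m
    by (simp add: dater_def)
next
  case (step k)
  have "s (n + int j) - (\<Sum>i\<in>{j..<Suc k}. t (n + int i)) \<le> dater m s t n k - t (n + int k)"
    using step by (simp add: algebra_simps)
  also have "\<dots> \<le> W (Suc k) ! (m - 1)"
    using kw_step_last[OF workload_vector_kw_workload m s] by (simp add: dater_def)
  also have "\<dots> \<le> dater m s t n (Suc k)" unfolding dater_def by (rule max.cobounded2)
  finally show ?case .
qed

text \<open>
The total work decreases at rate \<open>m\<close> at most, also if some servers are idle, and no server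
carries more work than the dater.
\<close>
lemma dater_ge_total_work:
  assumes "j \<le> k"
  shows "(\<Sum>i\<in>{j..k}. s (n + int i)) - real m * (\<Sum>i\<in>{j..<k}. t (n + int i)) \<le> real m * dater m s t n k"
proof -
  have "(\<Sum>i\<in>{j..<k}. s (n + int i)) - real m * (\<Sum>i\<in>{j..<k}. t (n + int i)) \<le> sum_list (W k)"
    using assms
  proof (induction k rule: dec_induct)
    case base
    show ?case
      using workload_vector_kw_workload[of m s t n j] by (auto simp: workload_vector_def intro: sum_list_nonneg)
  next
    case (step k)
    show ?case
      using sum_kw_step_ge[OF workload_vector_kw_workload m, of s t n k "s (n + int k)" "t (n + int k)"] step
      by (simp add: algebra_simps)
  qed
  moreover have "sum_list (W k) + s (n + int k) \<le> real m * dater m s t n k"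
  proof -
    have "sum_list (W k) + s (n + int k) = (\<Sum>i<m. W k ! i + (if i = 0 then s (n + int k) else 0))"
      using m by (simp add: workload_vector_sum[OF workload_vector_kw_workload] sum.distrib)
    also have "\<dots> \<le> (\<Sum>i<m. dater m s t n k)"
      using workload_vector_nth(2)[OF workload_vector_kw_workload[of m s t n k]]
      by (intro sum_mono) (auto simp: dater_def intro: le_max_iff_disj[THEN iffD2])
    finally show ?thesis by simp
  qed
  ultimately show ?thesis
    using sum.atLeastLessThan_Suc[of j k "\<lambda>i. s (n + int i)"] assms
    by (simp add: atLeastLessThanSuc_atLeastAtMost)
qed

end

text \<open>
The water level after an additional volume \<open>K\<close> has been poured onto the workloads, but never
below the highest of them. The reserve \<open>K\<close> serves to absorb single jobs.
\<close>
definition level :: "real \<Rightarrow> real list \<Rightarrow> real" where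
  "level K w = max (w ! (length w - 1)) ((sum_list w + K) / real (length w))"

text \<open>
The largest possible rise of the level caused by a job of size \<open>v\<close>: either the job just adds
its share \<open>v / m\<close>, or it sticks out on top of the least loaded server, which lies at least
\<open>K / m\<close> below the level.
\<close>
definition rise :: "nat \<Rightarrow> real \<Rightarrow> real \<Rightarrow> real" where
  "rise m K v = max (v / real m) (v - K / real m)"

lemma rise_nonneg: "0 \<le> v \<Longrightarrow> 0 \<le> rise m K v"
  by (simp add: rise_def le_max_iff_disj)

lemma first_le_level:
  assumes w: "workload_vector m w" and m: "m \<ge> 1"
  shows "w ! 0 + K / real m \<le> level K w" "w ! (m - 1) \<le> level K w"
proof -
  have len: "length w = m" using w by (auto simp: workload_vector_def)
  have "(\<Sum>i<m. w ! 0) \<le> sum_list w"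
    unfolding workload_vector_sum[OF w] using workload_vector_nth(1)[OF w] by (intro sum_mono) auto
  then have "w ! 0 + K / real m \<le> (sum_list w + K) / real m"
    using m by (simp add: field_simps)
  then show "w ! 0 + K / real m \<le> level K w" by (simp add: level_def len)
  show "w ! (m - 1) \<le> level K w" by (simp add: level_def len)
qed

text \<open>
Lindley's recursion for the level. If an arrival finds an idle server, the remaining \<open>m - 1\<close>
servers and the reserve \<open>K\<close> average to at most the larger of the reduced level and
\<open>K\<close>. Otherwise no capacity is lost, and the level falls
as fast as time passes.
\<close>
lemma level_kw_step:
  assumes w: "workload_vector m w" and m: "m \<ge> 1" and s: "0 \<le> s" and t: "0 \<le> t" and K: "0 \<le> K"
  shows "level K (kw_step s t w) \<le> max (level K w + rise m K s - t) K"
proof -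
  have len: "length w = m" using w by (auto simp: workload_vector_def)
  define w' where "w' = kw_step s t w"
  have w': "workload_vector m w'" unfolding w'_def by (rule workload_vector_kw_step[OF len])
  define z where "z = level K w + rise m K s - t"
  have first: "w ! 0 + s \<le> level K w + rise m K s" "w ! (m - 1) \<le> level K w + rise m K s"
    using first_le_level[OF w m, of K] rise_nonneg[OF s, of m K] by (auto simp: rise_def)
  have last: "w' ! (m - 1) \<le> max 0 z"
    unfolding w'_def kw_step_last[OF w m s] z_def using first by auto
  \<comment> \<open>The highest workload is at most \<open>max 0 z\<close> by now. What remains is the average.\<close>
  have "(sum_list w' + K) / real m \<le> max z K"
  proof (cases "w' ! 0 = 0")
    case True
    have "sum_list w' \<le> (\<Sum>i<m. if i = 0 then 0 else max 0 z)"
      unfolding workload_vector_sum[OF w']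
      using workload_vector_nth(2)[OF w'] True last by (intro sum_mono) (auto intro: order_trans)
    also have "\<dots> = (real m - 1) * max 0 z"
      using m by (cases m) (simp_all add: sum.lessThan_Suc_shift del: sum.lessThan_Suc)
    also have "\<dots> \<le> (real m - 1) * max z K"
      using m K by (intro mult_left_mono) auto
    finally have "sum_list w' + K \<le> real m * max z K" by (simp add: algebra_simps)
    then show ?thesis using m by (simp add: field_simps)
  next
    case False
    have "(sum_list w' + K) / real m = (sum_list w + K) / real m + s / real m - t"
      using sum_kw_step_eq[OF w m False[unfolded w'_def]] m by (simp add: w'_def field_simps)
    also have "\<dots> \<le> z" unfolding z_def level_def len rise_def by simp
    finally show ?thesis by simp
  qed
  moreover have "w' ! (m - 1) \<le> max z K" using last K by auto
  moreover have "length w' = m" using w' by (simp add: workload_vector_def)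
  ultimately show ?thesis unfolding z_def[symmetric] w'_def[symmetric] level_def[of K w'] by simp
qed


text \<open>
Above the height \<open>u + B\<close>, for any \<open>u\<close> not below the least workload, there is no
more work than a single server with workload \<open>R\<close> would have there. This is the case if all
servers but one are balanced up to \<open>B\<close>, and the exceptional server need not be named.
Quantifying over \<open>u\<close> makes the property invariant: the passage of time only shifts
\<open>u\<close>.
\<close>
definition one_exceptional :: "real \<Rightarrow> real \<Rightarrow> real list \<Rightarrow> bool" where
  "one_exceptional B R w \<longleftrightarrow>
     (\<forall>u\<ge>w ! 0. (\<Sum>i<length w. max 0 (w ! i - u - B)) \<le> max 0 (R - u - B))"

text \<open>
A job of size at most \<open>B\<close> goes to the least loaded server, so afterwards it contributes
nothing above \<open>u + B\<close>.
\<close>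
lemma one_exceptional_kw_step:
  assumes w: "workload_vector m w" and m: "m \<ge> 1" and s: "0 \<le> s" "s \<le> B"
    and e: "one_exceptional B R w"
  shows "one_exceptional B (R - t) (kw_step s t w)"
  unfolding one_exceptional_def
proof (intro allI impI)
  have len: "length w = m" using w by (auto simp: workload_vector_def)
  fix u assume u: "kw_step s t w ! 0 \<le> u"
  have ge: "w ! 0 \<le> u + t" "0 \<le> u"
    using u kw_step_first_ge[OF w m s(1), of t] by auto
  have "(\<Sum>i<length (kw_step s t w). max 0 (kw_step s t w ! i - u - B))
      = (\<Sum>i<m. max 0 (max 0 (w ! i + (if i = 0 then s else 0) - t) - u - B))"
    using sum_kw_step[OF len m, of "\<lambda>v. max 0 (v - u - B)"] len by simp
  also have "\<dots> \<le> (\<Sum>i<m. max 0 (w ! i - (u + t) - B))"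
    using s ge by (intro sum_mono) auto
  also have "\<dots> \<le> max 0 (R - (u + t) - B)"
    using e ge len by (auto simp: one_exceptional_def)
  finally show "(\<Sum>i<length (kw_step s t w). max 0 (kw_step s t w ! i - u - B)) \<le> max 0 (R - t - u - B)"
    by (simp add: algebra_simps)
qed

lemma one_exceptional_first:
  assumes w: "workload_vector m w" and m: "m \<ge> 1" and s: "0 \<le> s" and C: "w ! (m - 1) \<le> C" "C \<le> B"
  shows "one_exceptional B (s + C - t) (kw_step s t w)"
  unfolding one_exceptional_def
proof (intro allI impI)
  have len: "length w = m" using w by (auto simp: workload_vector_def)
  fix u assume u: "kw_step s t w ! 0 \<le> u"
  have ge: "w ! 0 \<le> u + t" "0 \<le> u"
    using u kw_step_first_ge[OF w m s, of t] by auto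
  have nn: "0 \<le> C" using workload_vector_nth(3)[OF w, of "m - 1"] m C by simp
  have le: "w ! i \<le> C" if "i < m" for i using workload_vector_nth(2)[OF w that] C by simp
  have "(\<Sum>i<length (kw_step s t w). max 0 (kw_step s t w ! i - u - B))
      = (\<Sum>i<m. max 0 (max 0 (w ! i + (if i = 0 then s else 0) - t) - u - B))"
    using sum_kw_step[OF len m, of "\<lambda>v. max 0 (v - u - B)"] len by simp
  also have "\<dots> \<le> (\<Sum>i<m. if i = 0 then max 0 (s + C - t - u - B) else 0)"
  proof (intro sum_mono)
    fix i assume "i \<in> {..<m}"
    then have "w ! i \<le> C" "w ! 0 \<le> C" "0 \<le> w ! 0" using le m workload_vector_nth(3)[OF w] by auto
    then show "max 0 (max 0 (w ! i + (if i = 0 then s else 0) - t) - u - B)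
        \<le> (if i = 0 then max 0 (s + C - t - u - B) else 0)"
      using ge nn C by (cases "i = 0") auto
  qed
  also have "\<dots> \<le> max 0 (s + C - t - u - B)" using m by simp
  finally show "(\<Sum>i<length (kw_step s t w). max 0 (kw_step s t w ! i - u - B)) \<le> max 0 (s + C - t - u - B)" .
qed

lemma one_exceptionalD:
  assumes w: "workload_vector m w" and m: "m \<ge> 1" and e: "one_exceptional B R w"
  shows "w ! (m - 1) \<le> max R (w ! 0 + B)"
    and "w ! 0 = 0 \<Longrightarrow> 0 \<le> B \<Longrightarrow> sum_list w \<le> real m * B + max 0 R"
proof -
  have len: "length w = m" using w by (auto simp: workload_vector_def)
  have "max 0 (w ! (m - 1) - w ! 0 - B) \<le> (\<Sum>i<m. max 0 (w ! i - w ! 0 - B))"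
    using m by (intro member_le_sum) auto
  also have "\<dots> \<le> max 0 (R - w ! 0 - B)" using e len by (auto simp: one_exceptional_def)
  finally show "w ! (m - 1) \<le> max R (w ! 0 + B)" by auto
  assume 0: "w ! 0 = 0" and B: "0 \<le> B"
  have "sum_list w \<le> (\<Sum>i<m. B + max 0 (w ! i - 0 - B))"
    unfolding workload_vector_sum[OF w] by (intro sum_mono) auto
  also have "\<dots> = real m * B + (\<Sum>i<m. max 0 (w ! i - 0 - B))" by (simp add: sum.distrib)
  also have "(\<Sum>i<m. max 0 (w ! i - 0 - B)) \<le> max 0 (R - 0 - B)"
    using e len 0 unfolding one_exceptional_def by (metis order_refl)
  finally show "sum_list w \<le> real m * B + max 0 R" using B by auto
qed

context
  fixes m :: nat and s t :: "int \<Rightarrow> real" and n :: int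
  assumes m: "m \<ge> 1" and s: "\<And>i. 0 \<le> s i" and t: "\<And>i. 0 \<le> t i"
begin

private abbreviation "V j \<equiv> kw_workload m s t n j"

text \<open>
The recursion of the level, unrolled back to the last customer at which the level was at most
\<open>K\<close>, or to customer \<open>n + j\<close> if there is none.
\<close>
lemma level_kw_workload:
  assumes K: "0 \<le> K" and "j \<le> k"
  shows "level K (V k) \<le> level K (V j) + (\<Sum>i\<in>{j..<k}. rise m K (s (n + int i)) - t (n + int i)) \<or>
    (\<exists>l\<in>{j<..k}. level K (V k) \<le> K + (\<Sum>i\<in>{l..<k}. rise m K (s (n + int i)) - t (n + int i)))"
  using assms(2)
proof (induction k rule: dec_induct)
  case (step k)
  have *: "level K (V (Suc k)) \<le> max (level K (V k) + rise m K (s (n + int k)) - t (n + int k)) K"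
    using level_kw_step[OF workload_vector_kw_workload m s t K] by simp
  show ?case
  proof (cases "level K (V (Suc k)) \<le> K")
    case True
    then show ?thesis using step(1) by (intro disjI2 bexI[of _ "Suc k"]) auto
  next
    case False
    then have le: "level K (V (Suc k)) \<le> level K (V k) + (rise m K (s (n + int k)) - t (n + int k))"
      using * by auto
    from step.IH show ?thesis
    proof (elim disjE bexE)
      fix l assume l: "l \<in> {j<..k}"
        "level K (V k) \<le> K + (\<Sum>i\<in>{l..<k}. rise m K (s (n + int i)) - t (n + int i))"
      then show ?thesis using le by (intro disjI2 bexI[of _ l]) auto
    qed (use le step in auto)
  qed
qed simp

lemma dater_le_level: "dater m s t n k \<le> level K (V k) + rise m K (s (n + int k))"
  using first_le_level[OF workload_vector_kw_workload[of m s t n k] m, of K] rise_nonneg[OF s, of m K "n + int k"]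
  by (auto simp: dater_def rise_def)

text \<open>
After the big job of customer \<open>n + j\<close>, the total work either changes by exactly
\<open>s - m t\<close> or is bounded anew by \<open>m B\<close> and \<open>R l\<close>, namely at the moments
\<open>l\<close> when a server is idle. The last such moment, or \<open>j\<close>, is the index \<open>l\<close> that
is needed. The term with \<open>i = j\<close> is left out because the big job is part of \<open>R j\<close>.
\<close>
lemma workload_after_big_job:
  assumes C: "V j ! (m - 1) \<le> C" "C \<le> B"
    and B: "\<And>i. j < i \<Longrightarrow> i < k \<Longrightarrow> s (n + int i) \<le> B" and k: "j < k"
  defines "R \<equiv> \<lambda>l. s (n + int j) + C - (\<Sum>i\<in>{j..<l}. t (n + int i))"
  shows "one_exceptional B (R k) (V k)"
    and "\<exists>l\<in>{j..k}. sum_list (V k) \<le> real m * B + max 0 (R l)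
           + (\<Sum>i\<in>{l..<k}. (if i = j then 0 else s (n + int i)) - real m * t (n + int i))"
proof -
  have C0: "0 \<le> C"
    using workload_vector_nth(3)[OF workload_vector_kw_workload, of "m - 1" m s t n j] m C by simp
  have "one_exceptional B (R k) (V k) \<and> (\<exists>l\<in>{j..k}. sum_list (V k) \<le> real m * B + max 0 (R l)
           + (\<Sum>i\<in>{l..<k}. (if i = j then 0 else s (n + int i)) - real m * t (n + int i)))"
    using Suc_leI[OF k] B
  proof (induction k rule: dec_induct)
    case base
    have V: "V (Suc j) = kw_step (s (n + int j)) (t (n + int j)) (V j)" by simp
    have R: "R (Suc j) = s (n + int j) + C - t (n + int j)" by (simp add: R_def)
    have o: "one_exceptional B (R (Suc j)) (V (Suc j))"
      unfolding V R by (rule one_exceptional_first[OF workload_vector_kw_workload m s C])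
    show ?case
    proof (cases "V (Suc j) ! 0 = 0")
      case True
      have "sum_list (V (Suc j)) \<le> real m * B + max 0 (R (Suc j))"
        using one_exceptionalD(2)[OF workload_vector_kw_workload m o True] C C0 by simp
      then show ?thesis using o by (intro conjI bexI[of _ "Suc j"]) (auto simp del: kw_workload.simps)
    next
      case False
      have "sum_list (V j) \<le> (\<Sum>i<m. B)"
        unfolding workload_vector_sum[OF workload_vector_kw_workload]
        using workload_vector_nth(2)[OF workload_vector_kw_workload[of m s t n j]] C
        by (intro sum_mono) (auto intro: order_trans)
      moreover have "sum_list (V (Suc j)) = sum_list (V j) + s (n + int j) - real m * t (n + int j)"
        using sum_kw_step_eq[OF workload_vector_kw_workload m False[unfolded V]] V by simp
      moreover have "R j = s (n + int j) + C" by (simp add: R_def)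
      ultimately show ?thesis using o C0
        by (intro conjI bexI[of _ j]) (auto simp del: kw_workload.simps)
    qed
  next
    case (step k)
    have V: "V (Suc k) = kw_step (s (n + int k)) (t (n + int k)) (V k)" by simp
    have R: "R (Suc k) = R k - t (n + int k)" using step.hyps by (simp add: R_def)
    have IH: "one_exceptional B (R k) (V k)" "\<exists>l\<in>{j..k}. sum_list (V k) \<le> real m * B + max 0 (R l)
           + (\<Sum>i\<in>{l..<k}. (if i = j then 0 else s (n + int i)) - real m * t (n + int i))"
      using step.IH step.prems by auto
    have o: "one_exceptional B (R (Suc k)) (V (Suc k))"
      unfolding V R using step.hyps
      by (intro one_exceptional_kw_step[OF workload_vector_kw_workload m s step.prems IH(1)]) auto
    show ?case
    proof (cases "V (Suc k) ! 0 = 0")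
      case True
      have "sum_list (V (Suc k)) \<le> real m * B + max 0 (R (Suc k))"
        using one_exceptionalD(2)[OF workload_vector_kw_workload m o True] C C0 by simp
      then show ?thesis using o step.hyps by (intro conjI bexI[of _ "Suc k"]) (auto simp del: kw_workload.simps)
    next
      case False
      have *: "sum_list (V (Suc k)) = sum_list (V k) + s (n + int k) - real m * t (n + int k)"
        using sum_kw_step_eq[OF workload_vector_kw_workload m False[unfolded V]] V by simp
      from IH(2) obtain l where l: "l \<in> {j..k}" "sum_list (V k) \<le> real m * B + max 0 (R l)
           + (\<Sum>i\<in>{l..<k}. (if i = j then 0 else s (n + int i)) - real m * t (n + int i))" by blast
      show ?thesis
        using o l * step.hyps by (intro conjI bexI[of _ l]) (auto simp del: kw_workload.simps)
    qed
  qed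
  then show "one_exceptional B (R k) (V k)"
    and "\<exists>l\<in>{j..k}. sum_list (V k) \<le> real m * B + max 0 (R l)
           + (\<Sum>i\<in>{l..<k}. (if i = j then 0 else s (n + int i)) - real m * t (n + int i))" by auto
qed

end

section \<open>Independent coordinates and partial sums\<close>

locale iid_coordinates = sequence_space D for D :: "'b measure" +
  assumes space_D [simp]: "space D = UNIV"
begin

lemma space_S [simp]: "space S = UNIV"
  by (simp add: space_PiM)

lemma prob_S: "prob_space S" by unfold_locales
lemma prob_D: "prob_space D" by unfold_locales

lemma sets_Collect_S: "Measurable.pred S P \<Longrightarrow> {\<omega>. P \<omega>} \<in> sets S"
  by (simp add: pred_def)

lemma measure_UNIV [simp]: "measure D UNIV = 1" "measure S UNIV = 1"
  using prob_space.prob_space[OF prob_D] prob_space.prob_space[OF prob_S] by simp_all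

lemma measurable_shift [measurable]: "(\<lambda>\<omega> j. \<omega> (j + n)) \<in> S \<rightarrow>\<^sub>M S"
  by (rule measurable_PiM_single') (auto simp: space_PiM)

text \<open>
Drawing the coordinate \<open>i\<close> afresh preserves the product measure.
\<close>
lemma measure_coordinate_indep:
  assumes B [measurable]: "B \<in> sets D" and G [measurable]: "G \<in> sets S"
    and inv: "\<And>\<omega> x. fun_upd \<omega> i x \<in> G \<longleftrightarrow> \<omega> \<in> G"
  shows "measure S {\<omega>. \<omega> i \<in> B \<and> \<omega> \<in> G} = measure D B * measure S G"
proof -
  have eq: "distr (D \<Otimes>\<^sub>M S) S (\<lambda>(x, \<omega>). fun_upd \<omega> i x) = S"
    using distr_pair_PiM_eq_PiM[of "UNIV :: nat set" "\<lambda>_. D" i] prob_D by simp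
  have m: "(\<lambda>(x, \<omega>). fun_upd \<omega> i x) \<in> D \<Otimes>\<^sub>M S \<rightarrow>\<^sub>M S"
    unfolding split_beta' by (intro measurable_fun_upd[where J = UNIV]) auto
  have E: "{\<omega>. \<omega> i \<in> B \<and> \<omega> \<in> G} \<in> sets S"
    by (rule sets_Collect_S) measurable
  have "emeasure S {\<omega>. \<omega> i \<in> B \<and> \<omega> \<in> G}
      = emeasure (distr (D \<Otimes>\<^sub>M S) S (\<lambda>(x, \<omega>). fun_upd \<omega> i x)) {\<omega>. \<omega> i \<in> B \<and> \<omega> \<in> G}"
    unfolding eq ..
  also have "\<dots> = emeasure (D \<Otimes>\<^sub>M S) ((\<lambda>(x, \<omega>). fun_upd \<omega> i x) -` {\<omega>. \<omega> i \<in> B \<and> \<omega> \<in> G} \<inter> space (D \<Otimes>\<^sub>M S))"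
    using E m by (rule emeasure_distr[rotated])
  also have "(\<lambda>(x, \<omega>). fun_upd \<omega> i x) -` {\<omega>. \<omega> i \<in> B \<and> \<omega> \<in> G} \<inter> space (D \<Otimes>\<^sub>M S) = B \<times> G"
    using inv by (auto simp: space_pair_measure)
  also have "emeasure (D \<Otimes>\<^sub>M S) (B \<times> G) = emeasure D B * emeasure S G"
    by (rule P.emeasure_pair_measure_Times) auto
  finally show ?thesis
    by (simp add: P.emeasure_eq_measure M.emeasure_eq_measure flip: ennreal_mult)
qed

text \<open>
The future after time \<open>n\<close> may be replaced by an independent copy of the whole sequence.
\<close>
lemma emeasure_past_future:
  assumes R [measurable]: "R \<in> sets (S \<Otimes>\<^sub>M S)"
    and past: "\<And>\<omega> \<omega>' \<omega>''. (comb_seq n \<omega> \<omega>', \<omega>'') \<in> R \<longleftrightarrow> (\<omega>, \<omega>'') \<in> R"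
  shows "emeasure S {\<omega>. (\<omega>, \<lambda>j. \<omega> (j + n)) \<in> R} = (\<integral>\<^sup>+\<omega>. emeasure S {\<omega>'. (\<omega>, \<omega>') \<in> R} \<partial>S)"
proof -
  let ?E = "{\<omega>. (\<omega>, \<lambda>j. \<omega> (j + n)) \<in> R}"
  have E: "?E \<in> sets S"
    by (rule sets_Collect_S) measurable
  have "emeasure S ?E = emeasure (distr (S \<Otimes>\<^sub>M S) S (\<lambda>(\<omega>, \<omega>'). comb_seq n \<omega> \<omega>')) ?E"
    unfolding PiM_comb_seq ..
  also have "\<dots> = emeasure (S \<Otimes>\<^sub>M S) ((\<lambda>(\<omega>, \<omega>'). comb_seq n \<omega> \<omega>') -` ?E \<inter> space (S \<Otimes>\<^sub>M S))"
    by (rule emeasure_distr[OF measurable_comb_seq E])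
  also have "(\<lambda>(\<omega>, \<omega>'). comb_seq n \<omega> \<omega>') -` ?E \<inter> space (S \<Otimes>\<^sub>M S) = R"
    by (auto simp: space_pair_measure past comb_seq_add)
  also have "emeasure (S \<Otimes>\<^sub>M S) R = (\<integral>\<^sup>+\<omega>. \<integral>\<^sup>+\<omega>'. indicator R (\<omega>, \<omega>') \<partial>S \<partial>S)"
    by (rule P.emeasure_pair_measure[OF R])
  also have "\<dots> = (\<integral>\<^sup>+\<omega>. emeasure S {\<omega>'. (\<omega>, \<omega>') \<in> R} \<partial>S)"
  proof (intro nn_integral_cong)
    fix \<omega>
    have "{\<omega>' \<in> space S. (\<omega>, \<omega>') \<in> R} \<in> sets S" by measurable
    then have "{\<omega>'. (\<omega>, \<omega>') \<in> R} \<in> sets S" by simp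
    then have "emeasure S {\<omega>'. (\<omega>, \<omega>') \<in> R} = (\<integral>\<^sup>+\<omega>'. indicator {\<omega>'. (\<omega>, \<omega>') \<in> R} \<omega>' \<partial>S)"
      by simp
    then show "(\<integral>\<^sup>+\<omega>'. indicator R (\<omega>, \<omega>') \<partial>S) = emeasure S {\<omega>'. (\<omega>, \<omega>') \<in> R}"
      by (simp add: indicator_def)
  qed
  finally show ?thesis .
qed

lemma distr_shift: "distr S S (\<lambda>\<omega> j. \<omega> (j + n)) = S"
  using distr_PiM_reindex[of "UNIV :: nat set" "\<lambda>_. D" "\<lambda>j. j + n" UNIV] prob_D
  by (simp add: restrict_def inj_on_def)

lemma measure_shift:
  assumes "G \<in> sets S"
  shows "measure S {\<omega>. (\<lambda>j. \<omega> (j + n)) \<in> G} = measure S G"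
proof -
  have "measure S G = measure (distr S S (\<lambda>\<omega> j. \<omega> (j + n))) G" unfolding distr_shift ..
  also have "\<dots> = measure S ((\<lambda>\<omega> j. \<omega> (j + n)) -` G \<inter> space S)"
    by (rule measure_distr) (use assms in auto)
  finally show ?thesis by (simp add: vimage_def)
qed

text \<open>
The maximum of \<open>0\<close> and the partial sums up to \<open>n\<close>, written as a recursion that exhibits
the shift of the sequence.
\<close>
primrec lindley :: "('b \<Rightarrow> real) \<Rightarrow> nat \<Rightarrow> (nat \<Rightarrow> 'b) \<Rightarrow> real" where
  "lindley h 0 \<omega> = 0"
| "lindley h (Suc n) \<omega> = max 0 (h (\<omega> 0) + lindley h n (\<lambda>j. \<omega> (Suc j)))"

lemma lindley_nonneg: "0 \<le> lindley h n \<omega>"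
  by (cases n) auto

lemma lindley_mono_Suc: "lindley h n \<omega> \<le> lindley h (Suc n) \<omega>"
proof (induction n arbitrary: \<omega>)
  case (Suc n)
  then show ?case using max.mono[OF order_refl add_left_mono[OF Suc.IH]] by (metis lindley.simps(2))
qed simp

lemma partial_sum_le_lindley: "(\<Sum>j<n. h (\<omega> j)) \<le> lindley h n \<omega>"
proof (induction n arbitrary: \<omega>)
  case (Suc n)
  show ?case using Suc.IH[of "\<lambda>j. \<omega> (Suc j)"]
    by (simp add: le_max_iff_disj sum.lessThan_Suc_shift del: sum.lessThan_Suc)
qed simp

lemma measurable_lindley [measurable]:
  assumes [measurable]: "h \<in> borel_measurable D"
  shows "lindley h n \<in> borel_measurable S"
proof (induction n)
  case (Suc n)
  note [measurable] = Suc
  have "(\<lambda>\<omega>. \<lambda>j. \<omega> (Suc j)) \<in> S \<rightarrow>\<^sub>M S"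
    using measurable_shift[of 1] by simp
  note [measurable] = measurable_compose[OF this Suc]
  show ?case by simp
qed simp

lemma integrable_case_nat:
  fixes f :: "(nat \<Rightarrow> 'b) \<Rightarrow> real"
  assumes [measurable]: "f \<in> borel_measurable S"
  shows "integrable S f \<longleftrightarrow> integrable (D \<Otimes>\<^sub>M S) (\<lambda>(x, \<omega>). f (case_nat x \<omega>))"
    and "integral\<^sup>L S f = (\<integral>(x, \<omega>). f (case_nat x \<omega>) \<partial>(D \<Otimes>\<^sub>M S))"
proof -
  have m: "(\<lambda>(x, \<omega>). case_nat x \<omega>) \<in> D \<Otimes>\<^sub>M S \<rightarrow>\<^sub>M S" by measurable
  have "integrable (distr (D \<Otimes>\<^sub>M S) S (\<lambda>(x, \<omega>). case_nat x \<omega>)) f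
      \<longleftrightarrow> integrable (D \<Otimes>\<^sub>M S) (\<lambda>p. f ((\<lambda>(x, \<omega>). case_nat x \<omega>) p))"
    by (rule integrable_distr_eq[OF m]) simp
  then show "integrable S f \<longleftrightarrow> integrable (D \<Otimes>\<^sub>M S) (\<lambda>(x, \<omega>). f (case_nat x \<omega>))"
    unfolding PiM_iter by (simp add: split_beta')
  have "integral\<^sup>L (distr (D \<Otimes>\<^sub>M S) S (\<lambda>(x, \<omega>). case_nat x \<omega>)) f
      = (\<integral>p. f ((\<lambda>(x, \<omega>). case_nat x \<omega>) p) \<partial>(D \<Otimes>\<^sub>M S))"
    by (rule integral_distr[OF m]) simp
  then show "integral\<^sup>L S f = (\<integral>(x, \<omega>). f (case_nat x \<omega>) \<partial>(D \<Otimes>\<^sub>M S))"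
    unfolding PiM_iter by (simp add: split_beta')
qed

text \<open>
The argument of the maximal ergodic theorem. The set where the maxima tend to infinity is invariant
under the shift. On this set the mean increase of \<open>lindley h n\<close> is nonnegative, and it tends to
the mean of \<open>h\<close> times the probability of the set. A negative mean of \<open>h\<close> leaves only
probability zero.
\<close>
lemma lindley_bounded_AE:
  assumes h: "integrable D h" and neg: "integral\<^sup>L D h < 0"
  shows "AE \<omega> in S. \<exists>c. \<forall>n. lindley h n \<omega> \<le> c"
proof -
  interpret DS: pair_prob_space D S ..
  have [measurable]: "h \<in> borel_measurable D" using h by auto
  define I where "I = {\<omega>. \<forall>c::nat. \<exists>n. lindley h n \<omega> > real c}"
  have I [measurable]: "I \<in> sets S"
    unfolding I_def by (rule sets_Collect_S) measurable
  have shift: "lindley h (Suc n) (case_nat x \<omega>) = max 0 (h x + lindley h n \<omega>)" for n x \<omega>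
    by simp
  have inv: "case_nat x \<omega> \<in> I \<longleftrightarrow> \<omega> \<in> I" for x \<omega>
  proof
    assume *: "\<omega> \<in> I"
    show "case_nat x \<omega> \<in> I" unfolding I_def
    proof (clarify)
      fix c :: nat
      obtain d :: nat where d: "real c - h x \<le> real d" using real_arch_simple by blast
      obtain n where "lindley h n \<omega> > real d" using * by (auto simp: I_def)
      then have "lindley h (Suc n) (case_nat x \<omega>) > real c" unfolding shift using d by auto
      then show "\<exists>n. lindley h n (case_nat x \<omega>) > real c" by blast
    qed
  next
    assume *: "case_nat x \<omega> \<in> I"
    show "\<omega> \<in> I" unfolding I_def
    proof (clarify)
      fix c :: nat
      obtain d :: nat where d: "real c + \<bar>h x\<bar> \<le> real d" using real_arch_simple by blast
      obtain n where n: "lindley h n (case_nat x \<omega>) > real d" using * by (auto simp: I_def)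
      then obtain k where "n = Suc k" by (cases n) auto
      then have "max 0 (h x + lindley h k \<omega>) > real d" using n shift by simp
      then have "lindley h k \<omega> > real c" using d by auto
      then show "\<exists>n. lindley h n \<omega> > real c" by blast
    qed
  qed
  have snd: "integrable (D \<Otimes>\<^sub>M S) (\<lambda>(x, \<omega>). f \<omega>)"
    and snd_eq: "(\<integral>(x, \<omega>). f \<omega> \<partial>(D \<Otimes>\<^sub>M S)) = integral\<^sup>L S f"
    if "integrable S f" for f :: "(nat \<Rightarrow> 'b) \<Rightarrow> real"
  proof -
    let ?g = "\<lambda>\<omega>. f (\<lambda>j. \<omega> (Suc j))"
    have sh: "(\<lambda>\<omega>. \<lambda>j. \<omega> (Suc j)) \<in> S \<rightarrow>\<^sub>M S" using measurable_shift[of 1] by simp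
    have d: "distr S S (\<lambda>\<omega>. \<lambda>j. \<omega> (Suc j)) = S" using distr_shift[of 1] by simp
    have [measurable]: "f \<in> borel_measurable S" using that by auto
    have "integrable S ?g" "integral\<^sup>L S ?g = integral\<^sup>L S f"
      using integrable_distr_eq[OF sh, of f] integral_distr[OF sh, of f] that unfolding d by auto
    then show "integrable (D \<Otimes>\<^sub>M S) (\<lambda>(x, \<omega>). f \<omega>)" "(\<integral>(x, \<omega>). f \<omega> \<partial>(D \<Otimes>\<^sub>M S)) = integral\<^sup>L S f"
      using integrable_case_nat[OF measurable_compose[OF sh], of f] by auto
  qed
  have fst: "integrable (D \<Otimes>\<^sub>M S) (\<lambda>(x, \<omega>). h x)"
    using integrable_distr_eq[of fst "D \<Otimes>\<^sub>M S" D h] h P.distr_pair_fst[of D] by (simp add: split_beta')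
  define r where "r = lindley h"
  have r0: "0 \<le> r n \<omega>" and rS: "r n \<omega> \<le> r (Suc n) \<omega>" for n \<omega>
    unfolding r_def by (rule lindley_nonneg, rule lindley_mono_Suc)
  have [measurable]: "r n \<in> borel_measurable S" for n unfolding r_def by measurable
  have r_shift: "r (Suc n) (case_nat x \<omega>) = max 0 (h x + r n \<omega>)" for n x \<omega>
    unfolding r_def by simp
  have r_int: "integrable S (r n)" for n
  proof (induction n)
    case 0
    have "r 0 = (\<lambda>_. 0)" by (auto simp: r_def)
    then show ?case by simp
  next
    case (Suc n)
    have "integrable (D \<Otimes>\<^sub>M S) (\<lambda>p. max 0 ((case p of (x, \<omega>) \<Rightarrow> h x) + (case p of (x, \<omega>) \<Rightarrow> r n \<omega>)))"
      by (intro integrable_max Bochner_Integration.integrable_add fst snd Suc) auto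
    then show ?case by (subst integrable_case_nat(1)) (auto simp: r_shift split_beta')
  qed
  let ?u = "\<lambda>n (x, \<omega>). max (h x) (- r n \<omega>) * indicator I \<omega>"
  have pos: "0 \<le> (\<integral>p. ?u n p \<partial>(D \<Otimes>\<^sub>M S))" for n
  proof -
    have iI: "integrable S (\<lambda>\<omega>. r k \<omega> * indicator I \<omega>)" for k
      by (intro integrable_real_mult_indicator r_int I)
    have "integral\<^sup>L S (\<lambda>\<omega>. r n \<omega> * indicator I \<omega>) \<le> integral\<^sup>L S (\<lambda>\<omega>. r (Suc n) \<omega> * indicator I \<omega>)"
      by (intro integral_mono iI mult_right_mono rS) auto
    also have "\<dots> = (\<integral>(x, \<omega>). max 0 (h x + r n \<omega>) * indicator I \<omega> \<partial>(D \<Otimes>\<^sub>M S))"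
      by (subst integrable_case_nat(2)) (auto simp: r_shift inv indicator_def split_beta' intro!: Bochner_Integration.integral_cong)
    finally have "(\<integral>(x, \<omega>). r n \<omega> * indicator I \<omega> \<partial>(D \<Otimes>\<^sub>M S))
        \<le> (\<integral>(x, \<omega>). max 0 (h x + r n \<omega>) * indicator I \<omega> \<partial>(D \<Otimes>\<^sub>M S))"
      using snd_eq[OF iI] by simp
    moreover have "integrable (D \<Otimes>\<^sub>M S) (\<lambda>(x, \<omega>). max 0 (h x + r n \<omega>) * indicator I \<omega>)"
      using iI[of "Suc n"] by (subst (asm) integrable_case_nat(1)) (auto simp: r_shift inv indicator_def split_beta')
    ultimately have "0 \<le> (\<integral>p. (case p of (x, \<omega>) \<Rightarrow> max 0 (h x + r n \<omega>) * indicator I \<omega>)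
        - (case p of (x, \<omega>) \<Rightarrow> r n \<omega> * indicator I \<omega>) \<partial>(D \<Otimes>\<^sub>M S))"
      using snd[OF iI] by (subst Bochner_Integration.integral_diff) auto
    also have "\<dots> = (\<integral>p. ?u n p \<partial>(D \<Otimes>\<^sub>M S))"
      by (intro Bochner_Integration.integral_cong refl) (auto simp: indicator_def max_def)
    finally show ?thesis .
  qed
  \<comment> \<open>The integrand is the increase from \<open>r n\<close> (shifted) to \<open>r (Suc n)\<close>; where
  \<open>r n\<close> has passed \<open>- h x\<close> it equals \<open>h x\<close>.\<close>
  have "(\<lambda>n. \<integral>p. ?u n p \<partial>(D \<Otimes>\<^sub>M S)) \<longlonglongrightarrow> (\<integral>(x, \<omega>). h x * indicator I \<omega> \<partial>(D \<Otimes>\<^sub>M S))"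
  proof (rule integral_dominated_convergence)
    show "integrable (D \<Otimes>\<^sub>M S) (\<lambda>(x, \<omega>). \<bar>h x\<bar>)"
      using integrable_abs[OF fst] by (simp add: split_beta')
    show "AE p in D \<Otimes>\<^sub>M S. (\<lambda>n. ?u n p) \<longlonglongrightarrow> (case p of (x, \<omega>) \<Rightarrow> h x * indicator I \<omega>)"
    proof (rule AE_I2)
      fix p :: "'b \<times> (nat \<Rightarrow> 'b)"
      obtain x \<omega> where p: "p = (x, \<omega>)" by (cases p)
      show "(\<lambda>n. ?u n p) \<longlonglongrightarrow> (case p of (x, \<omega>) \<Rightarrow> h x * indicator I \<omega>)"
      proof (cases "\<omega> \<in> I")
        case True
        obtain d :: nat where d: "- h x \<le> real d" using real_arch_simple by blast
        obtain k where k: "r k \<omega> > real d" using True by (auto simp: I_def r_def)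
        have "max (h x) (- r n \<omega>) = h x" if "k \<le> n" for n
          using lift_Suc_mono_le[of "\<lambda>n. r n \<omega>", OF rS that] d k by auto
        then have "\<forall>\<^sub>F n in sequentially. ?u n p = h x * indicator I \<omega>"
          using p by (auto intro!: eventually_sequentiallyI[of k])
        then show ?thesis using p by (simp add: tendsto_eventually)
      qed (simp add: p)
    qed
    show "AE p in D \<Otimes>\<^sub>M S. norm (?u n p) \<le> (case p of (x, \<omega>) \<Rightarrow> \<bar>h x\<bar>)" for n
    proof (rule AE_I2)
      fix p :: "'b \<times> (nat \<Rightarrow> 'b)"
      show "norm (?u n p) \<le> (case p of (x, \<omega>) \<Rightarrow> \<bar>h x\<bar>)"
        using r0[of n "snd p"] by (cases p) (auto simp: indicator_def max_def abs_if)
    qed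
  qed measurable
  then have "0 \<le> (\<integral>(x, \<omega>). h x * indicator I \<omega> \<partial>(D \<Otimes>\<^sub>M S))"
    by (rule LIMSEQ_le_const) (use pos in auto)
  also have "\<dots> = (\<integral>x. \<integral>\<omega>. h x * indicator I \<omega> \<partial>S \<partial>D)"
  proof (rule DS.integral_fst[symmetric])
    show "integrable (D \<Otimes>\<^sub>M S) (\<lambda>(x, \<omega>). h x * indicator I \<omega>)"
      by (rule Bochner_Integration.integrable_bound[OF fst]) (auto simp: indicator_def)
  qed
  also have "\<dots> = integral\<^sup>L D h * measure S I" by simp
  finally have "measure S I = 0"
    using neg by (simp add: zero_le_mult_iff measure_le_0_iff)
  then have "AE \<omega> in S. \<omega> \<notin> I"
    by (intro AE_not_in) (simp add: null_sets_def P.emeasure_eq_measure)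
  then show ?thesis
  proof (rule AE_mp, intro AE_I2 impI)
    fix \<omega> assume "\<omega> \<notin> I"
    then obtain c :: nat where "\<And>n. lindley h n \<omega> \<le> real c" by (auto simp: I_def not_less)
    then show "\<exists>c. \<forall>n. lindley h n \<omega> \<le> c" by blast
  qed
qed

text \<open>
A one-sided law of large numbers that holds for all \<open>n\<close> simultaneously. Only a first moment is
available.
\<close>
lemma partial_sums_tight:
  assumes h: "integrable D h" and "\<eta> > 0" "\<delta> > 0"
  shows "\<exists>C0\<ge>0. \<forall>C\<ge>C0.
    measure S {\<omega>. \<exists>n. (\<Sum>j<n. h (\<omega> j)) > real n * (integral\<^sup>L D h + \<eta>) + C} \<le> \<delta>"
proof -
  have [measurable]: "h \<in> borel_measurable D" using h by auto
  let ?h = "\<lambda>x. h x - (integral\<^sup>L D h + \<eta>)"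
  have hh: "integrable D ?h" using h by simp
  have "integral\<^sup>L D ?h = - \<eta>" using h by simp
  then have neg: "integral\<^sup>L D ?h < 0" using assms by simp
  define E where "E C = {\<omega>. \<exists>n. (\<Sum>j<n. h (\<omega> j)) > real n * (integral\<^sup>L D h + \<eta>) + C}" for C
  have E [measurable]: "E C \<in> sets S" for C
    unfolding E_def by (rule sets_Collect_S) measurable
  have mono: "E C' \<subseteq> E C" if "C \<le> C'" for C C'
  proof
    fix \<omega> assume "\<omega> \<in> E C'"
    then obtain n where "(\<Sum>j<n. h (\<omega> j)) > real n * (integral\<^sup>L D h + \<eta>) + C'" by (auto simp: E_def)
    with that show "\<omega> \<in> E C" by (auto simp: E_def intro!: exI[of _ n])
  qed
  have "(\<lambda>i. measure S (E (real i))) \<longlonglongrightarrow> measure S (\<Inter>i. E (real i))"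
    using mono by (intro P.finite_Lim_measure_decseq) (auto simp: decseq_def)
  moreover have "measure S (\<Inter>i. E (real i)) = 0"
  proof -
    have "AE \<omega> in S. \<omega> \<notin> (\<Inter>i. E (real i))"
      using lindley_bounded_AE[OF hh neg]
    proof (rule AE_mp, intro AE_I2 impI)
      fix \<omega> assume "\<exists>c. \<forall>n. lindley ?h n \<omega> \<le> c"
      then obtain c where c: "\<And>n. lindley ?h n \<omega> \<le> c" by blast
      obtain i :: nat where "c \<le> real i" using real_arch_simple by blast
      then have "(\<Sum>j<n. ?h (\<omega> j)) \<le> real i" for n
        using c[of n] partial_sum_le_lindley[of ?h \<omega> n] by linarith
      then have "\<omega> \<notin> E (real i)"
        by (auto simp: E_def sum_subtractf not_less algebra_simps)
      then show "\<omega> \<notin> (\<Inter>i. E (real i))" by blast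
    qed
    then show ?thesis by (simp add: P.prob_eq_0)
  qed
  ultimately have "(\<lambda>i. measure S (E (real i))) \<longlonglongrightarrow> 0" by simp
  then have "\<forall>\<^sub>F i in sequentially. measure S (E (real i)) < \<delta>"
    using assms by (intro order_tendstoD) auto
  then obtain i :: nat where i: "measure S (E (real i)) < \<delta>"
    by (auto simp: eventually_sequentially)
  show ?thesis
  proof (intro exI[of _ "real i"] conjI allI impI)
    fix C assume "real i \<le> C"
    then have "measure S (E C) \<le> measure S (E (real i))"
      by (intro P.finite_measure_mono mono) auto
    then show "measure S {\<omega>. \<exists>n. (\<Sum>j<n. h (\<omega> j)) > real n * (integral\<^sup>L D h + \<eta>) + C} \<le> \<delta>"
      using i by (simp add: E_def)
  qed simp
qed

end

section \<open>Exceedance counts and the integrated tail\<close>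

locale service_law = iid_coordinates D for D :: "'b measure" +
  fixes sv :: "'b \<Rightarrow> real"
  assumes sv_integrable: "integrable D sv" and sv_nonneg: "\<And>v. 0 \<le> sv v"
begin

lemma measurable_sv [measurable]: "sv \<in> borel_measurable D"
  using sv_integrable by auto

definition exceed :: "real \<Rightarrow> real" where
  "exceed y = measure D {v. sv v > y}"

definition excess :: "real \<Rightarrow> real" where
  "excess y = (LINT v|D. max 0 (sv v - y))"

lemma sets_exceed [measurable]: "{v. sv v > y} \<in> sets D"
proof -
  have "{v \<in> space D. sv v > y} \<in> sets D" by measurable
  then show ?thesis by simp
qed

lemma integrable_excess: "integrable D (\<lambda>v. max 0 (sv v - y))"
  using sv_integrable by simp

lemma integrable_indicator_exceed: "integrable D (indicator {v. sv v > y} :: 'b \<Rightarrow> real)"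
  by (rule integrable_real_indicator) (simp_all add: M.emeasure_eq_measure)

lemma exceed_nonneg: "0 \<le> exceed y"
  by (simp add: exceed_def)

lemma exceed_mono: "x \<le> y \<Longrightarrow> exceed y \<le> exceed x"
  unfolding exceed_def by (intro M.finite_measure_mono) auto

lemma excess_nonneg: "0 \<le> excess y"
  unfolding excess_def by (intro Bochner_Integration.integral_nonneg) auto

lemma excess_mono: "x \<le> y \<Longrightarrow> excess y \<le> excess x"
  unfolding excess_def by (intro integral_mono integrable_excess) auto

text \<open>
The tail is a difference of values of the integrated tail. This is why it becomes negligible as soon
as the latter is long-tailed.
\<close>
lemma exceed_le_excess_diff: "exceed y \<le> excess (y - 1) - excess y"
proof -
  have "exceed y = (LINT v|D. indicator {v. sv v > y} v)" by (simp add: exceed_def)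
  also have "\<dots> \<le> (LINT v|D. max 0 (sv v - (y - 1)) - max 0 (sv v - y))"
    by (intro integral_mono Bochner_Integration.integrable_diff integrable_excess
        integrable_indicator_exceed) (auto simp: indicator_def)
  also have "\<dots> = excess (y - 1) - excess y"
    unfolding excess_def by (intro Bochner_Integration.integral_diff integrable_excess)
  finally show ?thesis .
qed

lemma exceed_le_excess: "exceed y \<le> excess (y - 1)"
  using exceed_le_excess_diff[of y] excess_nonneg[of y] by simp

text \<open>
Up to rounding, the number of \<open>n\<close> with \<open>s > min (p + n c) (q + n d)\<close>.
\<close>
definition crossings :: "real \<Rightarrow> real \<Rightarrow> real \<Rightarrow> real \<Rightarrow> real \<Rightarrow> real" where
  "crossings p q c d s = max 0 (max ((s - p) / c) ((s - q) / d))"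

lemma integrable_crossings: "integrable D (\<lambda>v. crossings p q c d (sv v))"
  unfolding crossings_def using sv_integrable by simp

lemma exceed_sums:
  assumes c: "0 < c" and d: "0 < d" and pq: "p \<le> q"
  defines "u \<equiv> \<lambda>n. min (p + real n * c) (q + real n * d)"
  shows "summable (\<lambda>n. exceed (u n))"
    and "(LINT v|D. crossings p q c d (sv v)) \<le> (\<Sum>n. exceed (u n))"
    and "(\<Sum>n. exceed (u n)) \<le> (LINT v|D. crossings p q c d (sv v)) + exceed p"
proof -
  define z where "z s = max ((s - p) / c) ((s - q) / d)" for s
  define N where "N s = real (nat \<lceil>z s\<rceil>)" for s
  have iff: "s > u n \<longleftrightarrow> n < nat \<lceil>z s\<rceil>" for s n
  proof -
    have "s > u n \<longleftrightarrow> real n < z s"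
      using c d by (auto simp: u_def z_def min_less_iff_disj less_max_iff_disj field_simps)
    also have "\<dots> \<longleftrightarrow> n < nat \<lceil>z s\<rceil>" by linarith
    finally show ?thesis .
  qed
  have N_ge: "crossings p q c d s \<le> N s" for s
    unfolding crossings_def N_def z_def[symmetric] by linarith
  have N_le: "N s \<le> crossings p q c d s + indicator {p<..} s" for s
  proof (cases "s > p")
    case True
    then show ?thesis unfolding crossings_def N_def z_def[symmetric] by simp linarith
  next
    case False
    then have "s - p \<le> 0" "s - q \<le> 0" using pq by auto
    then have "(s - p) / c \<le> 0" "(s - q) / d \<le> 0" using c d by (auto simp: divide_nonpos_pos)
    then have "z s \<le> 0" by (auto simp: z_def)
    then show ?thesis using False by (simp add: N_def crossings_def)
  qed
  have [measurable]: "(\<lambda>v. N (sv v)) \<in> borel_measurable D"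
    unfolding N_def z_def by measurable
  have int2: "integrable D (\<lambda>v. crossings p q c d (sv v) + indicator {v. sv v > p} v)"
    by (intro Bochner_Integration.integrable_add integrable_crossings integrable_indicator_exceed)
  have intN: "integrable D (\<lambda>v. N (sv v))"
  proof (rule Bochner_Integration.integrable_bound[OF int2])
    show "AE v in D. norm (N (sv v)) \<le> norm (crossings p q c d (sv v) + indicator {v. sv v > p} v)"
      using N_le by (intro AE_I2) (auto simp: N_def crossings_def indicator_def abs_of_nonneg)
  qed simp
  have sum_ind: "(\<Sum>n. indicator {v. sv v > u n} v) = ennreal (N (sv v))" for v
  proof -
    have "(\<Sum>n. indicator {v. sv v > u n} v :: ennreal) = (\<Sum>n<nat \<lceil>z (sv v)\<rceil>. indicator {v. sv v > u n} v)"
      by (rule suminf_finite) (auto simp: iff)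
    also have "\<dots> = (\<Sum>n<nat \<lceil>z (sv v)\<rceil>. 1)" by (intro sum.cong) (auto simp: iff)
    finally show ?thesis by (simp add: N_def ennreal_of_nat_eq_real_of_nat)
  qed
  have "(\<Sum>n. ennreal (exceed (u n))) = (\<Sum>n. \<integral>\<^sup>+v. indicator {v. sv v > u n} v \<partial>D)"
    by (simp add: exceed_def M.emeasure_eq_measure)
  also have "\<dots> = (\<integral>\<^sup>+v. (\<Sum>n. indicator {v. sv v > u n} v) \<partial>D)"
    by (rule nn_integral_suminf[symmetric]) simp
  also have "\<dots> = (\<integral>\<^sup>+v. ennreal (N (sv v)) \<partial>D)" by (simp add: sum_ind)
  also have "\<dots> = ennreal (LINT v|D. N (sv v))"
    by (rule nn_integral_eq_integral[OF intN]) (simp add: N_def)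
  finally have eq: "(\<Sum>n. ennreal (exceed (u n))) = ennreal (LINT v|D. N (sv v))" .
  then show sm: "summable (\<lambda>n. exceed (u n))"
    by (intro summable_suminf_not_top exceed_nonneg) simp
  have "ennreal (\<Sum>n. exceed (u n)) = ennreal (LINT v|D. N (sv v))"
    using eq suminf_ennreal2[OF exceed_nonneg sm] by simp
  then have s: "(\<Sum>n. exceed (u n)) = (LINT v|D. N (sv v))"
    using suminf_nonneg[OF sm exceed_nonneg] by (subst (asm) ennreal_inj) (auto simp: N_def intro!: Bochner_Integration.integral_nonneg)
  show "(LINT v|D. crossings p q c d (sv v)) \<le> (\<Sum>n. exceed (u n))"
    unfolding s by (intro integral_mono integrable_crossings intN N_ge)
  have "(\<Sum>n. exceed (u n)) \<le> (LINT v|D. crossings p q c d (sv v) + indicator {v. sv v > p} v)"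
    unfolding s using N_le by (intro integral_mono intN int2) (auto simp: indicator_def)
  also have "\<dots> = (LINT v|D. crossings p q c d (sv v)) + exceed p"
    by (subst Bochner_Integration.integral_add)
      (auto intro: integrable_crossings integrable_indicator_exceed simp: exceed_def)
  finally show "(\<Sum>n. exceed (u n)) \<le> (LINT v|D. crossings p q c d (sv v)) + exceed p" .
qed

lemma exceed_linear_sums:
  assumes c: "0 < c"
  shows "summable (\<lambda>n. exceed (p + real n * c))"
    and "(\<Sum>n. exceed (p + real n * c)) \<le> excess p / c + exceed p"
proof -
  have "(LINT v|D. crossings p p c c (sv v)) = (LINT v|D. max 0 (sv v - p) / c)"
    using c by (intro Bochner_Integration.integral_cong) (auto simp: crossings_def max_def field_simps)
  then have "(LINT v|D. crossings p p c c (sv v)) = excess p / c"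
    by (simp add: excess_def)
  then show "summable (\<lambda>n. exceed (p + real n * c))"
    "(\<Sum>n. exceed (p + real n * c)) \<le> excess p / c + exceed p"
    using exceed_sums[OF c c order_refl[of p]] by auto
qed

lemma big_jump_prob:
  assumes "summable (\<lambda>n. exceed (u n))"
  shows "measure S {\<omega>. \<exists>n. sv (\<omega> n) > u n} \<le> (\<Sum>n. exceed (u n))"
proof -
  have eq: "measure S {\<omega>. sv (\<omega> n) > u n} = exceed (u n)" for n
  proof -
    have "emeasure S {\<omega> \<in> space S. \<omega> n \<in> {v. sv v > u n}} = emeasure D {v. sv v > u n}"
      by (rule emeasure_PiM_Collect_single) auto
    then show ?thesis by (simp add: exceed_def P.emeasure_eq_measure M.emeasure_eq_measure)
  qed
  have sets: "{\<omega>. sv (\<omega> n) > u n} \<in> sets S" for n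
    by (rule sets_Collect_S) measurable
  have "measure S (\<Union>n. {\<omega>. sv (\<omega> n) > u n}) \<le> (\<Sum>n. measure S {\<omega>. sv (\<omega> n) > u n})"
    using assms sets by (intro P.finite_measure_subadditive_countably) (auto simp: eq)
  also have "(\<Union>n. {\<omega>. sv (\<omega> n) > u n}) = {\<omega>. \<exists>n. sv (\<omega> n) > u n}" by auto
  finally show ?thesis by (simp add: eq)
qed

end

text \<open>
The law \<open>\<nu>\<close> is the integrated tail distribution of the service times, moved to the
half-line.
\<close>
locale heavy_service = service_law D sv + subexponential_halfline \<nu>
  for D :: "'b measure" and sv :: "'b \<Rightarrow> real" and \<nu> :: "real measure" +
  assumes tail_excess: "\<And>x. 0 \<le> x \<Longrightarrow> tail \<nu> x = min 1 (excess x)"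
begin

lemma tail_le_excess: "0 \<le> x \<Longrightarrow> tail \<nu> x \<le> excess x"
  using tail_excess[of x] by simp

lemma excess_eq_tail: "\<forall>\<^sub>F x in at_top. excess x = tail \<nu> x"
proof -
  have "\<forall>\<^sub>F x in at_top. tail \<nu> x < 1" using tail_tendsto_0 by (rule order_tendstoD) simp
  then show ?thesis using eventually_ge_at_top[of 0]
    by eventually_elim (auto simp: tail_excess min_def split: if_splits)
qed

lemma excess_pos: "0 < excess x"
  using tail_pos[of "max 0 x"] tail_le_excess[of "max 0 x"] excess_mono[of x "max 0 x"] by simp

lemma excess_long_tailed:
  assumes "0 \<le> d" "e > 0" shows "\<forall>\<^sub>F x in at_top. excess (x - d) \<le> (1 + e) * excess x"
proof -
  have "\<forall>\<^sub>F x in at_top. excess (x - d) = tail \<nu> (x - d)"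
    using excess_eq_tail filterlim_tendsto_add_at_top[OF tendsto_const[of "- d"] filterlim_ident]
    by (auto simp: filterlim_iff)
  with excess_eq_tail long_tailed[OF assms] show ?thesis
    by eventually_elim simp
qed

text \<open>
A uniform version of the long-tail property: on a bounded range both sides are bounded away from
zero and infinity.
\<close>
lemma excess_shift_bound:
  "\<exists>K>0. \<forall>y\<ge>0. excess (y - d) \<le> K * tail \<nu> y"
proof -
  define d' where "d' = max 0 d"
  have "\<forall>\<^sub>F x in at_top. excess (x - d') \<le> 2 * excess x"
    using excess_long_tailed[of d' 1] by (simp add: d'_def)
  with excess_eq_tail have "\<forall>\<^sub>F x in at_top. excess (x - d') \<le> 2 * tail \<nu> x"
    by eventually_elim simp
  then obtain y0 where y0: "\<And>y. y \<ge> y0 \<Longrightarrow> excess (y - d') \<le> 2 * tail \<nu> y"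
    by (auto simp: eventually_at_top_linorder)
  define K where "K = max 2 (excess (- d') / tail \<nu> y0)"
  have "excess (y - d) \<le> K * tail \<nu> y" if "0 \<le> y" for y
  proof (cases "y \<ge> y0")
    case True
    have "excess (y - d) \<le> excess (y - d')" by (intro excess_mono) (auto simp: d'_def)
    also have "\<dots> \<le> 2 * tail \<nu> y" by (rule y0[OF True])
    also have "\<dots> \<le> K * tail \<nu> y" using tail_pos[of y] by (intro mult_right_mono) (auto simp: K_def)
    finally show ?thesis .
  next
    case False
    have "excess (y - d) \<le> excess (- d')" using that by (intro excess_mono) (auto simp: d'_def)
    also have "\<dots> \<le> K * tail \<nu> y0"
      using tail_pos[of y0] by (simp add: K_def field_simps max_def)
    also have "\<dots> \<le> K * tail \<nu> y"
      using False by (intro mult_left_mono tail_mono) (auto simp: K_def)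
    finally show ?thesis .
  qed
  then show ?thesis by (intro exI[of _ K]) (auto simp: K_def)
qed

lemma exceed_negligible:
  assumes "e > 0" shows "\<forall>\<^sub>F x in at_top. exceed (x - C) \<le> e * excess x"
proof -
  define C' where "C' = max 0 C"
  have f: "filterlim (\<lambda>x. x - C') at_top at_top"
    using filterlim_tendsto_add_at_top[OF tendsto_const[of "- C'"] filterlim_ident] by simp
  have "\<forall>\<^sub>F x in at_top. excess (x - 1) \<le> (1 + e / 2) * excess x"
    using assms by (intro excess_long_tailed) auto
  then have "\<forall>\<^sub>F x in at_top. excess (x - C' - 1) \<le> (1 + e / 2) * excess (x - C')"
    using f by (auto simp: filterlim_iff)
  moreover have "\<forall>\<^sub>F x in at_top. excess (x - C') \<le> (1 + 1) * excess x"
    by (intro excess_long_tailed) (auto simp: C'_def)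
  ultimately show ?thesis
  proof eventually_elim
    case (elim x)
    have "exceed (x - C) \<le> exceed (x - C')" by (intro exceed_mono) (auto simp: C'_def)
    also have "\<dots> \<le> excess (x - C' - 1) - excess (x - C')" by (rule exceed_le_excess_diff)
    also have "\<dots> \<le> e / 2 * excess (x - C')" using elim(1) by (simp add: algebra_simps)
    also have "\<dots> \<le> e / 2 * (2 * excess x)" using elim(2) assms by (intro mult_left_mono) auto
    finally show ?case by simp
  qed
qed

end

section \<open>The dominating random walk and its maximum\<close>

locale queue_law = service_law D sv for D :: "'b measure" and sv :: "'b \<Rightarrow> real" +
  fixes tv :: "'b \<Rightarrow> real" and a b :: real and m :: nat
  assumes tv_integrable: "integrable D tv" and tv_nonneg: "\<And>v. 0 \<le> tv v"
    and mean_sv: "integral\<^sup>L D sv = b" and mean_tv: "integral\<^sup>L D tv = a"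
    and servers: "m \<ge> 1" and stable: "b < real m * a"
begin

lemma measurable_tv [measurable]: "tv \<in> borel_measurable D"
  using tv_integrable by auto

lemma mean_nonneg: "0 \<le> b" "0 < a"
proof -
  show "0 \<le> b" unfolding mean_sv[symmetric] by (rule Bochner_Integration.integral_nonneg) (rule sv_nonneg)
  then have "0 < real m * a" using stable by simp
  then show "0 < a" using servers by (simp add: zero_less_mult_iff)
qed

abbreviation rise_sv :: "real \<Rightarrow> 'b \<Rightarrow> real" where
  "rise_sv K v \<equiv> rise m K (sv v)"

lemma rise_le: "0 \<le> K \<Longrightarrow> rise_sv K v \<le> sv v"
  using sv_nonneg[of v] servers divide_left_mono[of 1 "real m" "sv v"] by (simp add: rise_def)

lemma rise_sv_nonneg: "0 \<le> rise_sv K v"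
  by (rule rise_nonneg[OF sv_nonneg])

lemma measurable_rise [measurable]: "rise_sv K \<in> borel_measurable D"
  unfolding rise_def by measurable

lemma integrable_rise: "0 \<le> K \<Longrightarrow> integrable D (rise_sv K)"
  by (rule Bochner_Integration.integrable_bound[OF sv_integrable])
    (auto simp: rise_le abs_of_nonneg rise_sv_nonneg sv_nonneg)

text \<open>
As \<open>K\<close> grows, the rise tends to \<open>v / m\<close>, whose mean \<open>b / m\<close> is below
\<open>a\<close> by stability.
\<close>
lemma exists_stable_level: "\<exists>K\<ge>0. integral\<^sup>L D (rise_sv K) < a"
proof -
  have "(\<lambda>n. integral\<^sup>L D (rise_sv (real n))) \<longlonglongrightarrow> (LINT v|D. sv v / real m)"
  proof (rule integral_dominated_convergence[OF _ _ sv_integrable])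
    show "AE v in D. (\<lambda>n. rise_sv (real n) v) \<longlonglongrightarrow> sv v / real m"
    proof (rule AE_I2)
      fix v
      obtain k :: nat where k: "sv v * real m \<le> real k" using real_arch_simple by blast
      have "rise_sv (real n) v = sv v / real m" if "k \<le> n" for n
      proof -
        have "sv v * real m \<le> real n" using k that by linarith
        then have "sv v \<le> real n / real m" using servers by (simp add: field_simps)
        moreover have "0 \<le> sv v / real m" using sv_nonneg by simp
        ultimately show ?thesis unfolding rise_def by simp
      qed
      then show "(\<lambda>n. rise_sv (real n) v) \<longlonglongrightarrow> sv v / real m"
        by (intro tendsto_eventually eventually_sequentiallyI[of k]) auto
    qed
    show "AE v in D. norm (rise_sv (real n) v) \<le> sv v" for n
      by (auto simp: rise_le abs_of_nonneg rise_sv_nonneg)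
  qed auto
  moreover have "(LINT v|D. sv v / real m) < a"
    using stable servers by (simp add: mean_sv field_simps)
  ultimately have "\<forall>\<^sub>F n in sequentially. integral\<^sup>L D (rise_sv (real n)) < a"
    by (rule order_tendstoD)
  then obtain n where "integral\<^sup>L D (rise_sv (real n)) < a" by (auto simp: eventually_sequentially)
  then show ?thesis by (intro exI[of _ "real n"]) simp
qed

text \<open>
The last term has no interarrival time subtracted: the service time of the customer with index
\<open>n\<close> has to be worked off only during the interarrival times with indices below \<open>n\<close>.
\<close>
definition walk :: "real \<Rightarrow> nat \<Rightarrow> (nat \<Rightarrow> 'b) \<Rightarrow> real" where
  "walk K n \<omega> = (\<Sum>j<n. rise_sv K (\<omega> j) - tv (\<omega> j)) + rise_sv K (\<omega> n)"

lemma measurable_walk [measurable]: "walk K n \<in> borel_measurable S"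
  unfolding walk_def by measurable

lemma walk_Suc_le: "0 \<le> K \<Longrightarrow> walk K (Suc n) \<omega> \<le> walk K n \<omega> + sv (\<omega> (Suc n))"
  using rise_le[of K "\<omega> (Suc n)"] tv_nonneg[of "\<omega> n"] by (simp add: walk_def)

lemma walk_add: "walk K (l + Suc n) \<omega> = walk K n \<omega> - tv (\<omega> n) + walk K l (\<lambda>j. \<omega> (j + Suc n))"
proof (induction l)
  case 0
  then show ?case by (simp add: walk_def)
next
  case (Suc l)
  then show ?case by (simp add: walk_def)
qed

lemma walk_cong: "(\<And>j. j \<le> n \<Longrightarrow> \<omega> j = \<omega>' j) \<Longrightarrow> walk K n \<omega> = walk K n \<omega>'"
  by (simp add: walk_def)

lemma walk_tight:
  assumes K: "0 \<le> K" and c: "c < a - integral\<^sup>L D (rise_sv K)" and \<delta>: "\<delta> > 0"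
  shows "\<exists>C0\<ge>0. \<forall>C\<ge>C0. measure S {\<omega>. \<exists>n. walk K n \<omega> > C - real n * c} \<le> \<delta>"
proof -
  define g where "g = integral\<^sup>L D (rise_sv K)"
  \<comment> \<open>The gap between the drift and the slope is shared by services and interarrival times.\<close>
  define \<eta> where "\<eta> = (a - g - c) / 2"
  have \<eta>: "\<eta> > 0" using c by (simp add: \<eta>_def g_def)
  have g0: "0 \<le> g" unfolding g_def by (intro Bochner_Integration.integral_nonneg rise_sv_nonneg)
  obtain C1 where C1: "C1 \<ge> 0" "\<And>C. C \<ge> C1 \<Longrightarrow>
      measure S {\<omega>. \<exists>n. (\<Sum>j<n. rise_sv K (\<omega> j)) > real n * (g + \<eta>) + C} \<le> \<delta> / 2"
    using partial_sums_tight[OF integrable_rise[OF K] \<eta>, of "\<delta> / 2"] \<delta> by (auto simp: g_def)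
  have "integrable D (\<lambda>v. - tv v)" using tv_integrable by simp
  then obtain C2 where C2: "C2 \<ge> 0" "\<And>C. C \<ge> C2 \<Longrightarrow>
      measure S {\<omega>. \<exists>n. (\<Sum>j<n. - tv (\<omega> j)) > real n * (- a + \<eta>) + C} \<le> \<delta> / 2"
    using partial_sums_tight[of "\<lambda>v. - tv v" \<eta> "\<delta> / 2"] \<eta> \<delta> mean_tv by auto
  let ?A = "{\<omega>. \<exists>n. (\<Sum>j<n. rise_sv K (\<omega> j)) > real n * (g + \<eta>) + C1}"
  let ?B = "{\<omega>. \<exists>n. (\<Sum>j<n. - tv (\<omega> j)) > real n * (- a + \<eta>) + C2}"
  have mA: "?A \<in> sets S"
    by (rule sets_Collect_S) measurable
  have mB: "?B \<in> sets S"
    by (rule sets_Collect_S) measurable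
  show ?thesis
  proof (intro exI[of _ "C1 + C2 + g + \<eta>"] conjI allI impI)
    show "0 \<le> C1 + C2 + g + \<eta>" using C1 C2 g0 \<eta> by simp
    fix C assume C: "C1 + C2 + g + \<eta> \<le> C"
    have sub: "{\<omega>. \<exists>n. walk K n \<omega> > C - real n * c} \<subseteq> ?A \<union> ?B"
    proof
      fix \<omega> assume "\<omega> \<in> {\<omega>. \<exists>n. walk K n \<omega> > C - real n * c}"
      then obtain n where n: "walk K n \<omega> > C - real n * c" by blast
      show "\<omega> \<in> ?A \<union> ?B"
      proof (rule ccontr)
        assume "\<omega> \<notin> ?A \<union> ?B"
        then have 1: "(\<Sum>j<Suc n. rise_sv K (\<omega> j)) \<le> real (Suc n) * (g + \<eta>) + C1"
          and 2: "(\<Sum>j<n. - tv (\<omega> j)) \<le> real n * (- a + \<eta>) + C2"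
          by (simp_all only: Un_iff mem_Collect_eq de_Morgan_disj not_ex not_less)
        have "walk K n \<omega> = (\<Sum>j<Suc n. rise_sv K (\<omega> j)) + (\<Sum>j<n. - tv (\<omega> j))"
          by (simp add: walk_def sum_subtractf sum_negf)
        also have "\<dots> \<le> real (Suc n) * (g + \<eta>) + C1 + (real n * (- a + \<eta>) + C2)"
          using 1 2 by linarith
        also have "\<dots> = C1 + C2 + g + \<eta> + real n * (g + \<eta> - a + \<eta>)"
          by (simp add: algebra_simps)
        also have "g + \<eta> - a + \<eta> = - c" by (simp add: \<eta>_def field_simps)
        finally show False using n C by simp
      qed
    qed
    have "measure S {\<omega>. \<exists>n. walk K n \<omega> > C - real n * c} \<le> measure S (?A \<union> ?B)"
      using sub mA mB by (intro P.finite_measure_mono) auto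
    also have "\<dots> \<le> measure S ?A + measure S ?B"
      by (rule measure_Un_le[OF mA mB])
    also have "\<dots> \<le> \<delta>" using C1(2)[of C1] C2(2)[of C2] by simp
    finally show "measure S {\<omega>. \<exists>n. walk K n \<omega> > C - real n * c} \<le> \<delta>" .
  qed
qed

end

locale heavy_queue = heavy_service D sv \<nu> + queue_law D sv tv a b m
  for D :: "'b measure" and sv tv :: "'b \<Rightarrow> real" and \<nu> :: "real measure" and a b :: real and m :: nat
begin

context
  fixes K c :: real
  assumes K: "0 \<le> K" and c: "0 < c" "c < a - integral\<^sup>L D (rise_sv K)"
begin

text \<open>
Passage above a line that descends more slowly than the walk drifts. Such a passage is unlikely for
large \<open>r\<close>, and before it the walk is low, so an overshoot is due to a single increment.
\<close>
definition first_passage :: "real \<Rightarrow> nat \<Rightarrow> (nat \<Rightarrow> 'b) \<Rightarrow> bool" where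
  "first_passage r n \<omega> \<longleftrightarrow>
     walk K n \<omega> > r - real n * c \<and> (\<forall>k<n. walk K k \<omega> \<le> r - real k * c)"

definition sup_tail :: "real \<Rightarrow> real" where
  "sup_tail x = measure S {\<omega>. \<exists>n. walk K n \<omega> > x}"

definition passage_prob :: "real \<Rightarrow> real" where
  "passage_prob r = measure S {\<omega>. \<exists>n. walk K n \<omega> > r - real n * c}"

text \<open>
The first passage does not come close to \<open>x\<close>, and an independent copy of the walk has to
cover the rest.
\<close>
definition relay :: "real \<Rightarrow> real \<Rightarrow> real \<Rightarrow> nat \<Rightarrow> ((nat \<Rightarrow> 'b) \<times> (nat \<Rightarrow> 'b)) set" where
  "relay r h x n = {(\<omega>, \<omega>'). first_passage r n \<omega> \<and> walk K n \<omega> \<le> x - h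
      \<and> (\<exists>l. walk K l \<omega>' > x - max 0 (walk K n \<omega>))}"

abbreviation relayed :: "real \<Rightarrow> real \<Rightarrow> real \<Rightarrow> (nat \<Rightarrow> 'b) set" where
  "relayed r h x \<equiv> {\<omega>. \<exists>n. (\<omega>, \<lambda>j. \<omega> (j + Suc n)) \<in> relay r h x n}"

lemma measurable_first_passage [measurable]: "Measurable.pred S (first_passage r n)"
  unfolding first_passage_def by measurable

lemma first_passage_unique: "first_passage r n \<omega> \<Longrightarrow> first_passage r k \<omega> \<Longrightarrow> n = k"
  unfolding first_passage_def by (metis linorder_neqE_nat not_less)

lemma passage_prob_small: "\<delta> > 0 \<Longrightarrow> \<exists>r\<ge>0. passage_prob r \<le> \<delta>"
  using walk_tight[OF K c(2)] by (auto simp: passage_prob_def)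

lemma first_passage_jump:
  assumes f: "first_passage r n \<omega>" and r: "0 \<le> r" and y: "walk K n \<omega> > y"
  shows "sv (\<omega> n) > y - r - c + real n * c"
proof (cases n)
  case 0
  then show ?thesis using y r c rise_le[OF K, of "\<omega> 0"] by (simp add: walk_def)
next
  case (Suc k)
  then have "walk K k \<omega> \<le> r - real k * c" using f by (auto simp: first_passage_def)
  then show ?thesis using walk_Suc_le[OF K, of k \<omega>] y Suc by (simp add: algebra_simps)
qed

text \<open>
Either the increment at the first passage covers the distance to \<open>x\<close> up to \<open>h\<close>, or
the walk restarted after the passage covers the remainder.
\<close>
lemma exceedance_cases:
  assumes x: "r \<le> x" and h: "0 \<le> h" and r: "0 \<le> r" and ex: "walk K n \<omega> > x"
  shows "(\<exists>k. sv (\<omega> k) > x - h - r - c + real k * c)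
    \<or> (\<exists>k. (\<omega>, \<lambda>j. \<omega> (j + Suc k)) \<in> relay r h x k)"
proof -
  have "0 \<le> real n * c" using c by simp
  then have "r - real n * c \<le> x" using x by linarith
  then have "walk K n \<omega> > r - real n * c" using ex by linarith
  then have ex': "\<exists>n. walk K n \<omega> > r - real n * c" by blast
  define k where "k = (LEAST n. walk K n \<omega> > r - real n * c)"
  have k: "walk K k \<omega> > r - real k * c" unfolding k_def using ex' by (rule LeastI_ex)
  have kmin: "walk K j \<omega> \<le> r - real j * c" if "j < k" for j
    using not_less_Least[OF that[unfolded k_def]] by simp
  have f: "first_passage r k \<omega>" using k kmin by (auto simp: first_passage_def)
  have "k \<le> n"
  proof (rule ccontr)
    assume "\<not> k \<le> n"
    then have "walk K n \<omega> \<le> r - real n * c" by (intro kmin) simp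
    then show False using \<open>walk K n \<omega> > r - real n * c\<close> by simp
  qed
  show ?thesis
  proof (cases "walk K k \<omega> > x - h")
    case True
    then show ?thesis using first_passage_jump[OF f r True] by (auto simp: algebra_simps)
  next
    case False
    then have "k \<noteq> n" using ex h by auto
    then have "Suc k \<le> n" using \<open>k \<le> n\<close> by simp
    then have l: "n = (n - Suc k) + Suc k" by simp
    define l where "l = n - Suc k"
    have l: "n = l + Suc k" using l by (simp add: l_def)
    have "walk K n \<omega> \<le> max 0 (walk K k \<omega>) + walk K l (\<lambda>j. \<omega> (j + Suc k))"
      unfolding l walk_add using tv_nonneg[of "\<omega> k"] by simp
    then have "walk K l (\<lambda>j. \<omega> (j + Suc k)) > x - max 0 (walk K k \<omega>)" using ex by simp
    then show ?thesis using f False by (auto simp: relay_def not_less)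
  qed
qed

lemma jump_sum_bound:
  "\<exists>Q>0. \<forall>y\<ge>0. summable (\<lambda>n. exceed (y - r + real n * c)) \<and>
     (\<Sum>n. exceed (y - r + real n * c)) \<le> Q * tail \<nu> y"
proof -
  obtain Q where Q: "Q > 0" "\<And>y. y \<ge> 0 \<Longrightarrow> excess (y - (r + 1)) \<le> Q * tail \<nu> y"
    using excess_shift_bound[of "r + 1"] by blast
  have "summable (\<lambda>n. exceed (y - r + real n * c)) \<and>
     (\<Sum>n. exceed (y - r + real n * c)) \<le> (1 / c + 1) * Q * tail \<nu> y" if y: "0 \<le> y" for y
  proof
    show "summable (\<lambda>n. exceed (y - r + real n * c))" by (rule exceed_linear_sums(1)[OF c(1)])
    have "(\<Sum>n. exceed (y - r + real n * c)) \<le> excess (y - r) / c + exceed (y - r)"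
      by (rule exceed_linear_sums(2)[OF c(1)])
    also have "\<dots> \<le> excess (y - (r + 1)) / c + excess (y - (r + 1))"
      using c exceed_le_excess[of "y - r"]
      by (intro add_mono divide_right_mono excess_mono) (auto simp: algebra_simps)
    also have "\<dots> = (1 / c + 1) * excess (y - (r + 1))" by (simp add: algebra_simps)
    also have "\<dots> \<le> (1 / c + 1) * (Q * tail \<nu> y)" using c Q(2)[OF y] by (intro mult_left_mono) auto
    finally show "(\<Sum>n. exceed (y - r + real n * c)) \<le> (1 / c + 1) * Q * tail \<nu> y" by (simp add: mult.assoc)
  qed
  then show ?thesis using Q(1) c by (intro exI[of _ "(1 / c + 1) * Q"]) (auto intro!: mult_pos_pos add_pos_pos)
qed


lemma sets_relay [measurable]: "relay r h x n \<in> sets (S \<Otimes>\<^sub>M S)"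
proof -
  have "{p \<in> space (S \<Otimes>\<^sub>M S). first_passage r n (fst p) \<and> walk K n (fst p) \<le> x - h
      \<and> (\<exists>l. walk K l (snd p) > x - max 0 (walk K n (fst p)))} \<in> sets (S \<Otimes>\<^sub>M S)"
    by measurable
  moreover have "relay r h x n = {p \<in> space (S \<Otimes>\<^sub>M S). first_passage r n (fst p) \<and> walk K n (fst p) \<le> x - h
      \<and> (\<exists>l. walk K l (snd p) > x - max 0 (walk K n (fst p)))}"
    by (auto simp: relay_def space_pair_measure)
  ultimately show ?thesis by simp
qed

text \<open>
Given the walk up to the passage, the rest is a fresh walk whose maximum has the assumed tail.
\<close>
lemma emeasure_relay:
  assumes A: "\<And>y. 0 \<le> y \<Longrightarrow> y \<le> x \<Longrightarrow> sup_tail y \<le> A * tail \<nu> y" and h: "0 \<le> h" "h \<le> x"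
  shows "emeasure S {\<omega>. (\<omega>, \<lambda>j. \<omega> (j + Suc n)) \<in> relay r h x n}
    \<le> (\<integral>\<^sup>+\<omega>. indicator {\<omega>. first_passage r n \<omega> \<and> walk K n \<omega> \<le> x - h} \<omega>
          * ennreal (A * tail \<nu> (x - max 0 (walk K n \<omega>))) \<partial>S)"
proof -
  have "emeasure S {\<omega>. (\<omega>, \<lambda>j. \<omega> (j + Suc n)) \<in> relay r h x n}
      = (\<integral>\<^sup>+\<omega>. emeasure S {\<omega>'. (\<omega>, \<omega>') \<in> relay r h x n} \<partial>S)"
  proof (rule emeasure_past_future[OF sets_relay])
    fix \<omega> \<omega>' \<omega>''
    have w: "walk K k (comb_seq (Suc n) \<omega> \<omega>') = walk K k \<omega>" if "k \<le> n" for k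
      using that by (intro walk_cong) (simp add: comb_seq_def)
    then show "(comb_seq (Suc n) \<omega> \<omega>', \<omega>'') \<in> relay r h x n \<longleftrightarrow> (\<omega>, \<omega>'') \<in> relay r h x n"
      by (auto simp: relay_def first_passage_def)
  qed
  also have "\<dots> \<le> (\<integral>\<^sup>+\<omega>. indicator {\<omega>. first_passage r n \<omega> \<and> walk K n \<omega> \<le> x - h} \<omega>
          * ennreal (A * tail \<nu> (x - max 0 (walk K n \<omega>))) \<partial>S)"
  proof (rule nn_integral_mono)
    fix \<omega>
    show "emeasure S {\<omega>'. (\<omega>, \<omega>') \<in> relay r h x n}
      \<le> indicator {\<omega>. first_passage r n \<omega> \<and> walk K n \<omega> \<le> x - h} \<omega>
          * ennreal (A * tail \<nu> (x - max 0 (walk K n \<omega>)))"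
    proof (cases "first_passage r n \<omega> \<and> walk K n \<omega> \<le> x - h")
      case True
      have "emeasure S {\<omega>'. (\<omega>, \<omega>') \<in> relay r h x n} = ennreal (sup_tail (x - max 0 (walk K n \<omega>)))"
        using True by (simp add: relay_def sup_tail_def P.emeasure_eq_measure)
      also have "\<dots> \<le> ennreal (A * tail \<nu> (x - max 0 (walk K n \<omega>)))"
        using True h by (intro ennreal_leI A) auto
      finally show ?thesis using True by simp
    next
      case False
      then have "{\<omega>'. (\<omega>, \<omega>') \<in> relay r h x n} = {}" by (auto simp: relay_def)
      then show ?thesis by simp
    qed
  qed
  finally show ?thesis .
qed

lemma sum_first_passage_le:
  assumes Y: "\<And>n. Y n \<in> sets S" "\<And>n \<omega>. \<omega> \<in> Y n \<Longrightarrow> first_passage r n \<omega>"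
  shows "(\<Sum>n. emeasure S (Y n)) \<le> ennreal (passage_prob r)"
proof -
  have "(\<Sum>n. emeasure S (Y n)) = emeasure S (\<Union>n. Y n)"
  proof (rule suminf_emeasure)
    show "range Y \<subseteq> sets S" using Y(1) by blast
    show "disjoint_family Y" unfolding disjoint_family_on_def using Y(2) first_passage_unique by blast
  qed
  also have "\<dots> \<le> emeasure S {\<omega>. \<exists>n. walk K n \<omega> > r - real n * c}"
  proof (rule emeasure_mono)
    show "(\<Union>n. Y n) \<subseteq> {\<omega>. \<exists>n. walk K n \<omega> > r - real n * c}"
      using Y(2) unfolding first_passage_def by blast
    have "{\<omega> \<in> space S. \<exists>n. walk K n \<omega> > r - real n * c} \<in> sets S" by measurable
    then show "{\<omega>. \<exists>n. walk K n \<omega> > r - real n * c} \<in> sets S" by simp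
  qed
  finally show ?thesis by (simp add: passage_prob_def P.emeasure_eq_measure)
qed

text \<open>
Let \<open>y\<close> have the law \<open>\<nu>\<close>. Up to the factor \<open>A\<close>, the relay probability
is at most the probability that the passage height and \<open>y\<close> add up to more than
\<open>x\<close>. The order of integration is exchanged, because only the tail of the passage height is
controlled: for \<open>h < y \<le> x - h\<close> by a multiple of \<open>tail \<nu> (x - y)\<close>, and for larger
\<open>y\<close> by the probability that a passage occurs at all.
\<close>
lemma relay_total:
  assumes A: "\<And>y. 0 \<le> y \<Longrightarrow> y \<le> x \<Longrightarrow> sup_tail y \<le> A * tail \<nu> y" "0 \<le> A"
    and h: "0 \<le> h" "h \<le> x" and r: "0 \<le> r"
    and Q: "0 < Q" "\<And>y. 0 \<le> y \<Longrightarrow> summable (\<lambda>n. exceed (y - (r + c) + real n * c)) \<and>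
       (\<Sum>n. exceed (y - (r + c) + real n * c)) \<le> Q * tail \<nu> y"
  shows "measure S (relayed r h x)
    \<le> A * (Q * (LINT y|\<nu>. indicator {h<..x - h} y * tail \<nu> (x - y)) + passage_prob r * tail \<nu> (x - h))"
proof -
  interpret \<nu>S: pair_sigma_finite \<nu> S ..
  let ?B = "\<lambda>n. {\<omega>. first_passage r n \<omega> \<and> walk K n \<omega> \<le> x - h}"
  have B [measurable]: "?B n \<in> sets S" for n
    by (rule sets_Collect_S) measurable
  let ?R = "\<lambda>n. {\<omega>. (\<omega>, \<lambda>j. \<omega> (j + Suc n)) \<in> relay r h x n}"
  have R: "?R n \<in> sets S" for n
    by (rule sets_Collect_S) measurable
  let ?Y = "\<lambda>y n. {\<omega>. first_passage r n \<omega> \<and> walk K n \<omega> \<le> x - h \<and> x - max 0 (walk K n \<omega>) < y}"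
  have Y: "?Y y n \<in> sets S" for y n
    by (rule sets_Collect_S) measurable
  let ?P = "\<lambda>n. {p \<in> space (\<nu> \<Otimes>\<^sub>M S). first_passage r n (snd p) \<and> walk K n (snd p) \<le> x - h
      \<and> x - max 0 (walk K n (snd p)) < fst p}"
  have P: "?P n \<in> sets (\<nu> \<Otimes>\<^sub>M S)" for n
  proof -
    have [measurable]: "fst \<in> borel_measurable (\<nu> \<Otimes>\<^sub>M S)"
      using measurable_fst[of \<nu> S] by (simp cong: measurable_cong_sets)
    show ?thesis by measurable
  qed
  have Yind: "case_prod (\<lambda>y \<omega>. indicator (?Y y n) \<omega> :: ennreal) \<in> borel_measurable (\<nu> \<Otimes>\<^sub>M S)" for n
  proof -
    have "case_prod (\<lambda>y \<omega>. indicator (?Y y n) \<omega> :: ennreal) = indicator (?P n)"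
      by (auto simp: fun_eq_iff indicator_def space_pair_measure)
    then show ?thesis using P[of n] by (simp only: borel_measurable_indicator)
  qed
  have "emeasure S (relayed r h x) = emeasure S (\<Union>n. ?R n)"
    by (rule arg_cong[where f = "emeasure S"]) auto
  also have "\<dots> \<le> (\<Sum>n. emeasure S (?R n))"
    by (rule emeasure_subadditive_countably) (use R in auto)
  also have "\<dots> \<le> (\<Sum>n. \<integral>\<^sup>+\<omega>. indicator (?B n) \<omega> * ennreal (A * tail \<nu> (x - max 0 (walk K n \<omega>))) \<partial>S)"
    by (intro suminf_le summableI emeasure_relay A h)
  also have "\<dots> = (\<Sum>n. ennreal A * (\<integral>\<^sup>+\<omega>. indicator (?B n) \<omega> * ennreal (tail \<nu> (x - max 0 (walk K n \<omega>))) \<partial>S))"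
  proof (intro arg_cong[where f = suminf] ext)
    fix n
    have "(\<integral>\<^sup>+\<omega>. indicator (?B n) \<omega> * ennreal (A * tail \<nu> (x - max 0 (walk K n \<omega>))) \<partial>S)
        = (\<integral>\<^sup>+\<omega>. ennreal A * (indicator (?B n) \<omega> * ennreal (tail \<nu> (x - max 0 (walk K n \<omega>)))) \<partial>S)"
      using A(2) tail_pos by (intro nn_integral_cong) (simp add: ennreal_mult less_imp_le mult.left_commute)
    also have "\<dots> = ennreal A * (\<integral>\<^sup>+\<omega>. indicator (?B n) \<omega> * ennreal (tail \<nu> (x - max 0 (walk K n \<omega>))) \<partial>S)"
      by (rule nn_integral_cmult) measurable
    finally show "(\<integral>\<^sup>+\<omega>. indicator (?B n) \<omega> * ennreal (A * tail \<nu> (x - max 0 (walk K n \<omega>))) \<partial>S)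
        = ennreal A * (\<integral>\<^sup>+\<omega>. indicator (?B n) \<omega> * ennreal (tail \<nu> (x - max 0 (walk K n \<omega>))) \<partial>S)" .
  qed
  also have "\<dots> = ennreal A * (\<Sum>n. \<integral>\<^sup>+\<omega>. indicator (?B n) \<omega> * ennreal (tail \<nu> (x - max 0 (walk K n \<omega>))) \<partial>S)"
    by (rule ennreal_suminf_cmult)
  also have "(\<Sum>n. \<integral>\<^sup>+\<omega>. indicator (?B n) \<omega> * ennreal (tail \<nu> (x - max 0 (walk K n \<omega>))) \<partial>S)
      = (\<Sum>n. \<integral>\<^sup>+y. emeasure S (?Y y n) \<partial>\<nu>)"
  proof (intro arg_cong[where f = suminf] ext)
    fix n
    have "(\<integral>\<^sup>+\<omega>. indicator (?B n) \<omega> * ennreal (tail \<nu> (x - max 0 (walk K n \<omega>))) \<partial>S)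
        = (\<integral>\<^sup>+\<omega>. \<integral>\<^sup>+y. indicator (?Y y n) \<omega> \<partial>\<nu> \<partial>S)"
    proof (intro nn_integral_cong)
      fix \<omega>
      have "(\<integral>\<^sup>+y. indicator (?Y y n) \<omega> \<partial>\<nu>)
          = (\<integral>\<^sup>+y. indicator (?B n) \<omega> * indicator {x - max 0 (walk K n \<omega>)<..} y \<partial>\<nu>)"
        by (intro nn_integral_cong) (auto simp: indicator_def)
      also have "\<dots> = indicator (?B n) \<omega> * emeasure \<nu> {x - max 0 (walk K n \<omega>)<..}"
        by (subst nn_integral_cmult) auto
      finally show "indicator (?B n) \<omega> * ennreal (tail \<nu> (x - max 0 (walk K n \<omega>)))
          = (\<integral>\<^sup>+y. indicator (?Y y n) \<omega> \<partial>\<nu>)"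
        by (simp add: tail_def emeasure_eq_measure)
    qed
    also have "\<dots> = (\<integral>\<^sup>+y. \<integral>\<^sup>+\<omega>. indicator (?Y y n) \<omega> \<partial>S \<partial>\<nu>)"
      by (rule \<nu>S.Fubini'[of "\<lambda>y \<omega>. indicator (?Y y n) \<omega>", OF Yind])
    also have "\<dots> = (\<integral>\<^sup>+y. emeasure S (?Y y n) \<partial>\<nu>)" using Y by simp
    finally show "(\<integral>\<^sup>+\<omega>. indicator (?B n) \<omega> * ennreal (tail \<nu> (x - max 0 (walk K n \<omega>))) \<partial>S)
        = (\<integral>\<^sup>+y. emeasure S (?Y y n) \<partial>\<nu>)" .
  qed
  also have "(\<Sum>n. \<integral>\<^sup>+y. emeasure S (?Y y n) \<partial>\<nu>) = (\<integral>\<^sup>+y. (\<Sum>n. emeasure S (?Y y n)) \<partial>\<nu>)"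
  proof (rule nn_integral_suminf[symmetric])
    fix n
    show "(\<lambda>y. emeasure S (?Y y n)) \<in> borel_measurable \<nu>"
      using P.measurable_emeasure_Pair[OF P[of n]]
      by (simp add: vimage_def space_pair_measure)
  qed
  also have "\<dots> \<le> (\<integral>\<^sup>+y. ennreal (Q * (indicator {h<..x - h} y * tail \<nu> (x - y)) + passage_prob r * indicator {x - h<..} y) \<partial>\<nu>)"
  proof (rule nn_integral_mono)
    fix y
    consider "y \<le> h" | "h < y" "y \<le> x - h" | "x - h < y" by linarith
    then show "(\<Sum>n. emeasure S (?Y y n))
      \<le> ennreal (Q * (indicator {h<..x - h} y * tail \<nu> (x - y)) + passage_prob r * indicator {x - h<..} y)"
    proof cases
      case 1
      have "?Y y n = {}" for n using 1 h by (auto simp: max_def)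
      then have "(\<Sum>n. emeasure S (?Y y n)) = 0" by (simp only: emeasure_empty) simp
      then show ?thesis by simp
    next
      case 2
      have "emeasure S (?Y y n) \<le> ennreal (exceed (x - y - (r + c) + real n * c))" for n
      proof -
        have jump: "sv (\<omega> n) > x - y - (r + c) + real n * c" if "\<omega> \<in> ?Y y n" for \<omega>
        proof -
          have "walk K n \<omega> > x - y" using that 2 h by (auto simp: max_def split: if_splits)
          then show ?thesis using first_passage_jump[of r n \<omega> "x - y"] that r by (simp add: algebra_simps)
        qed
        have "emeasure S (?Y y n) \<le> emeasure S {\<omega> \<in> space S. \<omega> n \<in> {v. sv v > x - y - (r + c) + real n * c}}"
        proof (rule emeasure_mono)
          show "?Y y n \<subseteq> {\<omega> \<in> space S. \<omega> n \<in> {v. sv v > x - y - (r + c) + real n * c}}"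
            using jump by auto
        qed measurable
        also have "\<dots> = emeasure D {v. sv v > x - y - (r + c) + real n * c}"
          by (rule emeasure_PiM_Collect_single) auto
        finally show ?thesis by (simp add: exceed_def M.emeasure_eq_measure)
      qed
      then have "(\<Sum>n. emeasure S (?Y y n)) \<le> (\<Sum>n. ennreal (exceed (x - y - (r + c) + real n * c)))"
        by (intro suminf_le summableI)
      also have "\<dots> = ennreal (\<Sum>n. exceed (x - y - (r + c) + real n * c))"
        using Q(2)[of "x - y"] 2 h by (intro suminf_ennreal2 exceed_nonneg) auto
      also have "\<dots> \<le> ennreal (Q * tail \<nu> (x - y))"
        using Q(2)[of "x - y"] 2 h by (intro ennreal_leI) auto
      finally show ?thesis using 2 by simp
    next
      case 3
      have "(\<Sum>n. emeasure S (?Y y n)) \<le> ennreal (passage_prob r)"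
        using Y by (intro sum_first_passage_le) auto
      then show ?thesis using 3 by simp
    qed
  qed
  also have "\<dots> = ennreal (LINT y|\<nu>. Q * (indicator {h<..x - h} y * tail \<nu> (x - y)) + passage_prob r * indicator {x - h<..} y)"
  proof (rule nn_integral_eq_integral)
    show "integrable \<nu> (\<lambda>y. Q * (indicator {h<..x - h} y * tail \<nu> (x - y)) + passage_prob r * indicator {x - h<..} y)"
      using tail_le_1 tail_pos
      by (intro Bochner_Integration.integrable_add integrable_mult_right integrable_tail_bounded)
        (auto simp: indicator_def less_imp_le abs_of_pos)
    show "AE y in \<nu>. 0 \<le> Q * (indicator {h<..x - h} y * tail \<nu> (x - y)) + passage_prob r * indicator {x - h<..} y"
      using Q(1) tail_pos by (intro AE_I2) (auto simp: indicator_def less_imp_le passage_prob_def)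
  qed
  also have "(LINT y|\<nu>. Q * (indicator {h<..x - h} y * tail \<nu> (x - y)) + passage_prob r * indicator {x - h<..} y)
      = Q * (LINT y|\<nu>. indicator {h<..x - h} y * tail \<nu> (x - y)) + passage_prob r * tail \<nu> (x - h)"
  proof -
    have "integrable \<nu> (\<lambda>y. indicator {h<..x - h} y * tail \<nu> (x - y))"
      using tail_le_1 tail_pos
      by (intro integrable_tail_bounded) (auto simp: indicator_def less_imp_le abs_of_pos)
    moreover have "integrable \<nu> (indicator {x - h<..} :: real \<Rightarrow> real)"
      by (intro integrable_tail_bounded) auto
    ultimately show ?thesis by (simp add: tail_def)
  qed
  finally have "emeasure S (relayed r h x)
    \<le> ennreal A * ennreal (Q * (LINT y|\<nu>. indicator {h<..x - h} y * tail \<nu> (x - y)) + passage_prob r * tail \<nu> (x - h))"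
    by (simp add: mult_left_mono)
  moreover have nn: "0 \<le> Q * (LINT y|\<nu>. indicator {h<..x - h} y * tail \<nu> (x - y)) + passage_prob r * tail \<nu> (x - h)"
    using Q(1) tail_pos
    by (intro add_nonneg_nonneg mult_nonneg_nonneg Bochner_Integration.integral_nonneg)
       (auto simp: less_imp_le passage_prob_def)
  ultimately show ?thesis
    using A(2) by (simp add: P.emeasure_eq_measure flip: ennreal_mult)
qed


lemma sets_relay_event:
  "(relayed r h x) \<in> sets S"
    by (rule sets_Collect_S) measurable

text \<open>
The level \<open>r\<close> makes a passage unlikely, and then \<open>h\<close> makes the middle part of the
convolution small. The constant \<open>A\<close> stays free, since it is known only later.
\<close>
lemma relay_small:
  assumes e: "e > 0"
  shows "\<exists>r\<ge>0. \<exists>h\<ge>0. \<forall>\<^sub>F x in at_top. \<forall>A\<ge>0. (\<forall>y. 0 \<le> y \<and> y \<le> x \<longrightarrow> sup_tail y \<le> A * tail \<nu> y)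
    \<longrightarrow> measure S (relayed r h x) \<le> A * (e * tail \<nu> x)"
proof -
  obtain r where r: "r \<ge> 0" "passage_prob r \<le> e / 4" using passage_prob_small[of "e / 4"] e by auto
  obtain Q where Q: "Q > 0" "\<And>y. y \<ge> 0 \<Longrightarrow> summable (\<lambda>n. exceed (y - (r + c) + real n * c)) \<and>
       (\<Sum>n. exceed (y - (r + c) + real n * c)) \<le> Q * tail \<nu> y"
    using jump_sum_bound[of "r + c"] by blast
  obtain h where h: "h \<ge> 0" "\<forall>\<^sub>F x in at_top.
     (LINT y|\<nu>. indicator {h<..x - h} y * tail \<nu> (x - y)) \<le> e / (2 * Q) * tail \<nu> x"
    using convolution_middle_small[of "e / (2 * Q)"] e Q(1) by auto
  have "\<forall>\<^sub>F x in at_top. tail \<nu> (x - h) \<le> (1 + 1) * tail \<nu> x"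
    using h by (intro long_tailed) auto
  with h(2) eventually_ge_at_top[of h]
  have "\<forall>\<^sub>F x in at_top. \<forall>A\<ge>0. (\<forall>y. 0 \<le> y \<and> y \<le> x \<longrightarrow> sup_tail y \<le> A * tail \<nu> y)
    \<longrightarrow> measure S (relayed r h x) \<le> A * (e * tail \<nu> x)"
  proof eventually_elim
    case (elim x)
    show ?case
    proof (intro allI impI)
      fix A :: real assume A: "0 \<le> A" "\<forall>y. 0 \<le> y \<and> y \<le> x \<longrightarrow> sup_tail y \<le> A * tail \<nu> y"
      have "measure S (relayed r h x)
        \<le> A * (Q * (LINT y|\<nu>. indicator {h<..x - h} y * tail \<nu> (x - y)) + passage_prob r * tail \<nu> (x - h))"
        using A h elim r Q by (intro relay_total) auto
      also have "\<dots> \<le> A * (Q * (e / (2 * Q) * tail \<nu> x) + e / 4 * (2 * tail \<nu> x))"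
        using A Q(1) elim r e tail_pos[of "x - h"] by (intro mult_left_mono add_mono mult_mono) auto
      also have "\<dots> = A * (e * tail \<nu> x)" using Q(1) by (simp add: field_simps)
      finally show "measure S (relayed r h x) \<le> A * (e * tail \<nu> x)" .
    qed
  qed
  then show ?thesis using r(1) h(1) by blast
qed

text \<open>
With \<open>e = 1 / 2\<close>, a bound \<open>A\<close> for the ratio of the tails on \<open>[0, X]\<close> implies the
bound \<open>Q + A / 2\<close> there, apart from small arguments. The best \<open>A\<close> is therefore bounded
independently of \<open>X\<close>.
\<close>
lemma sup_tail_bound: "\<exists>A\<ge>0. \<forall>y\<ge>0. sup_tail y \<le> A * tail \<nu> y"
proof -
  obtain r h where rh: "r \<ge> 0" "h \<ge> 0" and
    ev: "\<forall>\<^sub>F x in at_top. \<forall>A\<ge>0. (\<forall>y. 0 \<le> y \<and> y \<le> x \<longrightarrow> sup_tail y \<le> A * tail \<nu> y)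
    \<longrightarrow> measure S (relayed r h x) \<le> A * (1 / 2 * tail \<nu> x)"
    using relay_small[of "1 / 2"] by auto
  obtain Q where Q: "Q > 0" "\<And>y. y \<ge> 0 \<Longrightarrow> summable (\<lambda>n. exceed (y - (h + r + c) + real n * c)) \<and>
       (\<Sum>n. exceed (y - (h + r + c) + real n * c)) \<le> Q * tail \<nu> y"
    using jump_sum_bound[of "h + r + c"] by blast
  obtain x1 where x1: "\<And>x A. x \<ge> x1 \<Longrightarrow> 0 \<le> A \<Longrightarrow> (\<And>y. 0 \<le> y \<Longrightarrow> y \<le> x \<Longrightarrow> sup_tail y \<le> A * tail \<nu> y)
    \<Longrightarrow> measure S (relayed r h x) \<le> A * (1 / 2 * tail \<nu> x)"
    using ev unfolding eventually_at_top_linorder by blast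
  \<comment> \<open>Below \<open>x0\<close> the trivial bound \<open>sup_tail \<le> 1\<close> suffices.\<close>
  define x0 where "x0 = max x1 (max r 0)"
  define B where "B = max (2 * Q) (1 / tail \<nu> x0)"
  have st01: "0 \<le> sup_tail y" "sup_tail y \<le> 1" for y by (auto simp: sup_tail_def P.prob_le_1)
  have step: "sup_tail x \<le> (Q + A / 2) * tail \<nu> x"
    if x: "x0 \<le> x" and A: "0 \<le> A" "\<And>y. 0 \<le> y \<Longrightarrow> y \<le> x \<Longrightarrow> sup_tail y \<le> A * tail \<nu> y" for x A
  proof -
    have m: "{\<omega>. \<exists>n. sv (\<omega> n) > x - (h + r + c) + real n * c} \<in> sets S"
    by (rule sets_Collect_S) measurable
    have "sup_tail x \<le> measure S ({\<omega>. \<exists>n. sv (\<omega> n) > x - (h + r + c) + real n * c}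
        \<union> (relayed r h x))"
      unfolding sup_tail_def
    proof (rule P.finite_measure_mono)
      show "{\<omega>. \<exists>n. walk K n \<omega> > x} \<subseteq> {\<omega>. \<exists>n. sv (\<omega> n) > x - (h + r + c) + real n * c}
        \<union> (relayed r h x)"
      proof
        fix \<omega> assume "\<omega> \<in> {\<omega>. \<exists>n. walk K n \<omega> > x}"
        then obtain n where "walk K n \<omega> > x" by blast
        then show "\<omega> \<in> {\<omega>. \<exists>n. sv (\<omega> n) > x - (h + r + c) + real n * c}
          \<union> (relayed r h x)"
          using exceedance_cases[of r x h n \<omega>] rh x by (auto simp: x0_def algebra_simps)
      qed
    qed (use m sets_relay_event in auto)
    also have "\<dots> \<le> measure S {\<omega>. \<exists>n. sv (\<omega> n) > x - (h + r + c) + real n * c}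
        + measure S (relayed r h x)"
      by (rule measure_Un_le[OF m sets_relay_event])
    also have "measure S {\<omega>. \<exists>n. sv (\<omega> n) > x - (h + r + c) + real n * c} \<le> Q * tail \<nu> x"
      using big_jump_prob[of "\<lambda>n. x - (h + r + c) + real n * c"] Q(2)[of x] x by (auto simp: x0_def)
    also have "measure S (relayed r h x) \<le> A * (1 / 2 * tail \<nu> x)"
      using x by (intro x1 A) (auto simp: x0_def)
    finally show ?thesis by (simp add: algebra_simps)
  qed
  have "sup_tail X \<le> B * tail \<nu> X" if X: "0 \<le> X" for X
  proof -
    define A where "A = (SUP z\<in>{0..X}. sup_tail z / tail \<nu> z)"
    have "sup_tail z / tail \<nu> z \<le> 1 / tail \<nu> X" if "z \<in> {0..X}" for z
      using that tail_mono[of z X] tail_pos[of X] tail_pos[of z] st01[of z] by (intro frac_le) auto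
    then have bdd: "bdd_above ((\<lambda>z. sup_tail z / tail \<nu> z) ` {0..X})" by (rule bdd_aboveI2)
    have up: "sup_tail z / tail \<nu> z \<le> A" if "z \<in> {0..X}" for z
      unfolding A_def using that by (rule cSUP_upper[OF _ bdd])
    have A0: "0 \<le> A" using up[of 0] X st01(1)[of 0] tail_pos[of 0] by (meson atLeastAtMost_iff divide_nonneg_pos order.refl order.trans)
    have "(SUP z\<in>{0..X}. sup_tail z / tail \<nu> z) \<le> max B (Q + A / 2)"
    proof (rule cSUP_least)
      show "{0..X} \<noteq> {}" using X by auto
      fix z assume z: "z \<in> {0..X}"
      show "sup_tail z / tail \<nu> z \<le> max B (Q + A / 2)"
      proof (cases "x0 \<le> z")
        case True
        have "sup_tail z \<le> (Q + A / 2) * tail \<nu> z"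
        proof (rule step[OF True A0])
          fix y assume "0 \<le> y" "y \<le> z"
          then show "sup_tail y \<le> A * tail \<nu> y" using up[of y] z tail_pos[of y] by (simp add: field_simps)
        qed
        then have "sup_tail z / tail \<nu> z \<le> Q + A / 2" using tail_pos[of z] by (simp add: field_simps)
        then show ?thesis by simp
      next
        case False
        then have "sup_tail z / tail \<nu> z \<le> 1 / tail \<nu> x0"
          using tail_mono[of z x0] tail_pos[of x0] tail_pos[of z] st01[of z] by (intro frac_le) auto
        then show ?thesis by (simp add: B_def)
      qed
    qed
    then have "A \<le> max B (Q + A / 2)" unfolding A_def[symmetric] .
    moreover have "2 * Q \<le> B" by (simp add: B_def)
    ultimately have "A \<le> B" by (auto simp: max_def split: if_splits)
    moreover have "sup_tail X \<le> A * tail \<nu> X" using up[of X] X tail_pos[of X] by (simp add: field_simps)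
    ultimately show ?thesis using tail_pos[of X] by (meson less_imp_le mult_right_mono order.trans)
  qed
  moreover have "0 \<le> B" using Q(1) by (simp add: B_def)
  ultimately show ?thesis by blast
qed

text \<open>
Without a big increment only the relay remains, and \<open>sup_tail_bound\<close> supplies the constant
that makes it small.
\<close>
lemma no_big_jump:
  assumes e: "e > 0"
  shows "\<exists>C\<ge>0. \<forall>\<^sub>F x in at_top.
    measure S {\<omega>. (\<exists>n. walk K n \<omega> > x) \<and> (\<forall>n. sv (\<omega> n) \<le> x - C + real n * c)} \<le> e * tail \<nu> x"
proof -
  obtain A where A: "0 \<le> A" "\<And>y. 0 \<le> y \<Longrightarrow> sup_tail y \<le> A * tail \<nu> y" using sup_tail_bound by blast
  obtain r h where rh: "r \<ge> 0" "h \<ge> 0" and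
    ev: "\<forall>\<^sub>F x in at_top. \<forall>A'\<ge>0. (\<forall>y. 0 \<le> y \<and> y \<le> x \<longrightarrow> sup_tail y \<le> A' * tail \<nu> y)
    \<longrightarrow> measure S (relayed r h x) \<le> A' * (e / (A + 1) * tail \<nu> x)"
    using relay_small[of "e / (A + 1)"] e A(1) by auto
  have "\<forall>\<^sub>F x in at_top. measure S {\<omega>. (\<exists>n. walk K n \<omega> > x) \<and> (\<forall>n. sv (\<omega> n) \<le> x - (h + r + c) + real n * c)} \<le> e * tail \<nu> x"
    using ev eventually_ge_at_top[of r]
  proof eventually_elim
    case (elim x)
    have "measure S {\<omega>. (\<exists>n. walk K n \<omega> > x) \<and> (\<forall>n. sv (\<omega> n) \<le> x - (h + r + c) + real n * c)}
      \<le> measure S (relayed r h x)"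
    proof (rule P.finite_measure_mono[OF _ sets_relay_event])
      show "{\<omega>. (\<exists>n. walk K n \<omega> > x) \<and> (\<forall>n. sv (\<omega> n) \<le> x - (h + r + c) + real n * c)}
        \<subseteq> (relayed r h x)"
      proof
        fix \<omega> assume *: "\<omega> \<in> {\<omega>. (\<exists>n. walk K n \<omega> > x) \<and> (\<forall>n. sv (\<omega> n) \<le> x - (h + r + c) + real n * c)}"
        then obtain n where n: "walk K n \<omega> > x" by blast
        have "\<not> (\<exists>k. sv (\<omega> k) > x - h - r - c + real k * c)"
          using * by (auto simp: not_less algebra_simps)
        then show "\<omega> \<in> (relayed r h x)"
          using exceedance_cases[OF elim(2) rh(2,1) n] by blast
      qed
    qed
    also have "\<dots> \<le> A * (e / (A + 1) * tail \<nu> x)" using elim(1) A by blast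
    also have "\<dots> \<le> e * tail \<nu> x"
      using A(1) e tail_pos[of x] by (simp add: field_simps)
    finally show ?case .
  qed
  then show ?thesis using rh c by (intro exI[of _ "h + r + c"]) auto
qed

end

end

section \<open>The maximal dater as a functional of the past\<close>

lemma sort_nth_measurable:
  fixes xs :: "'a \<Rightarrow> real list"
  assumes len: "\<And>\<omega>. length (xs \<omega>) = m" and meas: "\<And>k. k < m \<Longrightarrow> (\<lambda>\<omega>. xs \<omega> ! k) \<in> borel_measurable N"
    and i: "i < m"
  shows "(\<lambda>\<omega>. sort (xs \<omega>) ! i) \<in> borel_measurable N"
  unfolding borel_measurable_iff_le
proof
  fix v
  have "card {k. k < length (xs \<omega>) \<and> xs \<omega> ! k \<le> v} = (\<Sum>k<m. if xs \<omega> ! k \<le> v then 1 else 0)" for \<omega>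
    by (simp add: len sum.If_cases Int_def)
  then have "{\<omega> \<in> space N. sort (xs \<omega>) ! i \<le> v}
      = {\<omega> \<in> space N. real i < (\<Sum>k<m. if xs \<omega> ! k \<le> v then 1 else 0)}"
    using nth_sort_le_iff[of i "xs _" v] i len by (auto simp: sum.If_cases)
  also have "\<dots> \<in> sets N" using meas by measurable
  finally show "{\<omega> \<in> space N. sort (xs \<omega>) ! i \<le> v} \<in> sets N" .
qed

lemma kw_workload_measurable:
  assumes "m \<ge> 1" and [measurable]: "\<And>i. (\<lambda>\<omega>. s \<omega> i) \<in> borel_measurable N" "\<And>i. (\<lambda>\<omega>. t \<omega> i) \<in> borel_measurable N"
    and "i < m"
  shows "(\<lambda>\<omega>. kw_workload m (s \<omega>) (t \<omega>) n j ! i) \<in> borel_measurable N"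
  using assms(4)
proof (induction j arbitrary: i)
  case (Suc j)
  note [measurable] = Suc.IH
  have 0: "(\<lambda>\<omega>. kw_workload m (s \<omega>) (t \<omega>) n j ! 0) \<in> borel_measurable N"
    using assms(1) by (intro Suc.IH) simp
  note [measurable] = 0
  have "(\<lambda>\<omega>. kw_step (s \<omega> (n + int j)) (t \<omega> (n + int j)) (kw_workload m (s \<omega>) (t \<omega>) n j) ! i) \<in> borel_measurable N"
    unfolding kw_step_def
  proof (rule sort_nth_measurable[where m = m])
    fix k assume k: "k < m"
    have [measurable]: "(\<lambda>\<omega>. kw_workload m (s \<omega>) (t \<omega>) n j ! k) \<in> borel_measurable N" using k by (rule Suc.IH)
    show "(\<lambda>\<omega>. map (\<lambda>v. max 0 (v - t \<omega> (n + int j))) ((kw_workload m (s \<omega>) (t \<omega>) n j)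
        [0 := kw_workload m (s \<omega>) (t \<omega>) n j ! 0 + s \<omega> (n + int j)]) ! k) \<in> borel_measurable N"
      using k by (cases "k = 0") simp_all
  qed (use Suc.prems in auto)
  then show ?case by simp
qed simp

lemma maximal_dater_measurable:
  assumes "m \<ge> 1" and [measurable]: "\<And>i. (\<lambda>\<omega>. s \<omega> i) \<in> borel_measurable N" "\<And>i. (\<lambda>\<omega>. t \<omega> i) \<in> borel_measurable N"
  shows "(\<lambda>\<omega>. maximal_dater m (s \<omega>) (t \<omega>) k) \<in> borel_measurable N"
proof -
  have [measurable]: "(\<lambda>\<omega>. kw_workload m (s \<omega>) (t \<omega>) (- int k) k ! i) \<in> borel_measurable N" if "i < m" for i
    using assms that by (intro kw_workload_measurable) auto
  have [measurable]: "(\<lambda>\<omega>. kw_workload m (s \<omega>) (t \<omega>) (- int k) k ! 0) \<in> borel_measurable N"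
     "(\<lambda>\<omega>. kw_workload m (s \<omega>) (t \<omega>) (- int k) k ! (m - 1)) \<in> borel_measurable N"
    using assms(1) by (intro kw_workload_measurable assms; simp)+
  show ?thesis unfolding maximal_dater_def Let_def by measurable
qed

lemma sum_reverse_window:
  fixes f :: "nat \<Rightarrow> real"
  assumes "p \<le> i" "i \<le> k"
  shows "(\<Sum>l\<in>{k - i..<k - p}. f (k - l - 1)) = (\<Sum>j\<in>{p..<i}. f j)"
    and "(\<Sum>l\<in>{k - i..<k - p}. f (k - l)) = (\<Sum>j\<in>{p..<i}. f (Suc j))"
proof -
  show 1: "(\<Sum>l\<in>{k - i..<k - p}. f (k - l - 1)) = (\<Sum>j\<in>{p..<i}. f j)" for f :: "nat \<Rightarrow> real"
    using assms by (intro sum.reindex_bij_witness[of _ "\<lambda>j. k - j - 1" "\<lambda>l. k - l - 1"]) auto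
  have "(\<Sum>l\<in>{k - i..<k - p}. f (k - l)) = (\<Sum>l\<in>{k - i..<k - p}. f (Suc (k - l - 1)))"
    using assms by (intro sum.cong) (auto simp: Suc_diff_Suc)
  then show "(\<Sum>l\<in>{k - i..<k - p}. f (k - l)) = (\<Sum>j\<in>{p..<i}. f (Suc j))"
    using 1[of "\<lambda>j. f (Suc j)"] by simp
qed

context queue_law
begin

text \<open>
A point of the coordinate space lists the past in reversed order: coordinate \<open>j\<close> carries the
service time of customer \<open>-j\<close> and the interarrival time between the customers
\<open>-j - 1\<close> and \<open>-j\<close>. Customers after \<open>0\<close> do not matter.
\<close>
definition sseq :: "(nat \<Rightarrow> 'b) \<Rightarrow> int \<Rightarrow> real" where "sseq \<omega> i = sv (\<omega> (nat (- i)))"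
definition tseq :: "(nat \<Rightarrow> 'b) \<Rightarrow> int \<Rightarrow> real" where "tseq \<omega> i = tv (\<omega> (nat (- i - 1)))"

definition past_dater :: "nat \<Rightarrow> (nat \<Rightarrow> 'b) \<Rightarrow> real" where
  "past_dater k \<omega> = maximal_dater m (sseq \<omega>) (tseq \<omega>) k"

abbreviation vec :: "(nat \<Rightarrow> 'b) \<Rightarrow> nat \<Rightarrow> nat \<Rightarrow> real list" where
  "vec \<omega> k i \<equiv> kw_workload m (sseq \<omega>) (tseq \<omega>) (- int k) (k - i)"

lemma sseq_nonneg: "0 \<le> sseq \<omega> i" and tseq_nonneg: "0 \<le> tseq \<omega> i"
  by (auto simp: sseq_def tseq_def sv_nonneg tv_nonneg)

lemma seq_at: "j \<le> k \<Longrightarrow> sseq \<omega> (- int k + int j) = sv (\<omega> (k - j))"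
    "j < k \<Longrightarrow> tseq \<omega> (- int k + int j) = tv (\<omega> (k - j - 1))"
    "j \<le> k \<Longrightarrow> sseq \<omega> (int j - int k) = sv (\<omega> (k - j))"
    "j < k \<Longrightarrow> tseq \<omega> (int j - int k) = tv (\<omega> (k - j - 1))"
proof -
  assume "j \<le> k" then have "nat (- (- int k + int j)) = k - j" by linarith
  then show "sseq \<omega> (- int k + int j) = sv (\<omega> (k - j))" "sseq \<omega> (int j - int k) = sv (\<omega> (k - j))"
    by (simp_all add: sseq_def)
next
  assume "j < k" then have "nat (- (- int k + int j) - 1) = k - j - 1" by linarith
  then show "tseq \<omega> (- int k + int j) = tv (\<omega> (k - j - 1))" "tseq \<omega> (int j - int k) = tv (\<omega> (k - j - 1))"
    by (simp_all add: tseq_def)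
qed

lemma sum_tseq:
  assumes "p \<le> i" "i \<le> k"
  shows "(\<Sum>l\<in>{k - i..<k - p}. tseq \<omega> (- int k + int l)) = (\<Sum>j\<in>{p..<i}. tv (\<omega> j))"
proof -
  have "(\<Sum>l\<in>{k - i..<k - p}. tseq \<omega> (- int k + int l)) = (\<Sum>l\<in>{k - i..<k - p}. tv (\<omega> (k - l - 1)))"
    by (intro sum.cong refl seq_at(2)) auto
  then show ?thesis using sum_reverse_window(1)[OF assms, of "\<lambda>j. tv (\<omega> j)"] by simp
qed

lemma sum_sseq:
  fixes f :: "real \<Rightarrow> real"
  assumes "p \<le> i" "i \<le> k"
  shows "(\<Sum>l\<in>{k - i..<k - p}. f (sseq \<omega> (- int k + int l))) = (\<Sum>j\<in>{p..<i}. f (sv (\<omega> (Suc j))))"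
proof -
  have "(\<Sum>l\<in>{k - i..<k - p}. f (sseq \<omega> (- int k + int l))) = (\<Sum>l\<in>{k - i..<k - p}. f (sv (\<omega> (k - l))))"
    by (intro sum.cong refl arg_cong[where f = f] seq_at(1)) auto
  then show ?thesis using sum_reverse_window(2)[OF assms, of "\<lambda>j. f (sv (\<omega> j))"] by simp
qed

lemma measurable_past_dater [measurable]: "past_dater k \<in> borel_measurable S"
  unfolding past_dater_def[abs_def]
  by (intro maximal_dater_measurable servers) (simp_all add: sseq_def tseq_def)

lemma past_dater_mono: "j \<le> k \<Longrightarrow> past_dater j \<omega> \<le> past_dater k \<omega>"
  unfolding past_dater_def by (rule maximal_dater_mono[OF servers])

lemma past_dater_ge_job: "sv (\<omega> i) - (\<Sum>j<i. tv (\<omega> j)) \<le> past_dater i \<omega>"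
  using dater_ge_job[of m "sseq \<omega>" "tseq \<omega>", OF servers sseq_nonneg tseq_nonneg, where j = 0 and k = i and n = "- int i"]
    sum_tseq[of 0 i i \<omega>] seq_at(1)[of 0 i \<omega>]
  by (simp add: past_dater_def maximal_dater_eq_dater atLeast0LessThan)

lemma past_dater_ge_work:
  "sv (\<omega> i) + (\<Sum>j<i. sv (\<omega> j)) - real m * (\<Sum>j<i. tv (\<omega> j)) \<le> real m * past_dater i \<omega>"
proof -
  have "(\<Sum>l\<in>{0..i}. sseq \<omega> (- int i + int l)) = (\<Sum>j\<le>i. sv (\<omega> j))"
    by (intro sum.reindex_bij_witness[of _ "\<lambda>j. i - j" "\<lambda>l. i - l"]) (auto simp: seq_at)
  also have "\<dots> = sv (\<omega> i) + (\<Sum>j<i. sv (\<omega> j))" by (simp add: lessThan_Suc_atMost[symmetric])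
  finally show ?thesis
    using dater_ge_total_work[of m "sseq \<omega>" "tseq \<omega>", OF servers sseq_nonneg tseq_nonneg, where j = 0 and k = i and n = "- int i"] sum_tseq[of 0 i i \<omega>]
    by (simp add: past_dater_def maximal_dater_eq_dater atLeast0LessThan)
qed

lemma sum_level_increments:
  assumes "p \<le> i" "i \<le> k"
  shows "(\<Sum>l\<in>{k - i..<k - p}. rise m K (sseq \<omega> (- int k + int l)) - tseq \<omega> (- int k + int l))
    = (\<Sum>j\<in>{p..<i}. rise_sv K (\<omega> (Suc j)) - tv (\<omega> j))"
  using sum_sseq[OF assms, of "rise m K" \<omega>] sum_tseq[OF assms, of \<omega>] by (simp add: sum_subtractf)

lemma walk_alt: "walk K n \<omega> = rise_sv K (\<omega> 0) + (\<Sum>j<n. rise_sv K (\<omega> (Suc j)) - tv (\<omega> j))"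
  by (induction n) (simp_all add: walk_def)

lemma level_vec:
  assumes K: "0 \<le> K" and "p \<le> i" "i \<le> k"
  shows "level K (vec \<omega> k p) \<le> level K (vec \<omega> k i) + (\<Sum>j\<in>{p..<i}. rise_sv K (\<omega> (Suc j)) - tv (\<omega> j)) \<or>
    (\<exists>l. p \<le> l \<and> l < i \<and> level K (vec \<omega> k p) \<le> K + (\<Sum>j\<in>{p..<l}. rise_sv K (\<omega> (Suc j)) - tv (\<omega> j)))"
proof -
  have "k - i \<le> k - p" using assms by simp
  from level_kw_workload[of m "sseq \<omega>" "tseq \<omega>", OF servers sseq_nonneg tseq_nonneg K this, where n = "- int k"]
  show ?thesis
  proof (elim disjE bexE)
    assume "level K (vec \<omega> k p) \<le> level K (vec \<omega> k i)
       + (\<Sum>l\<in>{k - i..<k - p}. rise m K (sseq \<omega> (- int k + int l)) - tseq \<omega> (- int k + int l))"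
    then show ?thesis unfolding sum_level_increments[OF assms(2,3)] by (rule disjI1)
  next
    fix l assume l: "l \<in> {k - i<..k - p}" "level K (vec \<omega> k p) \<le> K
       + (\<Sum>l\<in>{l..<k - p}. rise m K (sseq \<omega> (- int k + int l)) - tseq \<omega> (- int k + int l))"
    have kl: "k - (k - l) = l" "p \<le> k - l" "k - l < i" using l(1) assms by auto
    have "(\<Sum>l\<in>{l..<k - p}. rise m K (sseq \<omega> (- int k + int l)) - tseq \<omega> (- int k + int l))
      = (\<Sum>j\<in>{p..<k - l}. rise_sv K (\<omega> (Suc j)) - tv (\<omega> j))"
      using sum_level_increments[of p "k - l" k K \<omega>] kl by simp
    then show ?thesis using l(2) kl by (intro disjI2 exI[of _ "k - l"]) auto
  qed
qed

lemma level_vec_start: "0 \<le> K \<Longrightarrow> level K (vec \<omega> k k) \<le> K"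
  using servers divide_left_mono[of 1 "real m" K] by (simp add: level_def sum_list_replicate)

text \<open>
The interval from customer \<open>-p\<close> to customer \<open>0\<close> contributes \<open>walk K p\<close> to the
level found by customer \<open>-p\<close>, unless the level was low in between.
\<close>
lemma past_dater_le_level:
  assumes K: "0 \<le> K" and p: "p \<le> k"
  shows "past_dater k \<omega> \<le> level K (vec \<omega> k p) + walk K p \<omega> \<or> (\<exists>n<p. past_dater k \<omega> \<le> K + walk K n \<omega>)"
proof -
  have 0: "past_dater k \<omega> \<le> level K (vec \<omega> k 0) + rise_sv K (\<omega> 0)"
    using dater_le_level[of m "sseq \<omega>" "tseq \<omega>", OF servers sseq_nonneg tseq_nonneg, where n = "- int k" and k = k and K = K] seq_at(1)[of k k \<omega>]
    by (simp add: past_dater_def maximal_dater_eq_dater)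
  from level_vec[OF K le0 p, of \<omega>] show ?thesis
  proof (elim disjE exE conjE)
    fix l assume "l < p" "level K (vec \<omega> k 0) \<le> K + (\<Sum>j\<in>{0..<l}. rise_sv K (\<omega> (Suc j)) - tv (\<omega> j))"
    then show ?thesis using 0 by (intro disjI2 exI[of _ l]) (simp add: walk_alt atLeast0LessThan)
  qed (use 0 in \<open>auto simp: walk_alt atLeast0LessThan\<close>)
qed

lemma past_dater_le_walk:
  assumes K: "0 \<le> K" shows "\<exists>n. past_dater k \<omega> \<le> K + walk K n \<omega>"
  using past_dater_le_level[OF K order_refl, of k \<omega>]
proof (elim disjE exE conjE)
  assume "past_dater k \<omega> \<le> level K (vec \<omega> k k) + walk K k \<omega>"
  then show ?thesis using level_vec_start[OF K, of \<omega> k] by (intro exI[of _ k]) linarith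
qed blast

text \<open>
The workloads found by customer \<open>-i\<close> depend on the customers before it only.
\<close>
lemma vec_last_le:
  assumes K: "0 \<le> K" and i: "i \<le> k" and C: "0 \<le> C" "\<And>n. walk K n (\<lambda>j. \<omega> (j + Suc i)) \<le> C"
  shows "vec \<omega> k i ! (m - 1) \<le> K + C"
proof -
  have sum: "(\<Sum>j\<in>{i..<l}. rise_sv K (\<omega> (Suc j)) - tv (\<omega> j)) \<le> C" if "i \<le> l" for l
  proof (cases "l = i")
    case False
    define n where "n = l - Suc i"
    have n: "l = Suc n + i" using that False by (simp add: n_def)
    have "(\<Sum>j\<in>{i..<l}. rise_sv K (\<omega> (Suc j)) - tv (\<omega> j))
        = (\<Sum>j<Suc n. rise_sv K (\<omega> (Suc (j + i))) - tv (\<omega> (j + i)))"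
      unfolding n using sum.shift_bounds_nat_ivl[of "\<lambda>j. rise_sv K (\<omega> (Suc j)) - tv (\<omega> j)" 0 i "Suc n"]
      by (simp add: atLeast0LessThan)
    also have "\<dots> = walk K n (\<lambda>j. \<omega> (j + Suc i)) - tv (\<omega> i)"
      by (simp add: walk_alt sum.lessThan_Suc_shift del: sum.lessThan_Suc)
    finally show ?thesis using C(2)[of n] tv_nonneg[of "\<omega> i"] by linarith
  qed (use C in simp)
  have "level K (vec \<omega> k i) \<le> K + C"
    using level_vec[OF K i order_refl, of \<omega>]
  proof (elim disjE exE conjE)
    assume "level K (vec \<omega> k i) \<le> level K (vec \<omega> k k) + (\<Sum>j\<in>{i..<k}. rise_sv K (\<omega> (Suc j)) - tv (\<omega> j))"
    then show ?thesis using level_vec_start[OF K, of \<omega> k] sum[OF i] by linarith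
  next
    fix l assume "i \<le> l" "level K (vec \<omega> k i) \<le> K + (\<Sum>j\<in>{i..<l}. rise_sv K (\<omega> (Suc j)) - tv (\<omega> j))"
    then show ?thesis using sum[of l] by linarith
  qed
  then show ?thesis
    using first_le_level(2)[OF workload_vector_kw_workload servers, of "sseq \<omega>" "tseq \<omega>" "- int k" "k - i" K] by linarith
qed


text \<open>
At customer \<open>-q\<close>, either the server of the big job is the last to finish, or all workloads
are nearly equal and hence bounded by the average, up to multiples of the bound \<open>B\<close> on the other
jobs.
\<close>
lemma vec_after_big_job:
  assumes qi: "q < i" "i \<le> k" and C: "vec \<omega> k i ! (m - 1) \<le> C" "C \<le> B"
    and B: "\<And>j. q < j \<Longrightarrow> j < i \<Longrightarrow> sv (\<omega> j) \<le> B"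
  shows "\<exists>p\<in>{q..i}. vec \<omega> k q ! (m - 1) \<le>
    max (sv (\<omega> i) + C - (\<Sum>j\<in>{q..<i}. tv (\<omega> j)))
      (2 * B + (max 0 (sv (\<omega> i) + C - (\<Sum>j\<in>{p..<i}. tv (\<omega> j)))
         + (\<Sum>j\<in>{q<..p} - {i}. sv (\<omega> j)) - real m * (\<Sum>j\<in>{q..<p}. tv (\<omega> j))) / real m)"
proof -
  let ?s = "sseq \<omega>" and ?t = "tseq \<omega>" and ?n = "- int k"
  have lt: "k - i < k - q" using qi by simp
  have si: "?s (?n + int (k - i)) = sv (\<omega> i)" using seq_at(1)[of "k - i" k \<omega>] qi by simp
  have B': "?s (?n + int l) \<le> B" if "k - i < l" "l < k - q" for l
    using seq_at(1)[of l k \<omega>] B[of "k - l"] that qi by simp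
  have t_sum: "(\<Sum>l\<in>{k - i..<k - p}. ?t (?n + int l)) = (\<Sum>j\<in>{p..<i}. tv (\<omega> j))" if "p \<le> i" for p
    by (rule sum_tseq[OF that qi(2)])
  note big = workload_after_big_job[of m ?s ?t, OF servers sseq_nonneg tseq_nonneg C B' lt]
  let ?w = "vec \<omega> k q"
  have w: "workload_vector m ?w" by (rule workload_vector_kw_workload)
  have exc: "one_exceptional B (sv (\<omega> i) + C - (\<Sum>j\<in>{q..<i}. tv (\<omega> j))) ?w"
    using big(1) si t_sum[of q] qi by simp
  obtain l where l: "l \<in> {k - i..k - q}" "sum_list ?w \<le> real m * B
      + max 0 (?s (?n + int (k - i)) + C - (\<Sum>l\<in>{k - i..<l}. ?t (?n + int l)))
      + (\<Sum>l'\<in>{l..<k - q}. (if l' = k - i then 0 else ?s (?n + int l')) - real m * ?t (?n + int l'))"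
    using big(2) by blast
  define p where "p = k - l"
  have p: "p \<in> {q..i}" "l = k - p" "p \<le> k" using l(1) qi by (auto simp: p_def)
  have t2: "(\<Sum>l'\<in>{l..<k - q}. ?t (?n + int l')) = (\<Sum>j\<in>{q..<p}. tv (\<omega> j))"
    unfolding p(2) using p by (intro sum_tseq) auto
  have s2: "(\<Sum>l'\<in>{l..<k - q}. (if l' = k - i then 0 else ?s (?n + int l'))) = (\<Sum>j\<in>{q<..p} - {i}. sv (\<omega> j))"
  proof -
    have "(\<Sum>j\<in>{q<..p} - {i}. sv (\<omega> j)) = (\<Sum>j\<in>{q<..p}. if j = i then 0 else sv (\<omega> j))"
      by (intro sum.mono_neutral_cong_left) auto
    also have "\<dots> = (\<Sum>l'\<in>{l..<k - q}. (if l' = k - i then 0 else ?s (?n + int l')))"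
    proof (rule sum.reindex_bij_witness[of _ "\<lambda>l. k - l" "\<lambda>j. k - j"])
      fix j assume j: "j \<in> {q<..p}"
      then have "?s (?n + int (k - j)) = sv (\<omega> j)" using seq_at(1)[of "k - j" k \<omega>] p by simp
      moreover have "k - j = k - i \<longleftrightarrow> j = i" using j p qi by auto
      ultimately show "(if k - j = k - i then 0 else ?s (?n + int (k - j))) = (if j = i then 0 else sv (\<omega> j))"
        by simp
    qed (use p qi in auto)
    finally show ?thesis by simp
  qed
  have sum: "sum_list ?w \<le> real m * B + (max 0 (sv (\<omega> i) + C - (\<Sum>j\<in>{p..<i}. tv (\<omega> j)))
         + (\<Sum>j\<in>{q<..p} - {i}. sv (\<omega> j)) - real m * (\<Sum>j\<in>{q..<p}. tv (\<omega> j)))" (is "_ \<le> _ + ?X")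
    using l(2) t_sum[of p] p unfolding si p(2)[symmetric] sum_subtractf s2 sum_distrib_left[symmetric] t2 by simp
  have "?w ! (m - 1) \<le> max (sv (\<omega> i) + C - (\<Sum>j\<in>{q..<i}. tv (\<omega> j))) (?w ! 0 + B)"
    by (rule one_exceptionalD(1)[OF w servers exc])
  moreover have "?w ! 0 \<le> B + ?X / real m"
  proof -
    have "?w ! 0 + 0 / real m \<le> (sum_list ?w + 0) / real m"
    proof -
      have "(\<Sum>i<m. ?w ! 0) \<le> sum_list ?w"
        unfolding workload_vector_sum[OF w] using workload_vector_nth(1)[OF w] by (intro sum_mono) auto
      then show ?thesis using servers by (simp add: field_simps)
    qed
    also have "\<dots> \<le> (real m * B + ?X) / real m" using sum servers by (intro divide_right_mono) auto
    also have "\<dots> = B + ?X / real m" using servers by (simp add: add_divide_distrib)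
    finally show ?thesis by simp
  qed
  then have "max (sv (\<omega> i) + C - (\<Sum>j\<in>{q..<i}. tv (\<omega> j))) (?w ! 0 + B)
      \<le> max (sv (\<omega> i) + C - (\<Sum>j\<in>{q..<i}. tv (\<omega> j))) (2 * B + ?X / real m)"
    by (intro max.mono order_refl) linarith
  ultimately show ?thesis using p(1) by (intro bexI[of _ p]) (rule order_trans)
qed

lemma level_vec_le_last: "0 \<le> K \<Longrightarrow> level K (vec \<omega> k q) \<le> vec \<omega> k q ! (m - 1) + K"
proof -
  assume K: "0 \<le> K"
  have w: "workload_vector m (vec \<omega> k q)" by (rule workload_vector_kw_workload)
  have "sum_list (vec \<omega> k q) \<le> (\<Sum>i<m. vec \<omega> k q ! (m - 1))"
    unfolding workload_vector_sum[OF w] using workload_vector_nth(2)[OF w] by (intro sum_mono) auto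
  then have "(sum_list (vec \<omega> k q) + K) / real m \<le> (real m * vec \<omega> k q ! (m - 1) + K) / real m"
    by (intro divide_right_mono) auto
  also have "\<dots> = vec \<omega> k q ! (m - 1) + K / real m" using servers by (simp add: add_divide_distrib)
  also have "\<dots> \<le> vec \<omega> k q ! (m - 1) + K" using K servers divide_left_mono[of 1 "real m" K] by simp
  finally show ?thesis using K by (simp add: level_def)
qed

text \<open>
The four conditions concern the coordinates below \<open>i\<close> or above \<open>i\<close>, never coordinate
\<open>i\<close> itself. The first two are laws of large numbers between the big job and customer
\<open>0\<close>, the third one is for the final stretch before customer \<open>0\<close>, and the last one
bounds the workloads found by the big job.
\<close>
definition typical :: "real \<Rightarrow> real \<Rightarrow> real \<Rightarrow> real \<Rightarrow> nat \<Rightarrow> (nat \<Rightarrow> 'b) set" where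
  "typical K c \<eta> C i = {\<omega>.
     (\<forall>n\<le>i. \<bar>(\<Sum>j<n. tv (\<omega> j)) - real n * a\<bar> \<le> \<eta> * real n + C) \<and>
     (\<forall>n\<le>i. \<bar>(\<Sum>j<n. sv (\<omega> j)) - real n * b\<bar> \<le> \<eta> * real n + C) \<and>
     (\<forall>n<i. walk K n \<omega> \<le> C - real n * c) \<and>
     (\<forall>n. walk K n (\<lambda>j. \<omega> (j + Suc i)) \<le> C)}"

lemma typical_window:
  assumes ty: "\<omega> \<in> typical K c \<eta> C i" and \<eta>: "0 \<le> \<eta>" and pq: "p \<le> r" "r \<le> i"
  shows "\<bar>(\<Sum>j\<in>{p..<r}. tv (\<omega> j)) - (real r - real p) * a\<bar> \<le> 2 * (\<eta> * real i + C)"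
    and "\<bar>(\<Sum>j\<in>{p..<r}. sv (\<omega> j)) - (real r - real p) * b\<bar> \<le> 2 * (\<eta> * real i + C)"
proof -
  have le: "\<eta> * real n + C \<le> \<eta> * real i + C" if "n \<le> i" for n
    using that \<eta> by (intro add_right_mono mult_left_mono) auto
  have win: "(\<Sum>j\<in>{p..<r}. f j) = (\<Sum>j<r. f j) - (\<Sum>j<p. f j)" for f :: "nat \<Rightarrow> real"
    using sum.atLeastLessThan_concat[of 0 p r f] pq by (simp add: atLeast0LessThan)
  have 1: "\<bar>(\<Sum>j<n. tv (\<omega> j)) - real n * a\<bar> \<le> \<eta> * real i + C"
    "\<bar>(\<Sum>j<n. sv (\<omega> j)) - real n * b\<bar> \<le> \<eta> * real i + C" if "n \<le> i" for n
    using ty le[OF that] that unfolding typical_def by (blast intro: order_trans)+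
  have alg: "(real r - real p) * x = real r * x - real p * x" for x by (simp add: algebra_simps)
  have pr: "p \<le> i" "r \<le> i" using pq by auto
  have diff: "\<bar>A - B - (u - v)\<bar> \<le> 2 * E" if "\<bar>B - v\<bar> \<le> E" "\<bar>A - u\<bar> \<le> E" for A B u v E :: real
    using that by linarith
  show "\<bar>(\<Sum>j\<in>{p..<r}. tv (\<omega> j)) - (real r - real p) * a\<bar> \<le> 2 * (\<eta> * real i + C)"
    unfolding win alg by (rule diff[OF 1(1)[OF pr(1)] 1(1)[OF pr(2)]])
  show "\<bar>(\<Sum>j\<in>{p..<r}. sv (\<omega> j)) - (real r - real p) * b\<bar> \<le> 2 * (\<eta> * real i + C)"
    unfolding win alg by (rule diff[OF 1(2)[OF pr(1)] 1(2)[OF pr(2)]])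
qed

end

section \<open>A single big job\<close>

context queue_law
begin

text \<open>
The fluid bound is applied up to customer \<open>-q\<close> with \<open>q\<close> about \<open>e i\<close>, and the
random walk bound from there to customer \<open>0\<close>. The errors of the laws of large numbers are
proportional to \<open>i\<close>, and they may be much larger than \<open>x\<close>. The drift of the walk over
the last \<open>q\<close> customers compensates them, as their rate \<open>c e / 10\<close> is small enough. The
slack \<open>e\<close> in the slopes of the thresholds pays for the fact that the fluid bound stops early.
\<close>
lemma no_overflow_given_typical:
  assumes K: "0 \<le> K" and c: "0 < c" and e: "0 < e" "e < 1" and C: "0 \<le> C"
  defines "\<kappa> \<equiv> 2 * b + 5 * K + 14 * C + c"
  assumes x: "\<kappa> \<le> x" and ty: "\<omega> \<in> typical K c (c * e / 10) C i"
    and s: "sv (\<omega> i) \<le> min (x + real i * ((1 - e) * a)) (real m * x + real i * ((1 - e) * (real m * a - b))) - real m * \<kappa>"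
  shows "past_dater k \<omega> \<le> x"
proof -
  define d where "d = real m * a - b"
  define k' where "k' = max i k"
  define E where "E = c * e / 10 * real i + C"
  have d: "0 < d" using stable by (simp add: d_def)
  have m1: "1 \<le> real m" using servers by simp
  have \<kappa>: "0 \<le> \<kappa>" using mean_nonneg K c C by (simp add: \<kappa>_def)
  have x0: "0 \<le> x" using \<kappa> x by simp
  have \<eta>: "0 \<le> c * e / 10" using c e by simp
  have E0: "0 \<le> E" using \<eta> C by (simp add: E_def)
  have last_i: "vec \<omega> k' i ! (m - 1) \<le> K + C"
    by (rule vec_last_le[OF K _ C]) (use ty in \<open>auto simp: k'_def typical_def\<close>)
  have "past_dater k' \<omega> \<le> x"
  proof (cases "i = 0")
    case True
    have w: "workload_vector m (vec \<omega> k' 0)" by (rule workload_vector_kw_workload)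
    have "past_dater k' \<omega> \<le> vec \<omega> k' 0 ! (m - 1) + sv (\<omega> 0)"
      using workload_vector_nth(1)[OF w, of "m - 1"] servers seq_at(1)[of k' k' \<omega>] sv_nonneg[of "\<omega> 0"]
      by (simp add: past_dater_def maximal_dater_eq_dater dater_def)
    also have "\<dots> \<le> K + C + (x - real m * \<kappa>)" using last_i s True by auto
    also have "\<dots> \<le> x"
    proof -
      have "1 * \<kappa> \<le> real m * \<kappa>" using m1 \<kappa> by (intro mult_right_mono) auto
      moreover have "K + C \<le> \<kappa>" unfolding \<kappa>_def using mean_nonneg K c C by linarith
      ultimately show ?thesis by linarith
    qed
    finally show ?thesis .
  next
    case False
    \<comment> \<open>The splitting point; \<open>q < i\<close> since \<open>e < 1\<close>.\<close>
    define q where "q = nat \<lfloor>e * real i\<rfloor>"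
    have qle: "real q \<le> e * real i" and qge: "e * real i - 1 \<le> real q"
      using e by (auto simp: q_def intro: of_nat_floor)
    have "e * real i < 1 * real i" using e False by (intro mult_strict_right_mono) auto
    then have qi: "q < i" using qle by linarith
    define J where "J = real i - real q"
    have J: "(1 - e) * real i \<le> J" using qle by (simp add: J_def algebra_simps)
    define B where "B = b + 2 * E + K + C"
    have job: "sv (\<omega> j) \<le> B" if "j < i" for j
      using typical_window(2)[OF ty \<eta>, of j "Suc j"] that K C by (simp add: B_def E_def)
    have CB: "K + C \<le> B" using mean_nonneg E0 by (simp add: B_def)
    obtain p where p: "p \<in> {q..i}" and big: "vec \<omega> k' q ! (m - 1) \<le>
      max (sv (\<omega> i) + (K + C) - (\<Sum>j\<in>{q..<i}. tv (\<omega> j)))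
        (2 * B + (max 0 (sv (\<omega> i) + (K + C) - (\<Sum>j\<in>{p..<i}. tv (\<omega> j)))
         + (\<Sum>j\<in>{q<..p} - {i}. sv (\<omega> j)) - real m * (\<Sum>j\<in>{q..<p}. tv (\<omega> j))) / real m)"
      using vec_after_big_job[OF qi _ last_i CB job] qi by (auto simp: k'_def)
    define y where "y = max 0 (x - \<kappa>)"
    have y: "0 \<le> y" "x - real m * \<kappa> \<le> y" "real m * x - real m * \<kappa> \<le> real m * y"
    proof -
      show "0 \<le> y" by (simp add: y_def)
      have "1 * \<kappa> \<le> real m * \<kappa>" using m1 \<kappa> by (intro mult_right_mono) auto
      then show "x - real m * \<kappa> \<le> y" by (simp add: y_def)
      have "real m * (x - \<kappa>) \<le> real m * y" by (intro mult_left_mono) (auto simp: y_def)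
      then show "real m * x - real m * \<kappa> \<le> real m * y" by (simp add: algebra_simps)
    qed
    have Ja: "(1 - e) * real i * r \<le> J * r" if "0 \<le> r" for r
      using J that by (rule mult_right_mono)
    have sa: "sv (\<omega> i) - J * a \<le> y"
    proof -
      have "real i * ((1 - e) * a) = (1 - e) * real i * a" by simp
      then show ?thesis using s Ja[of a] mean_nonneg y(2) by linarith
    qed
    have sd: "sv (\<omega> i) - J * d \<le> real m * y"
    proof -
      have "real i * ((1 - e) * (real m * a - b)) = (1 - e) * real i * d" by (simp add: d_def)
      then show ?thesis using s Ja[of d] d y(3) by linarith
    qed
    have ym: "y \<le> real m * y" using m1 y(1) mult_right_mono[of 1 "real m" y] by simp
    have my: "0 \<le> real m * y" using ym y(1) by linarith
    have t_q: "(\<Sum>j\<in>{q..<i}. tv (\<omega> j)) \<ge> J * a - 2 * E"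
      using typical_window(1)[OF ty \<eta>, of q i] qi by (simp add: E_def J_def)
    have t_p: "(\<Sum>j\<in>{p..<i}. tv (\<omega> j)) \<ge> (real i - real p) * a - 2 * E"
      using typical_window(1)[OF ty \<eta>, of p i] p by (simp add: E_def)
    have t_qp: "(\<Sum>j\<in>{q..<p}. tv (\<omega> j)) \<ge> (real p - real q) * a - 2 * E"
      using typical_window(1)[OF ty \<eta>, of q p] p by (simp add: E_def)
    have s_qp: "(\<Sum>j\<in>{q<..p} - {i}. sv (\<omega> j)) \<le> (real p - real q) * b + 2 * E"
    proof (cases "p = i")
      case True
      have "{q<..p} - {i} = {Suc q..<i}" using True by auto
      moreover have "(\<Sum>j\<in>{Suc q..<i}. sv (\<omega> j)) \<le> (real i - real (Suc q)) * b + 2 * E"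
        using typical_window(2)[OF ty \<eta>, of "Suc q" i] qi by (simp add: E_def)
      ultimately show ?thesis using True mean_nonneg by (simp add: algebra_simps)
    next
      case False
      then have "{q<..p} - {i} = {Suc q..<Suc p}" using p by auto
      moreover have "(\<Sum>j\<in>{Suc q..<Suc p}. sv (\<omega> j)) \<le> (real (Suc p) - real (Suc q)) * b + 2 * E"
        using typical_window(2)[OF ty \<eta>, of "Suc q" "Suc p"] p False by (simp add: E_def)
      ultimately show ?thesis by simp
    qed
    \<comment> \<open>Along the way from the big job to customer \<open>-q\<close> the relevant rate is \<open>a\<close> before
    \<open>p\<close> and \<open>d\<close> after it; the smaller of both gives the bound.\<close>
    have mix: "max 0 (sv (\<omega> i) - (real i - real p) * a) - (real p - real q) * d \<le> real m * y"
    proof (cases "a \<le> d")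
      case True
      have "(real p - real q) * a \<le> (real p - real q) * d" using True p by (intro mult_left_mono) auto
      moreover have "0 \<le> (real p - real q) * d" using d p by (intro mult_nonneg_nonneg) auto
      moreover have "sv (\<omega> i) - (real i - real p) * a - (real p - real q) * a \<le> real m * y"
        using sa ym by (simp add: J_def algebra_simps)
      ultimately show ?thesis using my by (auto simp: max_def)
    next
      case False
      then have "(real i - real p) * d \<le> (real i - real p) * a" using p by (intro mult_left_mono) auto
      moreover have "0 \<le> (real p - real q) * d" using d p by (intro mult_nonneg_nonneg) auto
      moreover have "sv (\<omega> i) - (real i - real p) * d - (real p - real q) * d \<le> real m * y"
        using sd by (simp add: J_def algebra_simps)
      ultimately show ?thesis using my by (auto simp: max_def)
    qed
    have "vec \<omega> k' q ! (m - 1) \<le> 2 * b + 3 * K + 3 * C + 10 * E + y"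
    proof (rule order_trans[OF big max.boundedI])
      show "sv (\<omega> i) + (K + C) - (\<Sum>j\<in>{q..<i}. tv (\<omega> j)) \<le> 2 * b + 3 * K + 3 * C + 10 * E + y"
        using t_q sa mean_nonneg K C E0 by linarith
      let ?X = "max 0 (sv (\<omega> i) + (K + C) - (\<Sum>j\<in>{p..<i}. tv (\<omega> j)))
         + (\<Sum>j\<in>{q<..p} - {i}. sv (\<omega> j)) - real m * (\<Sum>j\<in>{q..<p}. tv (\<omega> j))"
      have 1: "max 0 (sv (\<omega> i) + (K + C) - (\<Sum>j\<in>{p..<i}. tv (\<omega> j)))
          \<le> max 0 (sv (\<omega> i) - (real i - real p) * a) + (K + C) + 2 * E"
        using t_p K C E0 by (auto simp: max_def)
      have 2: "real m * ((real p - real q) * a - 2 * E) \<le> real m * (\<Sum>j\<in>{q..<p}. tv (\<omega> j))"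
        using t_qp by (intro mult_left_mono) auto
      have "real m * ((real p - real q) * a - 2 * E) = (real p - real q) * d + (real p - real q) * b - 2 * (real m * E)"
        by (simp add: d_def algebra_simps)
      then have "?X \<le> real m * y + (K + C) + 4 * E + 2 * (real m * E)"
        using 1 2 s_qp mix by linarith
      also have "\<dots> \<le> real m * y + real m * (K + C) + 4 * (real m * E) + 2 * (real m * E)"
      proof -
        have "K + C \<le> real m * (K + C)" "E \<le> real m * E"
          using m1 K C E0 mult_right_mono[of 1 "real m" "K + C"] mult_right_mono[of 1 "real m" E] by simp_all
        then show ?thesis by linarith
      qed
      also have "\<dots> = (y + (K + C) + 6 * E) * real m" by (simp add: algebra_simps)
      finally have "?X / real m \<le> y + (K + C) + 6 * E" using m1 by (simp add: divide_le_eq)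
      then show "2 * B + ?X / real m \<le> 2 * b + 3 * K + 3 * C + 10 * E + y" by (simp add: B_def)
    qed
    then have lev: "level K (vec \<omega> k' q) \<le> 2 * b + 3 * K + 3 * C + 10 * E + y + K"
      using level_vec_le_last[OF K, of \<omega> k' q] by linarith
    have wq: "walk K n \<omega> \<le> C - real n * c" if "n \<le> q" for n
      using ty that qi by (auto simp: typical_def)
    have "q \<le> k'" using qi by (simp add: k'_def)
    from past_dater_le_level[OF K this, of \<omega>] show ?thesis
    proof (elim disjE exE conjE)
      assume *: "past_dater k' \<omega> \<le> level K (vec \<omega> k' q) + walk K q \<omega>"
      \<comment> \<open>Here \<open>10 * E\<close> grows like \<open>c e i\<close>, which the drift \<open>c q\<close> cancels.\<close>
      have "c * (e * real i - 1) \<le> c * real q" using c qge by (intro mult_left_mono) auto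
      then have "10 * E - real q * c \<le> 10 * C + c" by (simp add: E_def algebra_simps)
      then have "past_dater k' \<omega> \<le> \<kappa> + y"
        using * lev wq[of q] K C unfolding \<kappa>_def by linarith
      then show ?thesis using x by (simp add: y_def)
    next
      fix n assume n: "n < q" "past_dater k' \<omega> \<le> K + walk K n \<omega>"
      have "0 \<le> real n * c" using c by simp
      then have "walk K n \<omega> \<le> C" using wq[of n] n(1) by simp
      then show ?thesis using n(2) x mean_nonneg K c C unfolding \<kappa>_def by linarith
    qed
  qed
  moreover have "past_dater k \<omega> \<le> past_dater k' \<omega>" by (rule past_dater_mono) (simp add: k'_def)
  ultimately show ?thesis by simp
qed


lemma sets_typical [measurable]: "typical K c \<eta> C i \<in> sets S"
proof -
  have [measurable]: "(\<lambda>\<omega>. walk K n (\<lambda>j. \<omega> (j + Suc i))) \<in> borel_measurable S" for n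
    by (rule measurable_compose[OF measurable_shift measurable_walk])
  have "{\<omega> \<in> space S. (\<forall>n\<in>{..i}. \<bar>(\<Sum>j<n. tv (\<omega> j)) - real n * a\<bar> \<le> \<eta> * real n + C) \<and>
     (\<forall>n\<in>{..i}. \<bar>(\<Sum>j<n. sv (\<omega> j)) - real n * b\<bar> \<le> \<eta> * real n + C) \<and>
     (\<forall>n\<in>{..<i}. walk K n \<omega> \<le> C - real n * c) \<and>
     (\<forall>n. walk K n (\<lambda>j. \<omega> (j + Suc i)) \<le> C)} \<in> sets S"
    by measurable
  then show ?thesis by (simp add: typical_def Ball_def)
qed

lemma typical_coordinate: "fun_upd \<omega> i v \<in> typical K c \<eta> C i \<longleftrightarrow> \<omega> \<in> typical K c \<eta> C i"
proof -
  have 1: "(\<Sum>j<n. f (fun_upd \<omega> i v j)) = (\<Sum>j<n. f (\<omega> j))" if "n \<le> i" for n and f :: "'b \<Rightarrow> real"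
    using that by (intro sum.cong) auto
  have 2: "walk K n (fun_upd \<omega> i v) = walk K n \<omega>" if "n < i" for n
    using that by (intro walk_cong) auto
  have 3: "(\<lambda>j. fun_upd \<omega> i v (j + Suc i)) = (\<lambda>j. \<omega> (j + Suc i))" by auto
  show ?thesis unfolding typical_def mem_Collect_eq 3 by (simp add: 1 2 del: fun_upd_apply)
qed

lemma sets_deviation:
  assumes [measurable]: "h \<in> borel_measurable D"
  shows "{\<omega>. \<exists>n. (\<Sum>j<n. h (\<omega> j)) > real n * r + C} \<in> sets S"
    by (rule sets_Collect_S) measurable

lemma typical_prob:
  assumes K: "0 \<le> K" and c: "0 < c" "c < a - integral\<^sup>L D (rise_sv K)" and \<eta>: "\<eta> > 0" and \<delta>: "\<delta> > 0"
  shows "\<exists>C\<ge>0. \<forall>i. measure S (- typical K c \<eta> C i) \<le> \<delta>"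
proof -
  define dev where "dev h C = {\<omega> :: nat \<Rightarrow> 'b. \<exists>n. (\<Sum>j<n. h (\<omega> j)) > real n * (integral\<^sup>L D h + \<eta>) + C}"
    for h :: "'b \<Rightarrow> real" and C
  define ex where "ex C = {\<omega>. \<exists>n. walk K n \<omega> > C - real n * c}" for C
  have tight: "\<exists>C0\<ge>0. \<forall>C\<ge>C0. measure S (dev h C) \<le> \<delta> / 6" if "integrable D h" for h
    using partial_sums_tight[OF that \<eta>, of "\<delta> / 6"] \<delta> by (simp add: dev_def)
  have dev_sets: "dev h C \<in> sets S" if "integrable D h" for h C
    unfolding dev_def using that by (intro sets_deviation) auto
  have ex_sets: "ex C \<in> sets S" for C
    unfolding ex_def by (rule sets_Collect_S) measurable
  have ints: "integrable D tv" "integrable D (\<lambda>v. - tv v)" "integrable D sv" "integrable D (\<lambda>v. - sv v)"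
    using tv_integrable sv_integrable by auto
  obtain C1 where C1: "C1 \<ge> 0" "\<And>C. C \<ge> C1 \<Longrightarrow> measure S (dev tv C) \<le> \<delta> / 6" using tight[OF ints(1)] by blast
  obtain C2 where C2: "C2 \<ge> 0" "\<And>C. C \<ge> C2 \<Longrightarrow> measure S (dev (\<lambda>v. - tv v) C) \<le> \<delta> / 6" using tight[OF ints(2)] by blast
  obtain C3 where C3: "C3 \<ge> 0" "\<And>C. C \<ge> C3 \<Longrightarrow> measure S (dev sv C) \<le> \<delta> / 6" using tight[OF ints(3)] by blast
  obtain C4 where C4: "C4 \<ge> 0" "\<And>C. C \<ge> C4 \<Longrightarrow> measure S (dev (\<lambda>v. - sv v) C) \<le> \<delta> / 6" using tight[OF ints(4)] by blast
  obtain C5 where C5: "C5 \<ge> 0" "\<And>C. C \<ge> C5 \<Longrightarrow> measure S (ex C) \<le> \<delta> / 6"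
    using walk_tight[OF K c(2), of "\<delta> / 6"] \<delta> by (auto simp: ex_def)
  define C where "C = C1 + C2 + C3 + C4 + C5"
  have "measure S (- typical K c \<eta> C i) \<le> \<delta>" for i
  proof -
    let ?sh = "{\<omega>. (\<lambda>j. \<omega> (j + Suc i)) \<in> ex C}"
    have sh: "?sh \<in> sets S"
    proof -
      have "(\<lambda>\<omega> j. \<omega> (j + Suc i)) -` ex C \<inter> space S \<in> sets S"
        by (rule measurable_sets[OF measurable_shift ex_sets])
      then show ?thesis by (simp add: vimage_def)
    qed
    have "- typical K c \<eta> C i \<subseteq> ((dev tv C \<union> dev (\<lambda>v. - tv v) C) \<union> (dev sv C \<union> dev (\<lambda>v. - sv v) C)) \<union> (ex C \<union> ?sh)"
    proof
      fix \<omega> assume nt: "\<omega> \<in> - typical K c \<eta> C i"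
      show "\<omega> \<in> ((dev tv C \<union> dev (\<lambda>v. - tv v) C) \<union> (dev sv C \<union> dev (\<lambda>v. - sv v) C)) \<union> (ex C \<union> ?sh)"
      proof (rule ccontr)
        assume "\<not> ?thesis"
        then have 1: "(\<Sum>j<n. tv (\<omega> j)) \<le> real n * (a + \<eta>) + C" "(\<Sum>j<n. - tv (\<omega> j)) \<le> real n * (- a + \<eta>) + C"
          "(\<Sum>j<n. sv (\<omega> j)) \<le> real n * (b + \<eta>) + C" "(\<Sum>j<n. - sv (\<omega> j)) \<le> real n * (- b + \<eta>) + C"
          "walk K n \<omega> \<le> C - real n * c" "walk K n (\<lambda>j. \<omega> (j + Suc i)) \<le> C - real n * c" for n
          by (auto simp: dev_def ex_def mean_tv mean_sv not_less)
        have "walk K n (\<lambda>j. \<omega> (j + Suc i)) \<le> C" for n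
        proof -
          have "0 \<le> real n * c" using c by simp
          then show ?thesis using 1(6)[of n] by linarith
        qed
        moreover have "\<bar>(\<Sum>j<n. tv (\<omega> j)) - real n * a\<bar> \<le> \<eta> * real n + C" for n
          using 1(1,2)[of n] by (simp add: sum_negf abs_le_iff algebra_simps)
        moreover have "\<bar>(\<Sum>j<n. sv (\<omega> j)) - real n * b\<bar> \<le> \<eta> * real n + C" for n
          using 1(3,4)[of n] by (simp add: sum_negf abs_le_iff algebra_simps)
        ultimately have "\<omega> \<in> typical K c \<eta> C i" using 1(5) by (simp add: typical_def)
        then show False using nt by simp
      qed
    qed
    then have "measure S (- typical K c \<eta> C i)
      \<le> measure S (((dev tv C \<union> dev (\<lambda>v. - tv v) C) \<union> (dev sv C \<union> dev (\<lambda>v. - sv v) C)) \<union> (ex C \<union> ?sh))"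
      using dev_sets ints ex_sets sh by (intro P.finite_measure_mono) auto
    also have "\<dots> \<le> ((measure S (dev tv C) + measure S (dev (\<lambda>v. - tv v) C))
        + (measure S (dev sv C) + measure S (dev (\<lambda>v. - sv v) C))) + (measure S (ex C) + measure S ?sh)"
      using dev_sets ints ex_sets sh
      by (intro order_trans[OF measure_Un_le] add_mono) auto
    also have "measure S ?sh = measure S (ex C)" by (rule measure_shift[OF ex_sets])
    also have "((measure S (dev tv C) + measure S (dev (\<lambda>v. - tv v) C))
        + (measure S (dev sv C) + measure S (dev (\<lambda>v. - sv v) C))) + (measure S (ex C) + measure S (ex C)) \<le> \<delta>"
      using C1(2)[of C] C2(2)[of C] C3(2)[of C] C4(2)[of C] C5(2)[of C] C1(1) C2(1) C3(1) C4(1) C5(1)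
      by (simp add: C_def)
    finally show ?thesis .
  qed
  then show ?thesis using C1 C2 C3 C4 C5 by (intro exI[of _ C]) (auto simp: C_def)
qed

definition overflow :: "real \<Rightarrow> (nat \<Rightarrow> 'b) set" where
  "overflow x = {\<omega>. \<exists>k. past_dater k \<omega> > x}"

lemma sets_overflow [measurable]: "overflow x \<in> sets S"
    unfolding overflow_def by (rule sets_Collect_S) measurable

lemma sets_jump: "{\<omega>. sv (\<omega> i) > u} \<in> sets S"
    by (rule sets_Collect_S) measurable

lemma jump_and_rest:
  assumes "G \<in> sets S" "\<And>\<omega> v. fun_upd \<omega> i v \<in> G \<longleftrightarrow> \<omega> \<in> G"
  shows "measure S {\<omega>. sv (\<omega> i) > u \<and> \<omega> \<in> G} = exceed u * measure S G"
  using measure_coordinate_indep[of "{v. sv v > u}" G i] assms by (simp add: exceed_def)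

end

context heavy_queue
begin

text \<open>
An overflow needs a high maximum of the walk. Either this happens without a big increment, or some
job exceeds its fluid threshold, or a job causes a big increment below its threshold although the
other customers are not typical. The last possibility costs an arbitrarily small factor by
independence.
\<close>
lemma overflow_upper:
  assumes e: "0 < e" "e < 1" and \<epsilon>: "0 < \<epsilon>"
  shows "\<exists>C\<ge>0. \<forall>\<^sub>F x in at_top. measure S (overflow x) \<le> \<epsilon> * excess x
    + (\<Sum>n. exceed (min (x - C + real n * ((1 - e) * a)) (real m * x - C + real n * ((1 - e) * (real m * a - b)))))"
proof -
  obtain K where K: "0 \<le> K" "integral\<^sup>L D (rise_sv K) < a" using exists_stable_level by blast
  define c where "c = (a - integral\<^sup>L D (rise_sv K)) / 2"
  have c: "0 < c" "c < a - integral\<^sup>L D (rise_sv K)" using K by (auto simp: c_def)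
  obtain C1 where C1: "0 \<le> C1" "\<forall>\<^sub>F x in at_top.
    measure S {\<omega>. (\<exists>n. walk K n \<omega> > x) \<and> (\<forall>n. sv (\<omega> n) \<le> x - C1 + real n * c)} \<le> \<epsilon> / 4 * tail \<nu> x"
    using no_big_jump[OF K(1) c, of "\<epsilon> / 4"] \<epsilon> by auto
  define r where "r = K + C1"
  obtain Q where Q: "Q > 0" "\<And>y. y \<ge> 0 \<Longrightarrow> summable (\<lambda>n. exceed (y - r + real n * c)) \<and>
     (\<Sum>n. exceed (y - r + real n * c)) \<le> Q * tail \<nu> y"
    using jump_sum_bound[OF K(1) c, of r] by blast
  have "\<epsilon> / (2 * Q) > 0" "c * e / 10 > 0" using \<epsilon> Q c e by auto
  then obtain C where C: "0 \<le> C" "\<And>i. measure S (- typical K c (c * e / 10) C i) \<le> \<epsilon> / (2 * Q)"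
    using typical_prob[OF K(1) c, of "c * e / 10" "\<epsilon> / (2 * Q)"] by blast
  define \<kappa> where "\<kappa> = 2 * b + 5 * K + 14 * C + c"
  define C' where "C' = real m * \<kappa>"
  define u where "u x n = min (x - C' + real n * ((1 - e) * a)) (real m * x - C' + real n * ((1 - e) * (real m * a - b)))" for x n
  have \<kappa>: "0 \<le> \<kappa>" using mean_nonneg K C c by (simp add: \<kappa>_def)
  have sum_u: "summable (\<lambda>n. exceed (u x n))" if "0 \<le> x" for x
  proof -
    have "1 * x \<le> real m * x" using servers that by (intro mult_right_mono) auto
    then show ?thesis unfolding u_def using e mean_nonneg stable by (intro exceed_sums(1)) auto
  qed
  have "\<forall>\<^sub>F x in at_top. measure S {\<omega>. (\<exists>n. walk K n \<omega> > x - K) \<and> (\<forall>n. sv (\<omega> n) \<le> x - K - C1 + real n * c)} \<le> \<epsilon> / 4 * tail \<nu> (x - K)"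
    using C1(2) filterlim_tendsto_add_at_top[OF tendsto_const[of "- K"] filterlim_ident]
    by (auto simp: filterlim_iff)
  moreover have "\<forall>\<^sub>F x in at_top. tail \<nu> (x - K) \<le> (1 + 1) * tail \<nu> x"
    by (rule long_tailed) (use K in auto)
  ultimately have "\<forall>\<^sub>F x in at_top. measure S (overflow x) \<le> \<epsilon> * excess x + (\<Sum>n. exceed (u x n))"
    using eventually_ge_at_top[of \<kappa>]
  proof eventually_elim
    case (elim x)
    have x0: "0 \<le> x" using elim(3) \<kappa> by simp
    let ?N = "{\<omega>. (\<exists>n. walk K n \<omega> > x - K) \<and> (\<forall>n. sv (\<omega> n) \<le> x - K - C1 + real n * c)}"
    let ?U = "{\<omega>. \<exists>n. sv (\<omega> n) > u x n}"
    let ?V = "\<lambda>n. {\<omega>. sv (\<omega> n) > x - r + real n * c \<and> \<omega> \<in> - typical K c (c * e / 10) C n}"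
    have Nm: "?N \<in> sets S"
    by (rule sets_Collect_S) measurable
    have Um: "?U \<in> sets S"
    by (rule sets_Collect_S) measurable
    have Tm: "- typical K c (c * e / 10) C n \<in> sets S" for n
      using sets.compl_sets[OF sets_typical[of K c "c * e / 10" C n]] by (simp add: Compl_eq_Diff_UNIV)
    have Vm: "?V n \<in> sets S" for n
    proof -
      have "?V n = {\<omega>. sv (\<omega> n) > x - r + real n * c} \<inter> (- typical K c (c * e / 10) C n)" by auto
      then show ?thesis using sets_jump Tm by simp
    qed
    have Vp: "measure S (?V n) \<le> exceed (x - r + real n * c) * (\<epsilon> / (2 * Q))" for n
    proof -
      have "measure S (?V n) = exceed (x - r + real n * c) * measure S (- typical K c (c * e / 10) C n)"
        by (rule jump_and_rest[OF Tm]) (simp add: typical_coordinate)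
      also have "\<dots> \<le> exceed (x - r + real n * c) * (\<epsilon> / (2 * Q))"
        by (intro mult_left_mono C(2) exceed_nonneg)
      finally show ?thesis .
    qed
    have sV: "summable (\<lambda>n. measure S (?V n))"
      by (rule summable_comparison_test'[of "\<lambda>n. exceed (x - r + real n * c) * (\<epsilon> / (2 * Q))"])
        (use Q(2)[OF x0] Vp in \<open>auto intro: summable_mult2\<close>)
    have sub: "overflow x \<subseteq> (?N \<union> ?U) \<union> (\<Union>n. ?V n)"
    proof
      fix \<omega> assume "\<omega> \<in> overflow x"
      then obtain k where k: "past_dater k \<omega> > x" by (auto simp: overflow_def)
      obtain n where "past_dater k \<omega> \<le> K + walk K n \<omega>" using past_dater_le_walk[OF K(1)] by blast
      then have w: "\<exists>n. walk K n \<omega> > x - K" using k by (intro exI[of _ n]) linarith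
      show "\<omega> \<in> (?N \<union> ?U) \<union> (\<Union>n. ?V n)"
      proof (rule ccontr)
        assume no: "\<omega> \<notin> (?N \<union> ?U) \<union> (\<Union>n. ?V n)"
        then obtain i where i: "sv (\<omega> i) > x - K - C1 + real i * c" using w by (auto simp: not_le)
        then have ty: "\<omega> \<in> typical K c (c * e / 10) C i" using no by (auto simp: r_def algebra_simps)
        have "sv (\<omega> i) \<le> u x i" using no by (auto simp: not_less)
        then have "sv (\<omega> i) \<le> min (x + real i * ((1 - e) * a)) (real m * x + real i * ((1 - e) * (real m * a - b))) - real m * \<kappa>"
          unfolding u_def C'_def by (simp add: min_def algebra_simps split: if_splits)
        then have "past_dater k \<omega> \<le> x"
          using no_overflow_given_typical[OF K(1) c(1) e C(1) _ ty] elim(3) unfolding \<kappa>_def by blast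
        then show False using k by simp
      qed
    qed
    have "measure S (overflow x) \<le> measure S ((?N \<union> ?U) \<union> (\<Union>n. ?V n))"
      using Nm Um Vm by (intro P.finite_measure_mono[OF sub]) auto
    also have "\<dots> \<le> measure S ?N + measure S ?U + measure S (\<Union>n. ?V n)"
      using Nm Um Vm by (intro order_trans[OF measure_Un_le] add_mono measure_Un_le) auto
    also have "measure S ?N \<le> \<epsilon> / 2 * excess x"
    proof -
      have "measure S ?N \<le> \<epsilon> / 4 * tail \<nu> (x - K)" by (rule elim(1))
      also have "\<dots> \<le> \<epsilon> / 4 * (2 * tail \<nu> x)"
        using elim(2) \<epsilon> by (intro mult_left_mono) auto
      finally have "measure S ?N \<le> \<epsilon> / 2 * tail \<nu> x" by simp
      also have "\<dots> \<le> \<epsilon> / 2 * excess x" using tail_le_excess[OF x0] \<epsilon> by simp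
      finally show ?thesis .
    qed
    also have "measure S ?U \<le> (\<Sum>n. exceed (u x n))" by (rule big_jump_prob[OF sum_u[OF x0]])
    also have "measure S (\<Union>n. ?V n) \<le> \<epsilon> / 2 * excess x"
    proof -
      have "measure S (\<Union>n. ?V n) \<le> (\<Sum>n. measure S (?V n))"
        using Vm sV by (intro P.finite_measure_subadditive_countably) auto
      also have "\<dots> \<le> (\<Sum>n. exceed (x - r + real n * c) * (\<epsilon> / (2 * Q)))"
        using Q(2)[OF x0] by (intro suminf_le Vp sV summable_mult2) auto
      also have "\<dots> = (\<Sum>n. exceed (x - r + real n * c)) * (\<epsilon> / (2 * Q))"
        using Q(2)[OF x0] by (intro suminf_mult2[symmetric]) auto
      also have "\<dots> \<le> Q * excess x * (\<epsilon> / (2 * Q))"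
      proof (rule mult_right_mono)
        have "Q * tail \<nu> x \<le> Q * excess x" using Q(1) tail_le_excess[OF x0] by simp
        then show "(\<Sum>n. exceed (x - r + real n * c)) \<le> Q * excess x" using Q(2)[OF x0] by linarith
      qed (use \<epsilon> Q(1) in simp)
      also have "\<dots> = \<epsilon> / 2 * excess x" using Q(1) by simp
      finally show ?thesis .
    qed
    finally show ?case by simp
  qed
  then show ?thesis using \<kappa> unfolding u_def by (intro exI[of _ C']) (auto simp: C'_def)
qed

end

section \<open>Matching bounds\<close>

context queue_law
begin

text \<open>
The two branches of the minimum correspond to the two lower bounds of the dater.
\<close>
lemma overflow_of_big_job:
  assumes \<eta>: "0 \<le> \<eta>" "\<eta> \<le> e * a" "(1 + real m) * \<eta> \<le> e * (real m * a - b)" and C: "0 \<le> C"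
    and t: "(\<Sum>j<i. tv (\<omega> j)) \<le> real i * (a + \<eta>) + C"
    and s: "(\<Sum>j<i. - sv (\<omega> j)) \<le> real i * (- b + \<eta>) + C"
    and big: "sv (\<omega> i) > min (x + (1 + real m) * C + real i * ((1 + e) * a))
        (real m * x + (1 + real m) * C + real i * ((1 + e) * (real m * a - b)))"
  shows "\<omega> \<in> overflow x"
proof -
  have "past_dater i \<omega> > x"
  proof (cases "sv (\<omega> i) > x + (1 + real m) * C + real i * ((1 + e) * a)")
    case True
    have "real i * \<eta> \<le> real i * (e * a)" using \<eta> by (intro mult_left_mono) auto
    moreover have "0 \<le> real m * C" using C by simp
    ultimately show ?thesis
      using past_dater_ge_job[of \<omega> i] t True by (simp add: algebra_simps)
  next
    case False
    then have *: "sv (\<omega> i) > real m * x + (1 + real m) * C + real i * ((1 + e) * (real m * a - b))"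
      using big by (auto simp: min_def split: if_splits)
    have 1: "real i * ((1 + real m) * \<eta>) \<le> real i * (e * (real m * a - b))"
      using \<eta> by (intro mult_left_mono) auto
    have 2: "real m * (\<Sum>j<i. tv (\<omega> j)) \<le> real m * (real i * (a + \<eta>) + C)"
      using t by (intro mult_left_mono) auto
    have "real m * x < real m * past_dater i \<omega>"
      using past_dater_ge_work[of \<omega> i] s * 1 2 by (simp add: sum_negf algebra_simps)
    then show ?thesis by (simp add: mult_less_cancel_left)
  qed
  then show ?thesis by (auto simp: overflow_def)
qed

end

context heavy_queue
begin

lemma excess_tendsto_0: "(excess \<longlongrightarrow> 0) at_top"
  using tendsto_cong[OF excess_eq_tail, of 0] tail_tendsto_0 by blast

text \<open>
The events are made disjoint by requiring that all more recent jobs stay below their thresholds, which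
is likely for large \<open>x\<close>. Each of them is an independent intersection.
\<close>
lemma overflow_lower:
  assumes e: "0 < e" and \<epsilon>: "0 < \<epsilon>"
  shows "\<exists>C\<ge>0. \<forall>\<^sub>F x in at_top.
    (1 - \<epsilon>) * (\<Sum>n. exceed (min (x + C + real n * ((1 + e) * a)) (real m * x + C + real n * ((1 + e) * (real m * a - b)))))
     \<le> measure S (overflow x)"
proof -
  define d where "d = real m * a - b"
  have d: "0 < d" "0 < a" using stable mean_nonneg by (auto simp: d_def)
  have m1: "1 \<le> real m" using servers by simp
  \<comment> \<open>The error rate must fit into the slack of both branches; the second one involves \<open>m\<close>
  interarrival sums and one service sum.\<close>
  define \<eta> where "\<eta> = min (e * a) (e * d / (1 + real m))"
  have \<eta>: "0 < \<eta>" "\<eta> \<le> e * a" "(1 + real m) * \<eta> \<le> e * d"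
  proof -
    show "0 < \<eta>" using d e by (simp add: \<eta>_def)
    show "\<eta> \<le> e * a" by (simp add: \<eta>_def)
    have "(1 + real m) * \<eta> \<le> (1 + real m) * (e * d / (1 + real m))"
      by (intro mult_left_mono) (auto simp: \<eta>_def)
    also have "\<dots> = e * d" using m1 by simp
    finally show "(1 + real m) * \<eta> \<le> e * d" .
  qed
  have int: "integrable D (\<lambda>v. - sv v)" using sv_integrable by simp
  obtain C1 where C1: "C1 \<ge> 0" "\<And>C. C \<ge> C1 \<Longrightarrow>
      measure S {\<omega>. \<exists>n. (\<Sum>j<n. tv (\<omega> j)) > real n * (a + \<eta>) + C} \<le> \<epsilon> / 3"
    using partial_sums_tight[OF tv_integrable \<eta>(1), of "\<epsilon> / 3"] \<epsilon> by (auto simp: mean_tv)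
  obtain C2 where C2: "C2 \<ge> 0" "\<And>C. C \<ge> C2 \<Longrightarrow>
      measure S {\<omega>. \<exists>n. (\<Sum>j<n. - sv (\<omega> j)) > real n * (- b + \<eta>) + C} \<le> \<epsilon> / 3"
    using partial_sums_tight[OF int \<eta>(1), of "\<epsilon> / 3"] \<epsilon> by (auto simp: mean_sv)
  define C where "C = C1 + C2"
  define C' where "C' = (1 + real m) * C"
  have C: "0 \<le> C" "0 \<le> C'" using C1 C2 by (auto simp: C_def C'_def)
  let ?T = "{\<omega>. \<exists>n. (\<Sum>j<n. tv (\<omega> j)) > real n * (a + \<eta>) + C}"
  let ?S = "{\<omega>. \<exists>n. (\<Sum>j<n. - sv (\<omega> j)) > real n * (- b + \<eta>) + C}"
  have Tm: "?T \<in> sets S" "?S \<in> sets S" by (intro sets_deviation; measurable)+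
  define u where "u x n = min (x + C' + real n * ((1 + e) * a)) (real m * x + C' + real n * ((1 + e) * d))" for x n
  have pq: "x + C' \<le> real m * x + C'" if "0 \<le> x" for x
    using mult_right_mono[OF m1 that] by simp
  have sum_u: "summable (\<lambda>n. exceed (u x n))" if "0 \<le> x" for x
    unfolding u_def using d e pq[OF that] by (intro exceed_sums(1)) auto
  define s where "s = min a d"
  have s: "0 < s" using d by (simp add: s_def)
  have "((\<lambda>x. (1 / s + 1) * excess (x - 1)) \<longlongrightarrow> (1 / s + 1) * 0) at_top"
    using filterlim_compose[OF excess_tendsto_0 filterlim_tendsto_add_at_top[OF tendsto_const[of "-1"] filterlim_ident]]
    by (intro tendsto_mult tendsto_const) simp
  then have "\<forall>\<^sub>F x in at_top. (1 / s + 1) * excess (x - 1) < \<epsilon> / 3"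
    using \<epsilon> by (intro order_tendstoD) auto
  then have "\<forall>\<^sub>F x in at_top. (1 - \<epsilon>) * (\<Sum>n. exceed (u x n)) \<le> measure S (overflow x)"
    using eventually_ge_at_top[of 0]
  proof eventually_elim
    case (elim x)
    let ?U = "{\<omega>. \<exists>n. sv (\<omega> n) > u x n}"
    have Um: "?U \<in> sets S"
    by (rule sets_Collect_S) measurable
    have "measure S ?U \<le> (\<Sum>n. exceed (u x n))" by (rule big_jump_prob[OF sum_u[OF elim(2)]])
    also have "\<dots> \<le> (\<Sum>n. exceed (x + real n * s))"
    proof (intro suminf_le exceed_mono sum_u[OF elim(2)] exceed_linear_sums(1)[OF s])
      fix n
      have "s \<le> (1 + e) * a" "s \<le> (1 + e) * d"
      proof -
        have "1 * a \<le> (1 + e) * a" "1 * d \<le> (1 + e) * d" using d e by (intro mult_right_mono; simp)+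
        then show "s \<le> (1 + e) * a" "s \<le> (1 + e) * d" by (auto simp: s_def)
      qed
      then have "real n * s \<le> real n * ((1 + e) * a)" "real n * s \<le> real n * ((1 + e) * d)"
        by (auto intro: mult_left_mono)
      then show "x + real n * s \<le> u x n"
        using C(2) pq[OF elim(2)] unfolding u_def by (intro min.boundedI; linarith)
    qed
    also have "\<dots> \<le> excess x / s + exceed x" by (rule exceed_linear_sums(2)[OF s])
    also have "\<dots> \<le> excess (x - 1) / s + excess (x - 1)"
      using s exceed_le_excess[of x] by (intro add_mono divide_right_mono excess_mono) auto
    also have "\<dots> = (1 / s + 1) * excess (x - 1)" by (simp add: algebra_simps)
    finally have U: "measure S ?U \<le> \<epsilon> / 3" using elim(1) by linarith
    let ?G = "\<lambda>i. {\<omega>. (\<Sum>j<i. tv (\<omega> j)) \<le> real i * (a + \<eta>) + C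
       \<and> (\<Sum>j<i. - sv (\<omega> j)) \<le> real i * (- b + \<eta>) + C \<and> (\<forall>j<i. sv (\<omega> j) \<le> u x j)}"
    have Gm: "?G i \<in> sets S" for i
    proof -
      have "{\<omega> \<in> space S. (\<Sum>j<i. tv (\<omega> j)) \<le> real i * (a + \<eta>) + C
       \<and> (\<Sum>j<i. - sv (\<omega> j)) \<le> real i * (- b + \<eta>) + C \<and> (\<forall>j\<in>{..<i}. sv (\<omega> j) \<le> u x j)} \<in> sets S"
        by measurable
      then show ?thesis by (simp add: Ball_def)
    qed
    have Gp: "1 - \<epsilon> \<le> measure S (?G i)" for i
    proof -
      have "measure S (UNIV - ?G i) \<le> measure S ((?T \<union> ?S) \<union> ?U)"
        using Tm Um by (intro P.finite_measure_mono) (auto simp: not_le not_less)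
      also have "\<dots> \<le> (measure S ?T + measure S ?S) + measure S ?U"
        using Tm Um by (intro order_trans[OF measure_Un_le] add_mono measure_Un_le) auto
      also have "\<dots> \<le> \<epsilon>" using C1(2)[of C] C2(2)[of C] C1(1) C2(1) U by (simp add: C_def)
      finally have "measure S (UNIV - ?G i) \<le> \<epsilon>" .
      moreover have "measure S (UNIV - ?G i) = 1 - measure S (?G i)"
        using P.prob_compl[OF Gm[of i]] by simp
      ultimately show ?thesis by simp
    qed
    let ?A = "\<lambda>i. {\<omega>. sv (\<omega> i) > u x i \<and> \<omega> \<in> ?G i}"
    have Am: "?A i \<in> sets S" for i
    proof -
      have "?A i = {\<omega>. sv (\<omega> i) > u x i} \<inter> ?G i" by blast
      then show ?thesis using sets_jump[of "u x i" i] Gm[of i] by simp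
    qed
    have Ap: "measure S (?A i) = exceed (u x i) * measure S (?G i)" for i
    proof (rule jump_and_rest[OF Gm])
      fix \<omega> v
      have "(\<Sum>j<i. f (fun_upd \<omega> i v j)) = (\<Sum>j<i. f (\<omega> j))" for f :: "'b \<Rightarrow> real"
        by (intro sum.cong) auto
      then show "fun_upd \<omega> i v \<in> ?G i \<longleftrightarrow> \<omega> \<in> ?G i" by simp
    qed
    have disj: "disjoint_family ?A"
    proof -
      have lt: "\<omega> \<notin> ?A j" if "i < j" "\<omega> \<in> ?A i" for i j \<omega>
        using that by (auto simp: not_le)
      show ?thesis
        unfolding disjoint_family_on_def
      proof (intro ballI impI)
        fix i j :: nat assume "i \<noteq> j"
        then consider "i < j" | "j < i" by linarith
        then show "?A i \<inter> ?A j = {}" by cases (use lt in blast)+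
      qed
    qed
    have sA: "(\<lambda>i. measure S (?A i)) sums measure S (\<Union>i. ?A i)"
      using Am disj by (intro P.finite_measure_UNION) auto
    have "(1 - \<epsilon>) * (\<Sum>n. exceed (u x n)) = (\<Sum>n. (1 - \<epsilon>) * exceed (u x n))"
      by (intro suminf_mult[symmetric] sum_u[OF elim(2)])
    also have "\<dots> \<le> (\<Sum>n. measure S (?A n))"
    proof (intro suminf_le)
      show "(1 - \<epsilon>) * exceed (u x n) \<le> measure S (?A n)" for n
        unfolding Ap using mult_left_mono[OF Gp[of n] exceed_nonneg[of "u x n"]] by (simp add: mult.commute)
    qed (use sA sum_u[OF elim(2)] in \<open>auto intro: summable_mult sums_summable\<close>)
    also have "\<dots> = measure S (\<Union>i. ?A i)" using sA by (rule sums_unique[symmetric])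
    also have "\<dots> \<le> measure S (overflow x)"
    proof (rule P.finite_measure_mono)
      show "(\<Union>i. ?A i) \<subseteq> overflow x"
      proof
        fix \<omega> assume "\<omega> \<in> (\<Union>i. ?A i)"
        then obtain i where i: "sv (\<omega> i) > u x i" "\<omega> \<in> ?G i" by blast
        show "\<omega> \<in> overflow x"
          by (rule overflow_of_big_job[where \<eta> = \<eta> and e = e and C = C and i = i])
            (use i \<eta> C in \<open>auto simp: u_def C'_def d_def\<close>)
      qed
    qed simp
    finally show ?case .
  qed
  then show ?thesis using C(2) unfolding u_def d_def by blast
qed

text \<open>
The integral over \<open>t \<ge> 0\<close> of the service tail at the fluid threshold
\<open>min (x + t a) (m x + t (m a - b))\<close>.
\<close>
definition fluid_tail :: "real \<Rightarrow> real" where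
  "fluid_tail x = (LINT v|D. crossings x (real m * x) a (real m * a - b) (sv v))"

lemma fluid_tail_ge: "excess x / a \<le> fluid_tail x"
proof -
  have "excess x / a = (LINT v|D. max 0 (sv v - x) / a)" by (simp add: excess_def)
  also have "\<dots> \<le> fluid_tail x"
    unfolding fluid_tail_def
  proof (intro integral_mono integrable_crossings)
    show "integrable D (\<lambda>v. max 0 (sv v - x) / a)" using integrable_excess by simp
    show "max 0 (sv v - x) / a \<le> crossings x (real m * x) a (real m * a - b) (sv v)" for v
      using mean_nonneg by (auto simp: crossings_def max_def)
  qed
  finally show ?thesis .
qed

lemma crossings_scale:
  assumes "0 < r" shows "crossings p q (r * c) (r * d) s = crossings p q c d s / r"
proof -
  have eq: "(s - p) / (r * c) = (s - p) / c / r" "(s - q) / (r * d) = (s - q) / d / r" by (simp_all add: mult.commute)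
  have "max 0 (max (A / r) (B / r)) = max 0 (max A B) / r" for A B
    using assms by (auto simp: max_def divide_le_cancel divide_nonneg_pos zero_le_divide_iff)
  then show ?thesis unfolding crossings_def eq .
qed

text \<open>
Lowering the thresholds by \<open>C\<close> adds a bounded number of crossings, and only for
\<open>s > p - C\<close>.
\<close>
lemma crossings_shift:
  assumes "0 < c" "0 < d" "0 \<le> C" "p \<le> q"
  shows "crossings (p - C) (q - C) c d s \<le> crossings p q c d s + C / min c d * indicator {p - C<..} s"
proof (cases "p - C < s")
  case True
  have "C / c \<le> C / min c d" "C / d \<le> C / min c d"
    using assms by (auto intro!: divide_left_mono simp: min_def)
  moreover have "0 \<le> C / min c d" using assms by simp
  moreover have "(s - (p - C)) / c = (s - p) / c + C / c" "(s - (q - C)) / d = (s - q) / d + C / d"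
    by (simp_all add: diff_divide_distrib add_divide_distrib)
  ultimately show ?thesis using True by (simp add: crossings_def) (auto simp: max_def)
next
  case False
  then have "(s - (p - C)) / c \<le> 0" "(s - (q - C)) / d \<le> 0"
    using assms by (auto intro!: divide_nonpos_pos)
  then show ?thesis using False by (simp add: crossings_def)
qed

lemma integral_crossings_shift:
  assumes "0 \<le> C" "0 \<le> x"
  shows "(LINT v|D. crossings (x - C) (real m * x - C) a (real m * a - b) (sv v))
    \<le> fluid_tail x + C / min a (real m * a - b) * exceed (x - C)"
    and "fluid_tail x - C / min a (real m * a - b) * exceed x
    \<le> (LINT v|D. crossings (x + C) (real m * x + C) a (real m * a - b) (sv v))"
proof -
  let ?d = "real m * a - b"
  have d: "0 < ?d" "0 < a" using stable mean_nonneg by auto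
  have m1: "1 \<le> real m" using servers by simp
  have pq: "x \<le> real m * x" using mult_right_mono[OF m1 assms(2)] by simp
  have i2: "integrable D (\<lambda>v. C / min a ?d * indicator {v. sv v > y} v)" for y
    by (intro integrable_mult_right integrable_indicator_exceed)
  have ind: "indicator {y<..} (sv v) = indicator {v. sv v > y} v" for y v by (simp add: indicator_def)
  have le: "(LINT v|D. crossings (p - C) (q - C) a ?d (sv v))
    \<le> (LINT v|D. crossings p q a ?d (sv v)) + C / min a ?d * exceed (p - C)" if "p \<le> q" for p q
  proof -
    have "(LINT v|D. crossings (p - C) (q - C) a ?d (sv v))
      \<le> (LINT v|D. crossings p q a ?d (sv v) + C / min a ?d * indicator {v. sv v > p - C} v)"
    proof (intro integral_mono integrable_crossings Bochner_Integration.integrable_add i2)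
      show "crossings (p - C) (q - C) a ?d (sv v)
        \<le> crossings p q a ?d (sv v) + C / min a ?d * indicator {v. sv v > p - C} v" for v
        using crossings_shift[OF d(2,1) assms(1) that, of "sv v"] unfolding ind .
    qed
    also have "\<dots> = (LINT v|D. crossings p q a ?d (sv v)) + C / min a ?d * exceed (p - C)"
      by (subst Bochner_Integration.integral_add[OF integrable_crossings i2]) (simp add: exceed_def)
    finally show ?thesis .
  qed
  show "(LINT v|D. crossings (x - C) (real m * x - C) a ?d (sv v)) \<le> fluid_tail x + C / min a ?d * exceed (x - C)"
    unfolding fluid_tail_def by (rule le[OF pq])
  show "fluid_tail x - C / min a ?d * exceed x \<le> (LINT v|D. crossings (x + C) (real m * x + C) a ?d (sv v))"
    using le[of "x + C" "real m * x + C"] pq unfolding fluid_tail_def by simp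
qed

text \<open>
Scaling the slopes by \<open>1 \<plusminus> e\<close> scales the number of crossings, and shifting the thresholds
costs a multiple of the tail, which is negligible.
\<close>
lemma overflow_asymptotics:
  assumes e: "0 < e" "e < 1"
  shows "\<forall>\<^sub>F x in at_top. measure S (overflow x) \<le> (1 / (1 - e) + e) * fluid_tail x"
    and "\<forall>\<^sub>F x in at_top. (1 - e) * ((1 / (1 + e) - e) * fluid_tail x) \<le> measure S (overflow x)"
proof -
  let ?d = "real m * a - b"
  have d: "0 < ?d" "0 < a" using stable mean_nonneg by auto
  have m1: "1 \<le> real m" using servers by simp
  have pq: "x \<le> real m * x" if "0 \<le> x" for x using mult_right_mono[OF m1 that] by simp
  have ft: "excess x \<le> a * fluid_tail x" for x
    using fluid_tail_ge[of x] d by (simp add: field_simps)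
  obtain C where C: "0 \<le> C" "\<forall>\<^sub>F x in at_top. measure S (overflow x) \<le> e / (2 * a) * excess x
    + (\<Sum>n. exceed (min (x - C + real n * ((1 - e) * a)) (real m * x - C + real n * ((1 - e) * ?d))))"
    using overflow_upper[OF e, of "e / (2 * a)"] e d by auto
  define L where "L = C / min a ?d / (1 - e) + 1"
  have L: "0 < L" using C d e by (auto simp: L_def intro!: add_nonneg_pos)
  have "\<forall>\<^sub>F x in at_top. exceed (x - C) \<le> e / (2 * a * L) * excess x"
    using L e d by (intro exceed_negligible) auto
  with C(2) eventually_ge_at_top[of 0]
  show "\<forall>\<^sub>F x in at_top. measure S (overflow x) \<le> (1 / (1 - e) + e) * fluid_tail x"
  proof eventually_elim
    case (elim x)
    have "(\<Sum>n. exceed (min (x - C + real n * ((1 - e) * a)) (real m * x - C + real n * ((1 - e) * ?d))))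
      \<le> (LINT v|D. crossings (x - C) (real m * x - C) ((1 - e) * a) ((1 - e) * ?d) (sv v)) + exceed (x - C)"
      using d e pq[OF elim(2)] by (intro exceed_sums(3)) auto
    also have "\<dots> = (LINT v|D. crossings (x - C) (real m * x - C) a ?d (sv v)) / (1 - e) + exceed (x - C)"
      using e by (simp add: crossings_scale)
    also have "\<dots> \<le> (fluid_tail x + C / min a ?d * exceed (x - C)) / (1 - e) + exceed (x - C)"
      using integral_crossings_shift(1)[OF C(1) elim(2)] e by (intro add_mono divide_right_mono) auto
    also have "\<dots> = fluid_tail x / (1 - e) + L * exceed (x - C)"
      by (simp add: L_def add_divide_distrib algebra_simps)
    also have "L * exceed (x - C) \<le> L * (e / (2 * a * L) * excess x)"
      using L elim(3) by (intro mult_left_mono) auto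
    also have "\<dots> = e / (2 * a) * excess x" using L by simp
    finally have "measure S (overflow x) \<le> fluid_tail x / (1 - e) + e / a * excess x"
      using elim(1) by simp
    also have "e / a * excess x \<le> e / a * (a * fluid_tail x)"
      using ft d e by (intro mult_left_mono) auto
    finally show ?case using d by (simp add: algebra_simps)
  qed
  obtain C where C: "0 \<le> C" "\<forall>\<^sub>F x in at_top.
    (1 - e) * (\<Sum>n. exceed (min (x + C + real n * ((1 + e) * a)) (real m * x + C + real n * ((1 + e) * ?d))))
     \<le> measure S (overflow x)"
    using overflow_lower[OF e(1) e(1)] by blast
  define L where "L = C / min a ?d / (1 + e) + 1"
  have L: "0 < L" using C d e by (auto simp: L_def intro!: add_nonneg_pos)
  have "\<forall>\<^sub>F x in at_top. exceed (x - 0) \<le> e / (a * L) * excess x"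
    using L e d by (intro exceed_negligible) auto
  with C(2) eventually_ge_at_top[of 0]
  show "\<forall>\<^sub>F x in at_top. (1 - e) * ((1 / (1 + e) - e) * fluid_tail x) \<le> measure S (overflow x)"
  proof eventually_elim
    case (elim x)
    have "(C / min a ?d / (1 + e)) * exceed x \<le> L * exceed x"
      by (intro mult_right_mono exceed_nonneg) (simp add: L_def)
    also have "\<dots> \<le> L * (e / (a * L) * excess x)"
      using L elim(3) by (intro mult_left_mono) auto
    also have "\<dots> = e / a * excess x" using L by simp
    also have "\<dots> \<le> e / a * (a * fluid_tail x)"
      using ft d e by (intro mult_left_mono) auto
    finally have err: "C / min a ?d / (1 + e) * exceed x \<le> e * fluid_tail x" using d by simp
    have "(1 / (1 + e) - e) * fluid_tail x \<le> (fluid_tail x - C / min a ?d * exceed x) / (1 + e)"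
      using err by (simp add: diff_divide_distrib algebra_simps)
    also have "\<dots> \<le> (LINT v|D. crossings (x + C) (real m * x + C) a ?d (sv v)) / (1 + e)"
      using integral_crossings_shift(2)[OF C(1) elim(2)] e by (intro divide_right_mono) auto
    also have "\<dots> = (LINT v|D. crossings (x + C) (real m * x + C) ((1 + e) * a) ((1 + e) * ?d) (sv v))"
      using e by (simp add: crossings_scale)
    also have "\<dots> \<le> (\<Sum>n. exceed (min (x + C + real n * ((1 + e) * a)) (real m * x + C + real n * ((1 + e) * ?d))))"
      using d e pq[OF elim(2)] by (intro exceed_sums(2)) auto
    finally have "(1 - e) * ((1 / (1 + e) - e) * fluid_tail x)
      \<le> (1 - e) * (\<Sum>n. exceed (min (x + C + real n * ((1 + e) * a)) (real m * x + C + real n * ((1 + e) * ?d))))"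
      using e by (intro mult_left_mono) auto
    then show ?case using elim(1) by linarith
  qed
qed

lemma fluid_tail_pos: "0 < fluid_tail x"
proof -
  have "0 < excess x / a" using excess_pos mean_nonneg by simp
  then show ?thesis using fluid_tail_ge[of x] by linarith
qed

lemma overflow_equiv: "(\<lambda>x. measure S (overflow x)) \<sim>[at_top] fluid_tail"
proof (rule asymp_equivI')
  have up: "((\<lambda>e. 1 / (1 - e) + e) \<longlongrightarrow> 1 / (1 - 0) + 0) (at_right (0::real))"
    by (intro tendsto_intros) auto
  have low: "((\<lambda>e. (1 - e) * (1 / (1 + e) - e)) \<longlongrightarrow> (1 - 0) * (1 / (1 + 0) - 0)) (at_right (0::real))"
    by (intro tendsto_intros) auto
  have small: "\<forall>\<^sub>F e in at_right (0::real). 0 < e \<and> e < 1"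
    by (auto simp: eventually_at_right_field intro!: exI[of _ 1])
  show "((\<lambda>x. measure S (overflow x) / fluid_tail x) \<longlongrightarrow> 1) at_top"
  proof (rule order_tendstoI)
    fix y :: real assume y: "1 < y"
    have "\<forall>\<^sub>F e in at_right (0::real). 1 / (1 - e) + e < y"
      using up y by (intro order_tendstoD) auto
    with small obtain e :: real where e: "0 < e" "e < 1" "1 / (1 - e) + e < y"
      using eventually_happens[OF eventually_conj[OF small]] by (auto simp: trivial_limit_at_right_real)
    from overflow_asymptotics(1)[OF e(1,2)]
    show "\<forall>\<^sub>F x in at_top. measure S (overflow x) / fluid_tail x < y"
    proof eventually_elim
      case (elim x)
      then have "measure S (overflow x) / fluid_tail x \<le> 1 / (1 - e) + e"
        using fluid_tail_pos[of x] by (simp add: divide_le_eq)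
      then show ?case using e by linarith
    qed
  next
    fix y :: real assume y: "y < 1"
    have "\<forall>\<^sub>F e in at_right (0::real). y < (1 - e) * (1 / (1 + e) - e)"
      using low y by (intro order_tendstoD) auto
    with small obtain e :: real where e: "0 < e" "e < 1" "y < (1 - e) * (1 / (1 + e) - e)"
      using eventually_happens[OF eventually_conj[OF small]] by (auto simp: trivial_limit_at_right_real)
    from overflow_asymptotics(2)[OF e(1,2)]
    show "\<forall>\<^sub>F x in at_top. y < measure S (overflow x) / fluid_tail x"
    proof eventually_elim
      case (elim x)
      then have "(1 - e) * (1 / (1 + e) - e) \<le> measure S (overflow x) / fluid_tail x"
        using fluid_tail_pos[of x] by (simp add: le_divide_eq mult.assoc)
      then show ?case using e by linarith
    qed
  qed
qed

text \<open>
The two lines \<open>(s - x) / a\<close> and \<open>(s - m x) / (m a - b)\<close> meet at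
\<open>s = b x / (b - (m - 1) a)\<close> if the second one is steeper. Otherwise the second one never
matters where it is positive.
\<close>
lemma fluid_tail_eq:
  assumes b: "0 < b" and x: "0 \<le> x"
  shows "fluid_tail x = 1 / a * excess x + max 0 (1 / (real m * a - b) - 1 / a)
     * excess (b * x / (b - (real m - 1) * a))"
proof -
  define d where "d = real m * a - b"
  define y where "y = b * x / (b - (real m - 1) * a)"
  have d: "0 < d" "0 < a" using stable mean_nonneg by (auto simp: d_def)
  have m1: "1 \<le> real m" using servers by simp
  have pq: "x \<le> real m * x" using mult_right_mono[OF m1 x] by simp
  have "b - (real m - 1) * a = a - d" by (simp add: d_def algebra_simps)
  then have y: "y = b * x / (a - d)" by (simp only: y_def)
  have pw: "crossings x (real m * x) a d s = 1 / a * max 0 (s - x) + max 0 (1 / d - 1 / a) * max 0 (s - y)" for s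
  proof (cases "d < a")
    case True
    have k: "0 < 1 / d - 1 / a" using True d by (simp add: field_simps)
    have bad: "b = real m * a - d" by (simp add: d_def)
    have "a - d \<le> b" using m1 d mult_right_mono[OF m1, of a] by (simp add: d_def)
    then have "x * (a - d) \<le> x * b" using x by (intro mult_left_mono) auto
    then have xy: "x \<le> y" using True by (simp add: y le_divide_eq mult.commute)
    have id: "(s - real m * x) / d = (s - x) / a + (1 / d - 1 / a) * (s - y)"
    proof -
      have "1 / d - 1 / a = (a - d) / (a * d)" using d by (simp add: field_simps)
      then have "(1 / d - 1 / a) * y = b * x / (a * d)"
        using True d by (simp add: y)
      also have "\<dots> = real m * x / d - x / a" using d by (simp add: bad field_simps)
      finally show ?thesis by (simp add: diff_divide_distrib algebra_simps)
    qed
    show ?thesis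
    proof (cases "s \<le> y")
      case True
      then have "(1 / d - 1 / a) * (s - y) \<le> 0" using k by (simp add: mult_nonneg_nonpos)
      then have "(s - real m * x) / d \<le> (s - x) / a" using id by linarith
      then have "max ((s - x) / a) ((s - real m * x) / d) = (s - x) / a" by (rule max.absorb1)
      then show ?thesis using True d by (auto simp: crossings_def max_def divide_le_0_iff zero_le_divide_iff)
    next
      case False
      then have "0 \<le> (1 / d - 1 / a) * (s - y)" using k by simp
      then have "(s - x) / a \<le> (s - real m * x) / d" using id by linarith
      then have "max ((s - x) / a) ((s - real m * x) / d) = (s - real m * x) / d" by (rule max.absorb2)
      moreover have "0 \<le> (s - real m * x) / d" using id False xy d k by (simp add: add_nonneg_nonneg)
      ultimately show ?thesis using False xy k id by (simp add: crossings_def)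
    qed
  next
    case False
    then have "1 / d - 1 / a \<le> 0" using d by (simp add: field_simps)
    moreover have "max 0 (max ((s - x) / a) ((s - real m * x) / d)) = max 0 (s - x) / a"
    proof (cases "s \<le> x")
      case True
      then have "(s - x) / a \<le> 0" "(s - real m * x) / d \<le> 0" using pq d by (auto intro!: divide_nonpos_pos)
      then show ?thesis using True by simp
    next
      case s: False
      have "(s - real m * x) / d \<le> (s - x) / d" using pq d by (intro divide_right_mono) auto
      also have "\<dots> \<le> (s - x) / a" using False s d by (intro divide_left_mono) auto
      finally show ?thesis using s d by (simp add: max_def)
    qed
    ultimately show ?thesis by (simp add: crossings_def)
  qed
  have "fluid_tail x = (LINT v|D. 1 / a * max 0 (sv v - x) + max 0 (1 / d - 1 / a) * max 0 (sv v - y))"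
    unfolding fluid_tail_def d_def[symmetric] pw ..
  also have "\<dots> = 1 / a * excess x + max 0 (1 / d - 1 / a) * excess y"
    unfolding excess_def
    by (subst Bochner_Integration.integral_add) (auto intro!: integrable_mult_right integrable_excess)
  finally show ?thesis by (simp add: d_def y_def)
qed

end

section \<open>From the queue to the coordinate space\<close>

text \<open>
Fubini's theorem for the region below the graph of \<open>X\<close>.
\<close>
lemma (in prob_space) integral_tail_eq_excess:
  fixes X :: "'a \<Rightarrow> real"
  assumes X: "integrable M X"
  shows "(LBINT u:{x<..}. measure M {\<omega> \<in> space M. X \<omega> > u}) = (\<integral>\<omega>. max 0 (X \<omega> - x) \<partial>M)"
proof -
  have [measurable]: "X \<in> borel_measurable M" using X by auto
  interpret pair_sigma_finite lborel M ..
  define T where "T u = measure M {\<omega> \<in> space M. X \<omega> > u}" for u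
  have "mono (\<lambda>u. - T u)" unfolding T_def mono_def by (auto intro!: finite_measure_mono)
  then have "(\<lambda>u. - (- T u)) \<in> borel_measurable borel"
    by (intro borel_measurable_uminus borel_measurable_mono)
  then have [measurable]: "T \<in> borel_measurable borel" by simp
  have "(\<integral>\<^sup>+u. ennreal (indicator {x<..} u * T u) \<partial>lborel)
      = (\<integral>\<^sup>+u. \<integral>\<^sup>+\<omega>. indicator {x<..} u * indicator {u<..} (X \<omega>) \<partial>M \<partial>lborel)"
  proof (rule nn_integral_cong)
    fix u :: real
    have "(\<integral>\<^sup>+\<omega>. indicator {x<..} u * indicator {u<..} (X \<omega>) \<partial>M)
        = indicator {x<..} u * (\<integral>\<^sup>+\<omega>. indicator {\<omega> \<in> space M. X \<omega> > u} \<omega> \<partial>M)"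
      by (subst nn_integral_cmult[symmetric]) (auto intro!: nn_integral_cong simp: indicator_def)
    also have "(\<integral>\<^sup>+\<omega>. indicator {\<omega> \<in> space M. X \<omega> > u} \<omega> \<partial>M) = ennreal (T u)"
      unfolding T_def emeasure_eq_measure[symmetric] by (rule nn_integral_indicator) measurable
    also have "indicator {x<..} u * ennreal (T u) = ennreal (indicator {x<..} u * T u)"
      by (simp add: indicator_def)
    finally show "ennreal (indicator {x<..} u * T u) = (\<integral>\<^sup>+\<omega>. indicator {x<..} u * indicator {u<..} (X \<omega>) \<partial>M)" ..
  qed
  also have "\<dots> = (\<integral>\<^sup>+\<omega>. \<integral>\<^sup>+u. indicator {x<..} u * indicator {u<..} (X \<omega>) \<partial>lborel \<partial>M)"
    by (rule Fubini'[symmetric]) (simp add: indicator_def)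
  also have "\<dots> = (\<integral>\<^sup>+\<omega>. ennreal (max 0 (X \<omega> - x)) \<partial>M)"
  proof (rule nn_integral_cong)
    fix \<omega>
    have "(\<integral>\<^sup>+u. indicator {x<..} u * indicator {u<..} (X \<omega>) \<partial>lborel) = (\<integral>\<^sup>+u. indicator {x<..<X \<omega>} u \<partial>lborel)"
      by (intro nn_integral_cong) (auto simp: indicator_def)
    also have "\<dots> = emeasure lborel {x<..<X \<omega>}" by simp
    also have "\<dots> = ennreal (max 0 (X \<omega> - x))"
      by (cases "x \<le> X \<omega>") auto
    finally show "(\<integral>\<^sup>+u. indicator {x<..} u * indicator {u<..} (X \<omega>) \<partial>lborel) = ennreal (max 0 (X \<omega> - x))" .
  qed
  also have "\<dots> = ennreal (\<integral>\<omega>. max 0 (X \<omega> - x) \<partial>M)"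
    using X by (intro nn_integral_eq_integral) auto
  finally have "(\<integral>\<^sup>+u. ennreal (indicator {x<..} u * T u) \<partial>lborel) = ennreal (\<integral>\<omega>. max 0 (X \<omega> - x) \<partial>M)" .
  then have "(LINT u|lborel. indicator {x<..} u * T u) = (\<integral>\<omega>. max 0 (X \<omega> - x) \<partial>M)"
    by (subst integral_eq_nn_integral) (auto simp: T_def intro!: Bochner_Integration.integral_nonneg)
  then show ?thesis by (simp add: set_lebesgue_integral_def T_def)
qed

text \<open>
The law \<open>\<nu>\<close> is the integrated tail distribution with its mass on the negative numbers moved
to \<open>0\<close>. Its tail on the half-line is unaffected.
\<close>
lemma (in prob_space) subexponential_integrated_tail:
  fixes X :: "'a \<Rightarrow> real"
  assumes X: "integrable M X" and nonneg: "\<And>\<omega>. \<omega> \<in> space M \<Longrightarrow> 0 \<le> X \<omega>"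
    and F: "\<And>x. measure M {\<omega> \<in> space M. X \<omega> > x} = tail F x"
    and sub: "subexponential (integrated_tail_distribution F)"
  defines "\<nu> \<equiv> distr (integrated_tail_distribution F) borel (max 0)"
  shows "subexponential_halfline \<nu>"
    and "0 \<le> x \<Longrightarrow> tail \<nu> x = min 1 (\<integral>\<omega>. max 0 (X \<omega> - x) \<partial>M)"
    and "integrated_tail F y = min 1 (\<integral>\<omega>. max 0 (X \<omega> - y) \<partial>M)"
proof -
  define J where "J x = (\<integral>\<omega>. max 0 (X \<omega> - x) \<partial>M)" for x
  have I: "integrated_tail F x = min 1 (J x)" for x
    unfolding integrated_tail_def J_def using integral_tail_eq_excess[OF X, of x] by (simp add: F)
  then show "integrated_tail F y = min 1 (\<integral>\<omega>. max 0 (X \<omega> - y) \<partial>M)" by (simp add: J_def)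
  have int: "integrable M (\<lambda>\<omega>. max 0 (X \<omega> - x))" for x using X by simp
  have J_mono: "J y \<le> J x" if "x \<le> y" for x y
    unfolding J_def using that by (intro integral_mono int) auto
  have J_lip: "J x \<le> J y + \<bar>x - y\<bar>" for x y
  proof -
    have "J x \<le> (\<integral>\<omega>. max 0 (X \<omega> - y) + \<bar>x - y\<bar> \<partial>M)"
      unfolding J_def by (intro integral_mono int Bochner_Integration.integrable_add) auto
    also have "\<dots> = J y + \<bar>x - y\<bar>"
      by (subst Bochner_Integration.integral_add[OF int]) (simp_all add: J_def prob_space)
    finally show ?thesis .
  qed
  have J_cont: "isCont J x" for x
  proof -
    have "((\<lambda>y. J y - J x) \<longlongrightarrow> 0) (at x)"
    proof (rule Lim_null_comparison)
      show "\<forall>\<^sub>F y in at x. norm (J y - J x) \<le> \<bar>y - x\<bar>"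
      proof (rule always_eventually, rule allI)
        fix y
        show "norm (J y - J x) \<le> \<bar>y - x\<bar>" using J_lip[of y x] J_lip[of x y] by (simp add: abs_le_iff)
      qed
      show "((\<lambda>y. \<bar>y - x\<bar>) \<longlongrightarrow> 0) (at x)"
        by (rule tendsto_eq_intros | simp)+
    qed
    then show ?thesis unfolding isCont_def using LIM_zero_iff by blast
  qed
  have J_top: "(J \<longlongrightarrow> 0) at_top"
  proof -
    have "((\<lambda>x. \<integral>\<omega>. max 0 (X \<omega> - x) \<partial>M) \<longlongrightarrow> (\<integral>\<omega>. 0 \<partial>M)) at_top"
    proof (rule integral_dominated_convergence_at_top[where w = "\<lambda>\<omega>. \<bar>X \<omega>\<bar>"])
      show "\<forall>\<^sub>F x in at_top. AE \<omega> in M. norm (max 0 (X \<omega> - x)) \<le> \<bar>X \<omega>\<bar>"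
        using eventually_ge_at_top[of 0] by eventually_elim auto
      show "AE \<omega> in M. ((\<lambda>x. max 0 (X \<omega> - x)) \<longlongrightarrow> 0) at_top"
      proof (rule AE_I2)
        fix \<omega>
        have "\<forall>\<^sub>F x in at_top. max 0 (X \<omega> - x) = 0"
          using eventually_ge_at_top[of "X \<omega>"] by eventually_elim auto
        then show "((\<lambda>x. max 0 (X \<omega> - x)) \<longlongrightarrow> 0) at_top" by (rule tendsto_eventually)
      qed
    qed (use X in auto)
    then show ?thesis by (simp add: J_def[abs_def])
  qed
  have J_neg: "- x \<le> J x" for x
  proof -
    have "- x = (\<integral>\<omega>. - x \<partial>M)" by (simp add: prob_space)
    also have "\<dots> \<le> J x" unfolding J_def
    proof (intro integral_mono int)
      show "- x \<le> max 0 (X \<omega> - x)" if "\<omega> \<in> space M" for \<omega> using nonneg[OF that] by linarith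
    qed simp
    finally show ?thesis .
  qed
  let ?G = "\<lambda>x. 1 - integrated_tail F x"
  have G: "?G = (\<lambda>x. 1 - min 1 (J x))" by (simp add: I)
  have G_mono: "?G x \<le> ?G y" if "x \<le> y" for x y using J_mono[OF that] by (simp add: I)
  have G_cont: "continuous (at_right x) ?G" for x
  proof -
    have "isCont (\<lambda>x. 1 - min 1 (J x)) x" using J_cont by (intro continuous_intros)
    then show ?thesis unfolding G by (rule continuous_at_imp_continuous_at_within)
  qed
  have G_bot: "(?G \<longlongrightarrow> 0) at_bot"
  proof -
    have "\<forall>\<^sub>F x in at_bot. ?G x = 0"
      using eventually_le_at_bot[of "-1"]
    proof eventually_elim
      case (elim x)
      then show ?case using J_neg[of x] by (simp add: I)
    qed
    then show ?thesis by (rule tendsto_eventually)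
  qed
  have G_top: "(?G \<longlongrightarrow> 1) at_top"
  proof -
    have "((\<lambda>x. 1 - min 1 (J x)) \<longlongrightarrow> 1 - min 1 0) at_top" by (intro tendsto_intros J_top)
    then show ?thesis by (simp add: I)
  qed
  let ?\<mu> = "integrated_tail_distribution F"
  have rd: "real_distribution ?\<mu>"
    unfolding integrated_tail_distribution_def
    by (rule real_distribution_interval_measure[OF G_mono G_cont G_bot G_top])
  interpret \<mu>: real_distribution ?\<mu> by (rule rd)
  have cdf: "cdf ?\<mu> x = 1 - min 1 (J x)" for x
    unfolding integrated_tail_distribution_def
    using cdf_interval_measure[OF G_mono G_cont G_bot] by (simp add: I)
  have m: "max 0 \<in> ?\<mu> \<rightarrow>\<^sub>M (borel :: real measure)" by measurable
  have tail_nonneg: "tail \<nu> x = min 1 (J x)" if "0 \<le> x" for x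
  proof -
    have "tail \<nu> x = measure ?\<mu> (max 0 -` {x<..} \<inter> space ?\<mu>)"
      unfolding tail_def \<nu>_def by (rule measure_distr[OF m]) simp
    also have "max 0 -` {x<..} \<inter> space ?\<mu> = space ?\<mu> - {..x}" using that by auto
    also have "measure ?\<mu> \<dots> = 1 - cdf ?\<mu> x" unfolding cdf_def by (rule \<mu>.prob_compl) simp
    finally show ?thesis by (simp add: cdf)
  qed
  then show "0 \<le> x \<Longrightarrow> tail \<nu> x = min 1 (\<integral>\<omega>. max 0 (X \<omega> - x) \<partial>M)" by (simp add: J_def)
  show "subexponential_halfline \<nu>"
    unfolding subexponential_halfline_def
  proof (intro conjI allI)
    interpret \<nu>: prob_space \<nu> unfolding \<nu>_def by (rule \<mu>.prob_space_distr[OF m])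
    show "real_distribution \<nu>"
      by (intro real_distribution.intro real_distribution_axioms.intro) (simp_all add: \<nu>_def \<nu>.prob_space_axioms[unfolded \<nu>_def])
    show "AE y in \<nu>. 0 \<le> y" unfolding \<nu>_def by (subst AE_distr_iff[OF m]) auto
    show "tail \<nu> x > 0" for x
      using sub by (simp add: subexponential_def Let_def \<nu>_def)
    show "tail (\<nu> \<star> \<nu>) \<sim>[at_top] (\<lambda>x. 2 * tail \<nu> x)"
      using sub by (simp add: subexponential_def Let_def \<nu>_def)
  qed
qed

text \<open>
Joint independence of all single variables is checked on cylinder sets, where independence of the two
paths separates the variables of either kind. Grouping them in pairs preserves independence.
\<close>
lemma (in prob_space) distr_zip_iid:
  fixes \<sigma> \<tau> :: "int \<Rightarrow> 'a \<Rightarrow> real" and f g :: "nat \<Rightarrow> int"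
  assumes \<sigma>: "iid \<sigma>" and \<tau>: "iid \<tau>" and ind: "indep_seqs \<tau> \<sigma>" and f: "inj f" and g: "inj g"
  defines "X \<equiv> \<lambda>n \<omega>. (\<sigma> (f n) \<omega>, \<tau> (g n) \<omega>)"
  shows "(\<lambda>\<omega> n. X n \<omega>) \<in> M \<rightarrow>\<^sub>M (\<Pi>\<^sub>M n\<in>UNIV. borel \<Otimes>\<^sub>M borel)"
    and "distr M (\<Pi>\<^sub>M n\<in>UNIV. borel \<Otimes>\<^sub>M borel) (\<lambda>\<omega> n. X n \<omega>)
      = (\<Pi>\<^sub>M n\<in>UNIV. distr M (borel \<Otimes>\<^sub>M borel) (X 0))"
proof -
  have [measurable]: "\<sigma> n \<in> borel_measurable M" "\<tau> n \<in> borel_measurable M" for n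
    using \<sigma> \<tau> by (auto simp: iid_def indep_vars_def2)
  define Y where "Y p = (if fst p then \<sigma> (f (snd p)) else \<tau> (g (snd p)))" for p :: "bool \<times> nat"
  have Ym [measurable]: "Y p \<in> borel_measurable M" for p by (simp add: Y_def)
  interpret PY: product_prob_space "\<lambda>p. distr M borel (Y p)" UNIV
    by (intro product_prob_spaceI prob_space_distr Ym)
  have "distr M (\<Pi>\<^sub>M p\<in>UNIV. borel) (\<lambda>\<omega> p. Y p \<omega>) = (\<Pi>\<^sub>M p\<in>UNIV. distr M borel (Y p))"
  proof (rule PY.PiM_eq)
    show "sets (distr M (\<Pi>\<^sub>M p\<in>UNIV. borel) (\<lambda>\<omega> p. Y p \<omega>)) = sets (\<Pi>\<^sub>M p\<in>UNIV. distr M borel (Y p))"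
      by (simp cong: sets_PiM_cong)
    fix J :: "(bool \<times> nat) set" and E
    assume J: "finite J" "J \<subseteq> UNIV" and E': "\<And>p. p \<in> J \<Longrightarrow> E p \<in> sets (distr M borel (Y p))"
    then have E: "E p \<in> sets borel" if "p \<in> J" for p using that by simp
    define J1 where "J1 = {n. (True, n) \<in> J}"
    define J2 where "J2 = {n. (False, n) \<in> J}"
    have J_eq: "J = Pair True ` J1 \<union> Pair False ` J2"
    proof (rule set_eqI)
      fix p :: "bool \<times> nat"
      obtain c n where p: "p = (c, n)" by (cases p)
      show "p \<in> J \<longleftrightarrow> p \<in> Pair True ` J1 \<union> Pair False ` J2"
        unfolding p by (cases c) (auto simp: J1_def J2_def)
    qed
    have "finite (Pair True ` J1)" "finite (Pair False ` J2)"
      using J(1) unfolding J_eq by simp_all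
    then have fin: "finite J1" "finite J2"
      by (auto dest: finite_imageD simp: inj_on_def)
    have mY: "(\<lambda>\<omega> p. Y p \<omega>) \<in> M \<rightarrow>\<^sub>M (\<Pi>\<^sub>M p\<in>UNIV. borel)"
      by (rule measurable_PiM_single') (auto simp: space_PiM)
    define A where "A = {h :: int \<Rightarrow> real. \<forall>n\<in>J1. h (f n) \<in> E (True, n)}"
    define B where "B = {h :: int \<Rightarrow> real. \<forall>n\<in>J2. h (g n) \<in> E (False, n)}"
    have A: "A \<in> sets (\<Pi>\<^sub>M n\<in>UNIV. borel)"
    proof -
      have "{h \<in> space (\<Pi>\<^sub>M n\<in>(UNIV :: int set). (borel :: real measure)). \<forall>n\<in>J1. h (f n) \<in> E (True, n)} \<in> sets (\<Pi>\<^sub>M n\<in>UNIV. borel)"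
        using fin E by (intro sets.sets_Collect_finite_All sets_Collect_single') (auto simp: J1_def)
      then show ?thesis by (simp add: A_def space_PiM)
    qed
    have B: "B \<in> sets (\<Pi>\<^sub>M n\<in>UNIV. borel)"
    proof -
      have "{h \<in> space (\<Pi>\<^sub>M n\<in>(UNIV :: int set). (borel :: real measure)). \<forall>n\<in>J2. h (g n) \<in> E (False, n)} \<in> sets (\<Pi>\<^sub>M n\<in>UNIV. borel)"
        using fin E by (intro sets.sets_Collect_finite_All sets_Collect_single') (auto simp: J2_def)
      then show ?thesis by (simp add: B_def space_PiM)
    qed
    have cyl: "prob {\<omega> \<in> space M. \<forall>n\<in>K. Z (k n) \<omega> \<in> H n} = (\<Prod>n\<in>K. prob (Z (k n) -` H n \<inter> space M))"
      if Z: "indep_vars (\<lambda>_. borel) Z UNIV" and k: "inj k" and K: "finite K" and H: "\<And>n. n \<in> K \<Longrightarrow> H n \<in> sets borel"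
      for Z :: "int \<Rightarrow> 'a \<Rightarrow> real" and k :: "nat \<Rightarrow> int" and K and H :: "nat \<Rightarrow> real set"
    proof (cases "K = {}")
      case False
      have inv: "the_inv k (k n) = n" for n using k by (rule the_inv_f_f)
      have "prob (\<Inter>i\<in>k ` K. Z i -` H (the_inv k i) \<inter> space M) = (\<Prod>i\<in>k ` K. prob (Z i -` H (the_inv k i) \<inter> space M))"
        using False K H by (intro indep_varsD[OF Z]) (auto simp: inv)
      also have "(\<Inter>i\<in>k ` K. Z i -` H (the_inv k i) \<inter> space M) = {\<omega> \<in> space M. \<forall>n\<in>K. Z (k n) \<omega> \<in> H n}"
        using False by (auto simp: inv)
      also have "(\<Prod>i\<in>k ` K. prob (Z i -` H (the_inv k i) \<inter> space M)) = (\<Prod>n\<in>K. prob (Z (k n) -` H n \<inter> space M))"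
        using k by (subst prod.reindex) (auto simp: inv inj_on_def)
      finally show ?thesis .
    qed (simp add: prob_space)
    have pre: "(\<lambda>\<omega> p. Y p \<omega>) -` prod_emb UNIV (\<lambda>p. distr M borel (Y p)) J (Pi\<^sub>E J E) \<inter> space M
      = (\<lambda>\<omega>. (\<lambda>n. \<tau> n \<omega>, \<lambda>n. \<sigma> n \<omega>)) -` (B \<times> A) \<inter> space M"
    proof -
      have "(\<forall>p\<in>J. Y p \<omega> \<in> E p) \<longleftrightarrow> (\<forall>n\<in>J1. \<sigma> (f n) \<omega> \<in> E (True, n)) \<and> (\<forall>n\<in>J2. \<tau> (g n) \<omega> \<in> E (False, n))" for \<omega>
        unfolding J_eq by (auto simp: Y_def ball_Un)
      then show ?thesis by (auto simp: prod_emb_def A_def B_def PiE_iff space_PiM)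
    qed
    have "emeasure (distr M (\<Pi>\<^sub>M p\<in>UNIV. borel) (\<lambda>\<omega> p. Y p \<omega>)) (prod_emb UNIV (\<lambda>p. distr M borel (Y p)) J (Pi\<^sub>E J E))
      = emeasure M ((\<lambda>\<omega>. (\<lambda>n. \<tau> n \<omega>, \<lambda>n. \<sigma> n \<omega>)) -` (B \<times> A) \<inter> space M)"
    proof (subst emeasure_distr[OF mY])
      have "prod_emb UNIV (\<lambda>p. distr M borel (Y p)) J (Pi\<^sub>E J E) \<in> sets (\<Pi>\<^sub>M p\<in>UNIV. distr M borel (Y p))"
        using J E' by (intro sets_PiM_I) auto
      also have "sets (\<Pi>\<^sub>M p\<in>UNIV. distr M borel (Y p)) = sets (\<Pi>\<^sub>M p\<in>UNIV. borel)"
        by (intro sets_PiM_cong) auto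
      finally show "prod_emb UNIV (\<lambda>p. distr M borel (Y p)) J (Pi\<^sub>E J E) \<in> sets (\<Pi>\<^sub>M p\<in>UNIV. borel)" .
    qed (simp only: pre)
    also have "\<dots> = ennreal (prob ((\<lambda>\<omega> n. \<tau> n \<omega>) -` B \<inter> space M) * prob ((\<lambda>\<omega> n. \<sigma> n \<omega>) -` A \<inter> space M))"
      using indep_varD[OF ind[unfolded indep_seqs_def] B A] by (simp add: emeasure_eq_measure)
    also have "(\<lambda>\<omega> n. \<tau> n \<omega>) -` B \<inter> space M = {\<omega> \<in> space M. \<forall>n\<in>J2. \<tau> (g n) \<omega> \<in> E (False, n)}" by (auto simp: B_def)
    also have "(\<lambda>\<omega> n. \<sigma> n \<omega>) -` A \<inter> space M = {\<omega> \<in> space M. \<forall>n\<in>J1. \<sigma> (f n) \<omega> \<in> E (True, n)}" by (auto simp: A_def)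
    also have "prob {\<omega> \<in> space M. \<forall>n\<in>J2. \<tau> (g n) \<omega> \<in> E (False, n)} = (\<Prod>n\<in>J2. prob (\<tau> (g n) -` E (False, n) \<inter> space M))"
      using \<tau> E fin by (intro cyl[OF _ g]) (auto simp: iid_def J2_def)
    also have "prob {\<omega> \<in> space M. \<forall>n\<in>J1. \<sigma> (f n) \<omega> \<in> E (True, n)} = (\<Prod>n\<in>J1. prob (\<sigma> (f n) -` E (True, n) \<inter> space M))"
      using \<sigma> E fin by (intro cyl[OF _ f]) (auto simp: iid_def J1_def)
    also have "(\<Prod>n\<in>J2. prob (\<tau> (g n) -` E (False, n) \<inter> space M)) * (\<Prod>n\<in>J1. prob (\<sigma> (f n) -` E (True, n) \<inter> space M))
        = (\<Prod>p\<in>J. prob (Y p -` E p \<inter> space M))"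
    proof -
      have "(\<Prod>p\<in>J. prob (Y p -` E p \<inter> space M))
        = (\<Prod>p\<in>Pair True ` J1. prob (Y p -` E p \<inter> space M)) * (\<Prod>p\<in>Pair False ` J2. prob (Y p -` E p \<inter> space M))"
        unfolding J_eq using fin by (intro prod.union_disjoint) auto
      also have "(\<Prod>p\<in>Pair True ` J1. prob (Y p -` E p \<inter> space M)) = (\<Prod>n\<in>J1. prob (\<sigma> (f n) -` E (True, n) \<inter> space M))"
        by (subst prod.reindex) (auto simp: inj_on_def Y_def)
      also have "(\<Prod>p\<in>Pair False ` J2. prob (Y p -` E p \<inter> space M)) = (\<Prod>n\<in>J2. prob (\<tau> (g n) -` E (False, n) \<inter> space M))"
        by (subst prod.reindex) (auto simp: inj_on_def Y_def)
      finally show ?thesis by (simp add: mult.commute)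
    qed
    also have "ennreal (\<Prod>p\<in>J. prob (Y p -` E p \<inter> space M)) = (\<Prod>p\<in>J. emeasure (distr M borel (Y p)) (E p))"
      using E by (simp add: emeasure_distr emeasure_eq_measure prod_ennreal)
    finally show "emeasure (distr M (\<Pi>\<^sub>M p\<in>UNIV. borel) (\<lambda>\<omega> p. Y p \<omega>)) (prod_emb UNIV (\<lambda>p. distr M borel (Y p)) J (Pi\<^sub>E J E))
      = (\<Prod>p\<in>J. emeasure (distr M borel (Y p)) (E p))" .
  qed
  then have Yind: "indep_vars (\<lambda>_. borel) Y UNIV"
    by (subst indep_vars_iff_distr_eq_PiM') (auto simp: restrict_UNIV)
  have "indep_vars (\<lambda>n. \<Pi>\<^sub>M p\<in>{(True, n), (False, n)}. borel) (\<lambda>n \<omega>. restrict (\<lambda>p. Y p \<omega>) {(True, n), (False, n)}) UNIV"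
    by (rule indep_vars_restrict[OF Yind]) (auto simp: disjoint_family_on_def)
  then have "indep_vars (\<lambda>n. borel \<Otimes>\<^sub>M borel) (\<lambda>n \<omega>. (\<lambda>h. (h (True, n), h (False, n))) (restrict (\<lambda>p. Y p \<omega>) {(True, n), (False, n)})) UNIV"
    by (rule indep_vars_compose2) measurable
  then have Xind: "indep_vars (\<lambda>n. borel \<Otimes>\<^sub>M borel) X UNIV"
    by (simp add: Y_def X_def)
  have Xm: "X n \<in> M \<rightarrow>\<^sub>M borel \<Otimes>\<^sub>M borel" for n unfolding X_def by measurable
  show mX: "(\<lambda>\<omega> n. X n \<omega>) \<in> M \<rightarrow>\<^sub>M (\<Pi>\<^sub>M n\<in>UNIV. borel \<Otimes>\<^sub>M borel)"
    using Xm by (intro measurable_PiM_single') (auto simp: space_PiM space_pair_measure)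
  have pair: "distr M (borel \<Otimes>\<^sub>M borel) (X n) = distr M borel (\<sigma> 0) \<Otimes>\<^sub>M distr M borel (\<tau> 0)" for n
  proof -
    have ind': "indep_var borel (\<tau> (g n)) borel (\<sigma> (f n))"
      using indep_var_compose[OF ind[unfolded indep_seqs_def], of "\<lambda>h. h (g n)" borel "\<lambda>h. h (f n)" borel]
      by (simp add: comp_def)
    interpret P\<sigma>: prob_space "distr M borel (\<sigma> (f n))" by (rule prob_space_distr) simp
    interpret P\<tau>: prob_space "distr M borel (\<tau> (g n))" by (rule prob_space_distr) simp
    have "distr M borel (\<sigma> (f n)) \<Otimes>\<^sub>M distr M borel (\<tau> (g n)) = distr M (borel \<Otimes>\<^sub>M borel) (X n)"
    proof (rule pair_measure_eqI)
      fix A B assume "A \<in> sets (distr M borel (\<sigma> (f n)))" "B \<in> sets (distr M borel (\<tau> (g n)))"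
      then have [measurable]: "A \<in> sets borel" "B \<in> sets borel" by simp_all
      have "emeasure (distr M (borel \<Otimes>\<^sub>M borel) (X n)) (A \<times> B) = emeasure M (X n -` (A \<times> B) \<inter> space M)"
        by (rule emeasure_distr[OF Xm]) simp
      also have "X n -` (A \<times> B) \<inter> space M = (\<lambda>\<omega>. (\<tau> (g n) \<omega>, \<sigma> (f n) \<omega>)) -` (B \<times> A) \<inter> space M"
        by (auto simp: X_def)
      also have "emeasure M \<dots> = ennreal (prob (\<tau> (g n) -` B \<inter> space M) * prob (\<sigma> (f n) -` A \<inter> space M))"
        using indep_varD[OF ind', of B A] by (simp add: emeasure_eq_measure)
      finally show "emeasure (distr M borel (\<sigma> (f n))) A * emeasure (distr M borel (\<tau> (g n))) B
          = emeasure (distr M (borel \<Otimes>\<^sub>M borel) (X n)) (A \<times> B)"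
        by (simp add: emeasure_distr emeasure_eq_measure ennreal_mult mult.commute)
    qed (auto simp: P\<sigma>.sigma_finite_measure_axioms P\<tau>.sigma_finite_measure_axioms cong: sets_pair_measure_cong)
    moreover have "distr M borel (\<sigma> (f n)) = distr M borel (\<sigma> 0)" "distr M borel (\<tau> (g n)) = distr M borel (\<tau> 0)"
      using \<sigma> \<tau> by (auto simp: iid_def)
    ultimately show ?thesis by simp
  qed
  have "distr M (\<Pi>\<^sub>M n\<in>UNIV. borel \<Otimes>\<^sub>M borel) (\<lambda>\<omega> n. X n \<omega>) = (\<Pi>\<^sub>M n\<in>UNIV. distr M (borel \<Otimes>\<^sub>M borel) (X n))"
    using Xind Xm by (subst (asm) indep_vars_iff_distr_eq_PiM') (auto simp: restrict_UNIV)
  then show "distr M (\<Pi>\<^sub>M n\<in>UNIV. borel \<Otimes>\<^sub>M borel) (\<lambda>\<omega> n. X n \<omega>) = (\<Pi>\<^sub>M n\<in>UNIV. distr M (borel \<Otimes>\<^sub>M borel) (X 0))"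
    unfolding pair .
qed


lemma stationary_maximal_dater_gt_iff:
  assumes "m \<ge> 1"
  shows "stationary_maximal_dater m s t > ereal x \<longleftrightarrow> (\<exists>k. maximal_dater m s t k > x)"
proof -
  have "incseq (\<lambda>k. ereal (maximal_dater m s t k))"
    using maximal_dater_mono[OF assms] by (auto simp: incseq_def)
  then have "(\<lambda>k. ereal (maximal_dater m s t k)) \<longlonglongrightarrow> (SUP k. ereal (maximal_dater m s t k))"
    by (rule LIMSEQ_SUP)
  then have "stationary_maximal_dater m s t = (SUP k. ereal (maximal_dater m s t k))"
    unfolding stationary_maximal_dater_def by (rule limI)
  then show ?thesis by (simp add: less_SUP_iff)
qed

theorem theorem13:
  fixes M :: "'a measure" and \<tau> \<sigma> :: "int \<Rightarrow> 'a \<Rightarrow> real"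
    and F :: "real measure" and a b :: real and m :: nat
  assumes "prob_space M"
    and "m \<ge> 1"
    and "\<And>n \<omega>. \<omega> \<in> space M \<Longrightarrow> \<tau> n \<omega> \<ge> 0"
    and "\<And>n \<omega>. \<omega> \<in> space M \<Longrightarrow> \<sigma> n \<omega> \<ge> 0"
    and "prob_space.iid M \<tau>"
    and "prob_space.iid M \<sigma>"
    and "prob_space.indep_seqs M \<tau> \<sigma>"
    and "integrable M (\<tau> 1)" and "integral\<^sup>L M (\<tau> 1) = a"
    and "integrable M (\<sigma> 1)" and "integral\<^sup>L M (\<sigma> 1) = b"
    and "b / (real m * a) \<in> {0<..<1}"
    and "real_distribution F"
    and "\<And>x. measure M {\<omega> \<in> space M. \<sigma> 1 \<omega> > x} = tail F x"
    and "subexponential F"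
    and "subexponential (integrated_tail_distribution F)"
  shows "(\<lambda>x. measure M {\<omega> \<in> space M.
              stationary_maximal_dater m (\<lambda>n. \<sigma> n \<omega>) (\<lambda>n. \<tau> n \<omega>) > ereal x})
     \<sim>[at_top]
         (\<lambda>x. 1 / a * integrated_tail F x +
              max 0 (1 / (real m * a - b) - 1 / a) *
                integrated_tail F (b * x / (b - (real m - 1) * a)))"
proof -
  interpret prob_space M by fact
  have [measurable]: "\<sigma> n \<in> borel_measurable M" "\<tau> n \<in> borel_measurable M" for n
    using assms(5,6) by (auto simp: iid_def indep_vars_def2)
  have same_law: "integral\<^sup>L M (\<lambda>\<omega>. h (Z n \<omega>)) = integral\<^sup>L M (\<lambda>\<omega>. h (Z k \<omega>))"
      "integrable M (\<lambda>\<omega>. h (Z n \<omega>)) \<longleftrightarrow> integrable M (\<lambda>\<omega>. h (Z k \<omega>))"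
    if Z: "iid Z" and [measurable]: "h \<in> borel_measurable borel" for Z :: "int \<Rightarrow> 'a \<Rightarrow> real" and h :: "real \<Rightarrow> real" and n k
  proof -
    have [measurable]: "Z n \<in> borel_measurable M" for n using Z by (auto simp: iid_def indep_vars_def2)
    have d0: "distr M borel (Z n) = distr M borel (Z 0)" for n using Z unfolding iid_def by blast
    have d: "distr M borel (Z n) = distr M borel (Z k)" by (rule trans[OF d0 d0[symmetric]])
    show "integral\<^sup>L M (\<lambda>\<omega>. h (Z n \<omega>)) = integral\<^sup>L M (\<lambda>\<omega>. h (Z k \<omega>))"
      using integral_distr[of "Z n" M borel h] integral_distr[of "Z k" M borel h] d by simp
    show "integrable M (\<lambda>\<omega>. h (Z n \<omega>)) \<longleftrightarrow> integrable M (\<lambda>\<omega>. h (Z k \<omega>))"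
      using integrable_distr_eq[of "Z n" M borel h] integrable_distr_eq[of "Z k" M borel h] d by simp
  qed
  have a_nn: "0 \<le> a" and b_nn: "0 \<le> b"
    unfolding assms(9,11)[symmetric] by (rule Bochner_Integration.integral_nonneg_AE, rule AE_I2, rule assms(3,4), assumption)+
  have pos: "0 < b" "0 < a" "b < real m * a"
  proof -
    have r: "0 < b / (real m * a)" "b / (real m * a) < 1" using assms(12) by auto
    then have "b \<noteq> 0" "a \<noteq> 0" by auto
    then show "0 < b" "0 < a" using a_nn b_nn by auto
    then show "b < real m * a" using r(2) assms(2) by (simp add: divide_less_eq)
  qed
  define f where "f n = - int n" for n
  define g where "g n = - int n - 1" for n
  define X where "X n \<omega> = (\<sigma> (f n) \<omega>, \<tau> (g n) \<omega>)" for n \<omega>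
  define D where "D = distr M (borel \<Otimes>\<^sub>M borel) (X 0)"
  \<comment> \<open>Truncation at \<open>0\<close> makes the coordinates nonnegative everywhere and changes nothing on
  \<open>M\<close>.\<close>
  define sv where "sv p = max 0 (fst p)" for p :: "real \<times> real"
  define tv where "tv p = max 0 (snd p)" for p :: "real \<times> real"
  have inj: "inj f" "inj g" by (auto simp: inj_def f_def g_def)
  note zip = distr_zip_iid[OF assms(6,5,7) inj, folded X_def D_def]
  have X0 [measurable]: "X 0 \<in> M \<rightarrow>\<^sub>M borel \<Otimes>\<^sub>M borel" unfolding X_def[abs_def] by measurable
  have D_int: "integral\<^sup>L D h = (\<integral>\<omega>. h (X 0 \<omega>) \<partial>M)" "integrable D h \<longleftrightarrow> integrable M (\<lambda>\<omega>. h (X 0 \<omega>))"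
    if "h \<in> borel_measurable (borel \<Otimes>\<^sub>M borel)" for h :: "real \<times> real \<Rightarrow> real"
    unfolding D_def using integral_distr[OF X0 that] integrable_distr_eq[OF X0 that] by auto
  have [measurable]: "sv \<in> borel_measurable (borel \<Otimes>\<^sub>M borel)" "tv \<in> borel_measurable (borel \<Otimes>\<^sub>M borel)"
    unfolding sv_def[abs_def] tv_def[abs_def] by measurable
  have svX: "sv (X n \<omega>) = \<sigma> (f n) \<omega>" and tvX: "tv (X n \<omega>) = \<tau> (g n) \<omega>" if "\<omega> \<in> space M" for n \<omega>
    using assms(3,4)[OF that] by (auto simp: sv_def tv_def X_def max_def)
  have sv_law: "integral\<^sup>L D (\<lambda>v. h (sv v)) = (\<integral>\<omega>. h (\<sigma> 1 \<omega>) \<partial>M)"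
      "integrable D (\<lambda>v. h (sv v)) \<longleftrightarrow> integrable M (\<lambda>\<omega>. h (\<sigma> 1 \<omega>))"
    if [measurable]: "h \<in> borel_measurable borel" for h :: "real \<Rightarrow> real"
  proof -
    have "(\<integral>\<omega>. h (sv (X 0 \<omega>)) \<partial>M) = (\<integral>\<omega>. h (\<sigma> (f 0) \<omega>) \<partial>M)"
      by (rule Bochner_Integration.integral_cong) (simp_all add: svX)
    then show "integral\<^sup>L D (\<lambda>v. h (sv v)) = (\<integral>\<omega>. h (\<sigma> 1 \<omega>) \<partial>M)"
      using D_int(1)[of "\<lambda>v. h (sv v)"] same_law(1)[OF assms(6) that, of "f 0" 1] by simp
    have "integrable M (\<lambda>\<omega>. h (sv (X 0 \<omega>))) \<longleftrightarrow> integrable M (\<lambda>\<omega>. h (\<sigma> (f 0) \<omega>))"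
      by (rule Bochner_Integration.integrable_cong) (simp_all add: svX)
    then show "integrable D (\<lambda>v. h (sv v)) \<longleftrightarrow> integrable M (\<lambda>\<omega>. h (\<sigma> 1 \<omega>))"
      using D_int(2)[of "\<lambda>v. h (sv v)"] same_law(2)[OF assms(6) that, of "f 0" 1] by simp
  qed
  have tv_law: "integral\<^sup>L D tv = (\<integral>\<omega>. \<tau> 1 \<omega> \<partial>M)" "integrable D tv \<longleftrightarrow> integrable M (\<tau> 1)"
  proof -
    have "(\<integral>\<omega>. tv (X 0 \<omega>) \<partial>M) = (\<integral>\<omega>. \<tau> (g 0) \<omega> \<partial>M)"
      by (rule Bochner_Integration.integral_cong) (simp_all add: tvX)
    then show "integral\<^sup>L D tv = (\<integral>\<omega>. \<tau> 1 \<omega> \<partial>M)"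
      using D_int(1)[of tv] same_law(1)[OF assms(5), of "\<lambda>x. x" "g 0" 1] by simp
    have "integrable M (\<lambda>\<omega>. tv (X 0 \<omega>)) \<longleftrightarrow> integrable M (\<lambda>\<omega>. \<tau> (g 0) \<omega>)"
      by (rule Bochner_Integration.integrable_cong) (simp_all add: tvX)
    then show "integrable D tv \<longleftrightarrow> integrable M (\<tau> 1)"
      using D_int(2)[of tv] same_law(2)[OF assms(5), of "\<lambda>x. x" "g 0" 1] by simp
  qed
  define \<nu> where "\<nu> = distr (integrated_tail_distribution F) borel (max 0)"
  have \<sigma>1: "0 \<le> \<sigma> 1 \<omega>" if "\<omega> \<in> space M" for \<omega> using assms(4)[OF that] .
  have sub: "subexponential_halfline \<nu>"
      "\<And>x. 0 \<le> x \<Longrightarrow> tail \<nu> x = min 1 (\<integral>\<omega>. max 0 (\<sigma> 1 \<omega> - x) \<partial>M)"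
      "\<And>y. integrated_tail F y = min 1 (\<integral>\<omega>. max 0 (\<sigma> 1 \<omega> - y) \<partial>M)"
    unfolding \<nu>_def
    using subexponential_integrated_tail[of "\<sigma> 1" F, OF assms(10) \<sigma>1 assms(14) assms(16)] by blast+
  interpret PD: prob_space D unfolding D_def by (rule prob_space_distr) simp
  interpret Q: iid_coordinates D
  proof
    show "space D = UNIV" by (simp add: D_def space_pair_measure)
  qed
  interpret Q: service_law D sv
  proof unfold_locales
    show "integrable D sv" using sv_law(2)[of "\<lambda>x. x"] assms(10) by simp
    show "0 \<le> sv v" for v by (simp add: sv_def)
  qed
  interpret sub: subexponential_halfline \<nu> by (rule sub(1))
  have excess: "Q.excess y = (\<integral>\<omega>. max 0 (\<sigma> 1 \<omega> - y) \<partial>M)" for y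
    unfolding Q.excess_def by (rule sv_law(1)) measurable
  interpret Q: heavy_queue D sv tv \<nu> a b m
  proof unfold_locales
    show "tail \<nu> x = min 1 (Q.excess x)" if "0 \<le> x" for x using sub(2)[OF that] by (simp add: excess)
    show "integrable D tv" using tv_law(2) assms(8) by simp
    show "0 \<le> tv v" for v by (simp add: tv_def)
    show "integral\<^sup>L D sv = b" using sv_law(1)[of "\<lambda>x. x"] assms(11) by simp
    show "integral\<^sup>L D tv = a" using tv_law(1) assms(9) by simp
    show "1 \<le> m" by (rule assms(2))
    show "b < real m * a" by (rule pos(3))
  qed
  have Xm: "(\<lambda>\<omega> n. X n \<omega>) \<in> M \<rightarrow>\<^sub>M Q.S"
  proof -
    have "sets Q.S = sets (\<Pi>\<^sub>M n\<in>(UNIV :: nat set). (borel :: real measure) \<Otimes>\<^sub>M (borel :: real measure))"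
      by (intro sets_PiM_cong refl) (simp add: D_def)
    with zip(1) show ?thesis by (simp cong: measurable_cong_sets)
  qed
  have law: "distr M Q.S (\<lambda>\<omega> n. X n \<omega>) = Q.S"
  proof -
    have "distr M Q.S (\<lambda>\<omega> n. X n \<omega>)
        = distr M (\<Pi>\<^sub>M n\<in>UNIV. borel \<Otimes>\<^sub>M borel) (\<lambda>\<omega> n. X n \<omega>)"
      by (intro distr_cong refl sets_PiM_cong) (simp add: D_def)
    with zip(2) show ?thesis by simp
  qed
  have dater: "Q.past_dater k (\<lambda>n. X n \<omega>) = maximal_dater m (\<lambda>n. \<sigma> n \<omega>) (\<lambda>n. \<tau> n \<omega>) k"
    if "\<omega> \<in> space M" for k \<omega>
    unfolding Q.past_dater_def
    by (rule maximal_dater_cong) (simp_all add: Q.sseq_def Q.tseq_def svX[OF that] tvX[OF that] f_def g_def)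
  have prob: "measure M {\<omega> \<in> space M. stationary_maximal_dater m (\<lambda>n. \<sigma> n \<omega>) (\<lambda>n. \<tau> n \<omega>) > ereal x}
      = measure Q.S (Q.overflow x)" for x
  proof -
    have "measure Q.S (Q.overflow x) = measure (distr M Q.S (\<lambda>\<omega> n. X n \<omega>)) (Q.overflow x)"
      unfolding law ..
    also have "\<dots> = measure M ((\<lambda>\<omega> n. X n \<omega>) -` Q.overflow x \<inter> space M)"
      by (rule measure_distr[OF Xm Q.sets_overflow])
    also have "(\<lambda>\<omega> n. X n \<omega>) -` Q.overflow x \<inter> space M
        = {\<omega> \<in> space M. stationary_maximal_dater m (\<lambda>n. \<sigma> n \<omega>) (\<lambda>n. \<tau> n \<omega>) > ereal x}"
      by (auto simp: Q.overflow_def dater stationary_maximal_dater_gt_iff[OF assms(2)])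
    finally show ?thesis ..
  qed
  let ?rhs = "\<lambda>x. 1 / a * integrated_tail F x + max 0 (1 / (real m * a - b) - 1 / a) *
                integrated_tail F (b * x / (b - (real m - 1) * a))"
  have "\<forall>\<^sub>F x in at_top. Q.excess x < 1" using Q.excess_tendsto_0 by (rule order_tendstoD) simp
  then have rhs: "\<forall>\<^sub>F x in at_top. Q.fluid_tail x = ?rhs x"
    using eventually_ge_at_top[of 0]
  proof eventually_elim
    case (elim x)
    have I: "integrated_tail F y = min 1 (Q.excess y)" for y by (simp add: sub(3) excess)
    show ?case
    proof (cases "1 / (real m * a - b) - 1 / a \<le> 0")
      case True
      then show ?thesis using Q.fluid_tail_eq[OF pos(1) elim(2)] elim(1) by (simp add: I)
    next
      case False
      have d: "0 < real m * a - b" using pos by simp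
      then have "real m * a - b < a" using False pos by (simp add: field_simps)
      then have D: "0 < b - (real m - 1) * a" by (simp add: algebra_simps)
      have "b - (real m - 1) * a \<le> b" using assms(2) pos by simp
      then have "x * (b - (real m - 1) * a) \<le> x * b" using elim(2) by (intro mult_left_mono) auto
      then have "x \<le> b * x / (b - (real m - 1) * a)" using D by (simp add: le_divide_eq mult.commute)
      then have "Q.excess (b * x / (b - (real m - 1) * a)) \<le> Q.excess x" by (rule Q.excess_mono)
      then show ?thesis using Q.fluid_tail_eq[OF pos(1) elim(2)] elim(1) by (simp add: I)
    qed
  qed
  show ?thesis
    unfolding prob using asymp_equiv_transfer[OF Q.overflow_equiv _ rhs] by simp
qed

end
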